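(* Let $n\ge1$ be an integer, and let $\alpha=a/b\in(0,2)$ and $\nu=e/f>0$ be rational numbers with $a,b,e,f\in\mathbb{N}$, $\gcd(a,b)=\gcd(e,f)=1$. Suppose that one of the following conditions holds: (i) $a$ is not divisible by $f$; (ii) $n$ is an odd integer and $a/f$ is an even integer; (iii) $n$ is an even integer, $a$ and $f$ are both even integers and $a/f$ is an odd integer. Then for $r>0$ $$q_{\alpha,\nu,n}(r)=\frac{1}{2^n\pi^{\frac n2}\Gamma(\nu)}\left\{\frac{r^{\alpha\nu-n}}{2^{\alpha\nu-n}}A_{1;\alpha,\nu,n}(r^\alpha)+A_{2;\alpha,\nu,n}(r^2)\right\},$$ where $A_{1;\alpha,\nu,n}(z)$ and $A_{2;\alpha,\nu,n}(z)$ are entire functions given by $$A_{1;\alpha,\nu,n}(z)=\sum_{l=0}^\infty\frac{(-1)^l}{l!}\Gamma(\nu+l)\frac{\Gamma\left(\frac{n-\alpha(\nu+l)}{2}\right)}{\Gamma\left(\frac{\alpha(\nu+l)}{2}\right)}\frac{z^l}{2^{\alpha l}},$$ $$A_{2;\alpha,\nu,n}(z)=\frac2\alpha\sum_{j=0}^\infty\frac{(-1)^j}{j!}\frac{\Gamma\left(\frac{n+2j}{\alpha}\right)}{\Gamma\left(\frac{n+2j}{2}\right)}\Gamma\left(\frac{\alpha\nu-n-2j}{\alpha}\right)\frac{z^j}{2^{2j}}.$$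
   Context: $\Vert\cdot\Vert$ is the Euclidean norm on $\mathbb{R}^n$. For an integer $n\ge1$, $\alpha\in(0,2]$, $\nu>0$, $p_{\alpha,\nu,n}$ denotes the probability density function on $\mathbb{R}^n$ whose characteristic function is $\int_{\mathbb{R}^n}e^{i\mathbf{x}\cdot\boldsymbol{t}}p_{\alpha,\nu,n}(\mathbf{x})\,d^n\mathbf{x}=(1+\Vert\boldsymbol{t}\Vert^\alpha)^{-\nu}$ for all $\boldsymbol{t}\in\mathbb{R}^n$. It is a radial function; one takes the version which is continuous on $\mathbb{R}^n\setminus\{\mathbf{0}\}$, and $q_{\alpha,\nu,n}(r)$, $r>0$, denotes the value of $p_{\alpha,\nu,n}(\mathbf{x})$ at points with $\Vert\mathbf{x}\Vert=r$. $\mathbb{N}=\{1,2,\ldots\}$. *)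

theory Defs
  imports "HOL-Probability.Probability" "HOL-Complex_Analysis.Complex_Analysis"
begin

text \<open>
  Densities are determined only up to null sets, and continuity off the origin selects the
  version.  The value \<open>p 0\<close> stays arbitrary, as the density may be unbounded near \<open>0\<close>.
\<close>

definition linnik_density :: "real \<Rightarrow> real \<Rightarrow> (real ^ 'n \<Rightarrow> real) \<Rightarrow> bool" where
  "linnik_density \<alpha> \<nu> p \<longleftrightarrow>
     p \<in> borel_measurable lborel \<and> (\<forall>x. 0 \<le> p x) \<and>
     prob_space (density lborel (\<lambda>x. ennreal (p x))) \<and>
     (\<forall>t. (LINT x|lborel. exp (\<i> * complex_of_real (x \<bullet> t)) * complex_of_real (p x)) =
          complex_of_real ((1 + norm t powr \<alpha>) powr (- \<nu>))) \<and>
     continuous_on (UNIV - {0}) p"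

definition radial_value :: "(real ^ 'n \<Rightarrow> real) \<Rightarrow> real \<Rightarrow> real" where
  "radial_value p r = (THE y. \<forall>x. norm x = r \<longrightarrow> p x = y)"

text \<open>
  The library's \<open>Gamma\<close> is \<open>0\<close> at the nonpositive integers.  A pole occurs below only if
  \<open>\<alpha> * (\<nu> + l) = n + 2 * k\<close> for some naturals \<open>l\<close> and \<open>k\<close>.
\<close>

definition A1_term :: "real \<Rightarrow> real \<Rightarrow> nat \<Rightarrow> complex \<Rightarrow> nat \<Rightarrow> complex" where
  "A1_term \<alpha> \<nu> n z l =
     complex_of_real ((-1) ^ l / fact l * Gamma (\<nu> + real l) *
       (Gamma ((real n - \<alpha> * (\<nu> + real l)) / 2) / Gamma (\<alpha> * (\<nu> + real l) / 2)))
     * (z ^ l / complex_of_real (2 powr (\<alpha> * real l)))"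

definition A1 :: "real \<Rightarrow> real \<Rightarrow> nat \<Rightarrow> complex \<Rightarrow> complex" where
  "A1 \<alpha> \<nu> n z = (\<Sum>l. A1_term \<alpha> \<nu> n z l)"

definition A2_term :: "real \<Rightarrow> real \<Rightarrow> nat \<Rightarrow> complex \<Rightarrow> nat \<Rightarrow> complex" where
  "A2_term \<alpha> \<nu> n z j =
     complex_of_real ((-1) ^ j / fact j *
       (Gamma ((real n + 2 * real j) / \<alpha>) / Gamma ((real n + 2 * real j) / 2)) *
       Gamma ((\<alpha> * \<nu> - real n - 2 * real j) / \<alpha>))
     * (z ^ j / 2 ^ (2 * j))"

definition A2 :: "real \<Rightarrow> real \<Rightarrow> nat \<Rightarrow> complex \<Rightarrow> complex" where
  "A2 \<alpha> \<nu> n z = complex_of_real (2 / \<alpha>) * (\<Sum>j. A2_term \<alpha> \<nu> n z j)"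

end

theory Submission
  imports Defs "HOL-Real_Asymp.Real_Asymp"
begin

text \<open>
  The density is compared with the series through their Gaussian integrals.  Integrating the
  characteristic function against Gaussians modulated by \<open>cos (y \<bullet> t)\<close> gives the Gaussian means of \<open>p\<close> around \<open>y\<close>;
  they depend on \<open>norm y\<close> only, hence \<open>p\<close> is radial.  For \<open>y = 0\<close> the mean with parameter \<open>s\<close> is a
  Laplace transform in the variable \<open>u = (norm x)\<^sup>2\<close>, equal up to a factor to
  \<open>I(w) = \<integral> (1 + v powr \<beta>) powr -\<nu> * v powr (N - 1) * exp (- w v) dv\<close> over \<open>v > 0\<close>, where \<open>\<beta> = \<alpha> / 2\<close>,
  \<open>N = n / 2\<close> and \<open>w = 1 / (4 s)\<close>.  The claimed series grow slowly enough to be transformed term by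
  term, and the result is the expansion of \<open>I(w)\<close> obtained by splitting the integral at a point
  \<open>M > 1\<close>, expanding \<open>exp (- w v)\<close> below \<open>M\<close> and the binomial above \<open>M\<close>, and exchanging the two sums.
  The exchange is absolutely convergent because, by the arithmetic hypotheses, the denominators
  \<open>N + j - \<beta> (\<nu> + l)\<close> are bounded away from \<open>0\<close>.  Laplace transforms determine continuous functions
  by the Weierstrass approximation theorem.
\<close>

section \<open>Integrals of powers and exponentials\<close>

text \<open>The characteristic function need not be integrable, so Fourier inversion is not directly
  available; a Gaussian weight makes all integrals absolutely convergent and still determines a
  density that is continuous off the origin. Neither expansion can be integrated over the whole
  half-line: the exponential series produces divergent integrals at infinity, and the binomial
  series in powers \<open>v powr (- (\<beta> * (\<nu> + l)))\<close> diverges for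
  \<open>v < 1\<close>. After the split, each half has a closed Gamma or Beta value only while its
  exponent lies in a convergence range. The continuation beyond that range uses partial integration,
  one unit shift at a time, in place of contour integrals. Exchanging the sums needs more than
  nonvanishing denominators, since for general real parameters they could come arbitrarily close to
  0. Rationality makes each of them a nonzero multiple of \<open>1 / (2 * b * f)\<close>; this is
  the origin of \<open>\<delta>\<close>, and it also keeps every Gamma value off the poles.\<close>

lemma set_integral_FTC_Ioo:
  fixes f F :: "real \<Rightarrow> real"
  assumes "a < b"
    and F: "\<And>x. a < x \<Longrightarrow> x < b \<Longrightarrow> (F has_real_derivative f x) (at x)"
    and f: "\<And>x. a < x \<Longrightarrow> x < b \<Longrightarrow> isCont f x"
    and int: "set_integrable lborel {a<..<b} f"
    and A: "(F \<longlongrightarrow> A) (at_right a)" and B: "(F \<longlongrightarrow> B) (at_left b)"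
  shows "(LBINT x:{a<..<b}. f x) = B - A"
proof -
  have [simp]: "einterval (ereal a) (ereal b) = {a<..<b}"
    by (auto simp: einterval_iff)
  have "(LBINT x=ereal a..ereal b. f x) = B - A"
    by (rule interval_integral_FTC_integrable[where F=F])
       (use assms in \<open>auto simp: has_real_derivative_iff_has_vector_derivative
          ereal_tendsto_simps1 ereal_tendsto_simps2\<close>)
  then show ?thesis
    using \<open>a < b\<close> by (simp add: interval_lebesgue_integral_def)
qed

lemma set_integral_FTC_Ioi:
  fixes f F :: "real \<Rightarrow> real"
  assumes F: "\<And>x. a < x \<Longrightarrow> (F has_real_derivative f x) (at x)"
    and f: "\<And>x. a < x \<Longrightarrow> isCont f x"
    and int: "set_integrable lborel {a<..} f"
    and A: "(F \<longlongrightarrow> A) (at_right a)" and B: "(F \<longlongrightarrow> B) at_top"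
  shows "(LBINT x:{a<..}. f x) = B - A"
proof -
  have [simp]: "einterval (ereal a) \<infinity> = {a<..}"
    by (auto simp: einterval_iff)
  have "(LBINT x=ereal a..\<infinity>. f x) = B - A"
    by (rule interval_integral_FTC_integrable[where F=F])
       (use assms in \<open>auto simp: has_real_derivative_iff_has_vector_derivative
          ereal_tendsto_simps1 ereal_tendsto_simps2\<close>)
  then show ?thesis
    by (simp add: interval_lebesgue_integral_def)
qed

lemma set_integral_powr_Ioo:
  fixes s M :: real
  assumes "s > 0" "M > 0"
  shows "set_integrable lborel {0<..<M} (\<lambda>v. v powr (s - 1))"
    and "(LBINT v:{0<..<M}. v powr (s - 1)) = M powr s / s"
proof -
  have [simp]: "einterval (ereal 0) (ereal M) = {0<..<M}"
    by (auto simp: einterval_iff)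
  \<comment> \<open>The limit is 0, as \<open>0 powr s = 0\<close>; the unevaluated form is the one
    that the limit rules produce.\<close>
  have A: "((\<lambda>v. v powr s / s) \<longlongrightarrow> 0 powr s / s) (at_right 0)"
    using assms by (intro tendsto_intros tendsto_powr2) (auto simp: eventually_at_filter)
  have B: "((\<lambda>v. v powr s / s) \<longlongrightarrow> M powr s / s) (at_left M)"
    using assms by (intro tendsto_intros) auto
  have *: "\<And>x. 0 < x \<Longrightarrow> ((\<lambda>v. v powr s / s) has_real_derivative x powr (s - 1)) (at x)"
    using assms by (auto intro!: derivative_eq_intros)
  have "set_integrable lborel (einterval (ereal 0) (ereal M)) (\<lambda>v. v powr (s - 1))"
    by (rule interval_integral_FTC_nonneg[where F="\<lambda>v. v powr s / s"
          and A="0 powr s / s" and B="M powr s / s"])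
       (use assms * A B in \<open>auto simp: ereal_tendsto_simps1 ereal_tendsto_simps2 intro!: continuous_intros\<close>)
  then show int: "set_integrable lborel {0<..<M} (\<lambda>v. v powr (s - 1))"
    by simp
  show "(LBINT v:{0<..<M}. v powr (s - 1)) = M powr s / s"
    using set_integral_FTC_Ioo[OF assms(2) * _ int A B] assms
    by (simp add: continuous_intros)
qed

lemma set_integral_Gamma:
  fixes a s :: real
  assumes "a > 0" "s > 0"
  shows "set_integrable lborel {0<..} (\<lambda>u. u powr (a - 1) * exp (- (s * u)))"
    and "(LBINT u:{0<..}. u powr (a - 1) * exp (- (s * u))) = Gamma a * s powr (- a)"
proof -
  let ?f = "\<lambda>t::real. indicator {0<..} t * (t powr (a - 1) * exp (- t))"
  have "has_bochner_integral lborel ?f (Gamma a)"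
  proof (rule has_bochner_integral_nn_integral)
    have "(\<integral>\<^sup>+ t. ennreal (?f t) \<partial>lborel) =
          nn_integral lborel (\<lambda>t. ennreal (indicator {0..} t * t powr (a - 1) / exp t))"
      by (intro nn_integral_cong arg_cong[where f=ennreal]) (auto simp: indicator_def exp_minus field_simps)
    then show "(\<integral>\<^sup>+ t. ennreal (?f t) \<partial>lborel) = ennreal (Gamma a)"
      using Gamma_conv_nn_integral_real[OF assms(1)] by simp
  qed (use assms in \<open>auto intro: Gamma_real_nonneg simp: less_imp_le\<close>)
  then have "has_bochner_integral lborel (\<lambda>t. ?f (0 + s * t)) (Gamma a /\<^sub>R \<bar>s\<bar>)"
    using lborel_has_bochner_integral_real_affine_iff[of s ?f "Gamma a" 0] assms by simp
  \<comment> \<open>The new factor undoes the \<open>s powr (a - 1)\<close> that the substitution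
    puts in front of \<open>t powr (a - 1)\<close>.\<close>
  then have "has_bochner_integral lborel (\<lambda>t. s powr (1 - a) * ?f (0 + s * t)) (s powr (1 - a) * (Gamma a /\<^sub>R \<bar>s\<bar>))"
    by (intro has_bochner_integral_mult_right) auto
  moreover have "s powr (1 - a) * ?f (0 + s * t) =
      indicator {0<..} t *\<^sub>R (t powr (a - 1) * exp (- (s * t)))" for t
  proof (cases "t > 0")
    case True
    then have "s powr (1 - a) * (s powr (a - 1) * (t powr (a - 1) * exp (- (s * t)))) =
        s powr (1 - a + (a - 1)) * (t powr (a - 1) * exp (- (s * t)))"
      by (simp only: powr_add mult.assoc)
    then show ?thesis using True assms by (simp add: powr_mult mult_ac)
  next
    case False
    then show ?thesis using assms by (auto simp: indicator_def zero_less_mult_iff)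
  qed
  moreover have "s powr (1 - a) * (Gamma a /\<^sub>R \<bar>s\<bar>) = Gamma a * s powr (- a)"
    using assms by (simp add: powr_diff powr_minus field_simps)
  ultimately have "has_bochner_integral lborel
     (\<lambda>t. indicator {0<..} t *\<^sub>R (t powr (a - 1) * exp (- (s * t)))) (Gamma a * s powr (- a))"
    by (simp only:)
  then show "set_integrable lborel {0<..} (\<lambda>u. u powr (a - 1) * exp (- (s * u)))"
    and "(LBINT u:{0<..}. u powr (a - 1) * exp (- (s * u))) = Gamma a * s powr (- a)"
    unfolding set_integrable_def set_lebesgue_integral_def has_bochner_integral_iff by auto
qed

text \<open>Beyond 1 the integrand can only grow when \<open>s\<close> is replaced by
  \<open>max s 1\<close>, and the result is a Gamma integrand. Negative \<open>s\<close> has to be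
  covered, as the continuation arguments work there.\<close>

lemma set_integrable_powr_exp_Ioi:
  fixes s w M :: real
  assumes "w > 0" "M \<ge> 1"
  shows "set_integrable lborel {M<..} (\<lambda>v. v powr (s - 1) * exp (- (w * v)))"
proof (rule set_integrable_bound)
  show "set_integrable lborel {M<..} (\<lambda>v. v powr (max s 1 - 1) * exp (- (w * v)))"
    by (rule set_integrable_subset[OF set_integral_Gamma(1)]) (use assms in auto)
  show "set_borel_measurable lborel {M<..} (\<lambda>v. v powr (s - 1) * exp (- (w * v)))"
    unfolding set_borel_measurable_def by measurable
  show "AE v in lborel. v \<in> {M<..} \<longrightarrow> norm (v powr (s - 1) * exp (- (w * v)))
      \<le> norm (v powr (max s 1 - 1) * exp (- (w * v)))"
    using assms by (auto intro!: AE_I2 powr_mono simp: abs_mult)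
qed

section \<open>Exchange of series and integrals, and the exponential series below the splitting
  point\<close>

lemma set_integral_suminf:
  fixes f :: "nat \<Rightarrow> real \<Rightarrow> real"
  assumes "\<And>i. set_integrable M A (f i)"
    and "AE x in M. x \<in> A \<longrightarrow> summable (\<lambda>i. \<bar>f i x\<bar>)"
    and "summable (\<lambda>i. LINT x:A|M. \<bar>f i x\<bar>)"
  shows "set_integrable M A (\<lambda>x. \<Sum>i. f i x)"
    and "(\<lambda>i. LINT x:A|M. f i x) sums (LINT x:A|M. (\<Sum>i. f i x))"
proof -
  have 1: "AE x in M. summable (\<lambda>i. norm (indicator A x *\<^sub>R f i x))"
    using assms(2) by eventually_elim (auto simp: indicator_def)
  have 2: "summable (\<lambda>i. LINT x|M. norm (indicator A x *\<^sub>R f i x))"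
    using assms(3) by (simp add: set_lebesgue_integral_def abs_mult)
  have eq: "(\<Sum>i. indicator A x *\<^sub>R f i x) = indicator A x *\<^sub>R (\<Sum>i. f i x)" for x
    by (auto simp: indicator_def)
  show "set_integrable M A (\<lambda>x. \<Sum>i. f i x)"
    using integrable_suminf[OF assms(1)[unfolded set_integrable_def] 1 2]
    unfolding set_integrable_def eq .
  show "(\<lambda>i. LINT x:A|M. f i x) sums (LINT x:A|M. (\<Sum>i. f i x))"
    using sums_integral[OF assms(1)[unfolded set_integrable_def] 1 2]
    unfolding set_lebesgue_integral_def eq .
qed

lemma set_integral_split_Ioi:
  fixes f :: "real \<Rightarrow> real" and M :: real
  assumes "set_integrable lborel {0<..} f" "M > 0"
  shows "(LBINT v:{0<..}. f v) = (LBINT v:{0<..<M}. f v) + (LBINT v:{M<..}. f v)"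
proof -
  have "(LBINT v:{0<..}. f v) = (LBINT v:{0<..<M} \<union> {M<..}. f v)"
    unfolding set_lebesgue_integral_def
  proof (rule integral_cong_AE)
    have *: "set_integrable lborel ({0<..<M} \<union> {M<..}) f"
      by (rule set_integrable_subset[OF assms(1)]) (use assms in auto)
    show "(\<lambda>x. indicat_real {0<..} x *\<^sub>R f x) \<in> borel_measurable lborel"
      using assms(1) unfolding set_integrable_def by (rule borel_measurable_integrable)
    show "(\<lambda>x. indicat_real ({0<..<M} \<union> {M<..}) x *\<^sub>R f x) \<in> borel_measurable lborel"
      using * unfolding set_integrable_def by (rule borel_measurable_integrable)
    show "AE x in lborel. indicat_real {0<..} x *\<^sub>R f x = indicat_real ({0<..<M} \<union> {M<..}) x *\<^sub>R f x"
      using AE_lborel_singleton[of M] by eventually_elim (use assms in \<open>auto simp: indicator_def\<close>)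
  qed
  also have "\<dots> = (LBINT v:{0<..<M}. f v) + (LBINT v:{M<..}. f v)"
    by (intro set_integral_Un set_integrable_subset[OF assms(1)]) (use assms in auto)
  finally show ?thesis .
qed

lemma exp_powser_sums:
  fixes w v :: real
  shows "(\<lambda>j. (- w) ^ j / fact j * v ^ j) sums exp (- (w * v))"
  using exp_converges[of "- (w * v)"]
  by (simp add: scaleR_conv_of_real divide_inverse power_mult_distrib[symmetric] mult_ac)

lemma sums_integral_Ioo_powr_exp:
  fixes s w M :: real and g :: "real \<Rightarrow> real"
  assumes "s > 0" "w \<ge> 0" "M \<ge> 1" and g: "g \<in> borel_measurable borel" "\<And>v. 0 < v \<Longrightarrow> \<bar>g v\<bar> \<le> 1"
  shows "(\<lambda>j. (- w) ^ j / fact j * (LBINT v:{0<..<M}. g v * v powr (s + real j - 1)))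
      sums (LBINT v:{0<..<M}. g v * v powr (s - 1) * exp (- (w * v)))"
    and "\<And>j. set_integrable lborel {0<..<M} (\<lambda>v. g v * v powr (s + real j - 1))"
    and "\<And>j. (LBINT v:{0<..<M}. \<bar>g v * v powr (s + real j - 1)\<bar>) \<le> M powr s / s * M ^ j"
proof -
  note [measurable] = g(1)
  have bd: "\<And>j v. 0 < v \<Longrightarrow> \<bar>g v * v powr (s + real j - 1)\<bar> \<le> v powr (s + real j - 1)"
    using g(2) by (simp add: abs_mult mult_left_le_one_le)
  show int: "set_integrable lborel {0<..<M} (\<lambda>v. g v * v powr (s + real j - 1))" for j
    by (rule set_integrable_bound[OF set_integral_powr_Ioo(1)[of "s + real j" M]])
       (use assms bd in \<open>auto simp: set_borel_measurable_def\<close>)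
  show le: "(LBINT v:{0<..<M}. \<bar>g v * v powr (s + real j - 1)\<bar>) \<le> M powr s / s * M ^ j" for j
  proof -
    have "(LBINT v:{0<..<M}. \<bar>g v * v powr (s + real j - 1)\<bar>) \<le>
        (LBINT v:{0<..<M}. v powr (s + real j - 1))"
      by (intro set_integral_mono set_integrable_abs int set_integral_powr_Ioo) (use assms bd in auto)
    also have "\<dots> = M powr (s + real j) / (s + real j)"
      using assms by (intro set_integral_powr_Ioo) auto
    also have "\<dots> \<le> M powr (s + real j) / s"
      using assms by (intro divide_left_mono) auto
    also have "\<dots> = M powr s / s * M ^ j"
      using assms by (simp add: powr_add powr_realpow)
    finally show ?thesis .
  qed
  let ?f = "\<lambda>j v. (- w) ^ j / fact j * (g v * v powr (s + real j - 1))"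
  have pw: "?f j v = g v * v powr (s - 1) * ((- w) ^ j / fact j * v ^ j)" if "v > 0" for j v
    using that by (simp add: powr_add powr_diff powr_realpow mult_ac)
  have S: "summable (\<lambda>j. \<bar>?f j v\<bar>)" if "v > 0" for v
  proof -
    have "summable (\<lambda>j. \<bar>g v * v powr (s - 1)\<bar> * (w ^ j / fact j * v ^ j))"
      using exp_powser_sums[of "-w" v] by (intro summable_mult) (auto simp: sums_iff)
    then show ?thesis unfolding pw[OF that] using that assms by (simp add: abs_mult power_abs)
  qed
  have abs: "(LBINT v:{0<..<M}. \<bar>?f j v\<bar>) = w ^ j / fact j * (LBINT v:{0<..<M}. \<bar>g v * v powr (s + real j - 1)\<bar>)" for j
    using assms unfolding set_integral_mult_right[symmetric] by (intro set_lebesgue_integral_cong) (auto simp: abs_mult power_abs)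
  have S2: "summable (\<lambda>j. LBINT v:{0<..<M}. \<bar>?f j v\<bar>)"
  proof (rule summable_comparison_test')
    show "summable (\<lambda>j. M powr s / s * (w ^ j / fact j * M ^ j))"
      using exp_powser_sums[of "-w" M] by (intro summable_mult) (auto simp: sums_iff)
    show "norm (LBINT v:{0<..<M}. \<bar>?f j v\<bar>) \<le> M powr s / s * (w ^ j / fact j * M ^ j)" for j
    proof -
      have "w ^ j / fact j * (LBINT v:{0<..<M}. \<bar>g v * v powr (s + real j - 1)\<bar>) \<le> w ^ j / fact j * (M powr s / s * M ^ j)"
        using assms by (intro mult_left_mono le) auto
      moreover have "(LBINT v:{0<..<M}. \<bar>?f j v\<bar>) \<ge> 0"
        unfolding set_lebesgue_integral_def by (intro Bochner_Integration.integral_nonneg) auto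
      ultimately show ?thesis unfolding abs by (simp add: mult_ac)
    qed
  qed
  have "(\<lambda>j. LBINT v:{0<..<M}. ?f j v) sums (LBINT v:{0<..<M}. (\<Sum>j. ?f j v))"
    using S by (intro set_integral_suminf(2) S2 set_integrable_mult_right int) auto
  also have "(LBINT v:{0<..<M}. (\<Sum>j. ?f j v)) = (LBINT v:{0<..<M}. g v * v powr (s - 1) * exp (- (w * v)))"
  proof (intro set_lebesgue_integral_cong)
    show "\<forall>v. v \<in> {0<..<M} \<longrightarrow> (\<Sum>j. ?f j v) = g v * v powr (s - 1) * exp (- (w * v))"
    proof (intro allI impI)
      fix v assume "v \<in> {0<..<M}"
      then have "v > 0" by simp
      show "(\<Sum>j. ?f j v) = g v * v powr (s - 1) * exp (- (w * v))"
        unfolding pw[OF \<open>v > 0\<close>] by (rule sums_unique[symmetric], rule sums_mult, rule exp_powser_sums)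
    qed
  qed auto
  finally show "(\<lambda>j. (- w) ^ j / fact j * (LBINT v:{0<..<M}. g v * v powr (s + real j - 1)))
      sums (LBINT v:{0<..<M}. g v * v powr (s - 1) * exp (- (w * v)))" by simp
qed

text \<open>
  The expansion of the lower incomplete Gamma function, continued to negative noninteger \<open>s\<close>
  by partial integration.
\<close>

lemma Gamma_incomplete_sums:
  fixes s w M :: real
  assumes "w > 0" "M \<ge> 1" "\<And>j::nat. s + real j \<noteq> 0"
  shows "(\<lambda>j. (- w) ^ j / fact j * (M powr (s + real j) / (s + real j)))
     sums (Gamma s * w powr (- s) - (LBINT v:{M<..}. v powr (s - 1) * exp (- (w * v))))"
proof -
  \<comment> \<open>\<open>m\<close> counts the unit shifts that make \<open>s\<close> positive;
    induction on it is the analytic continuation along the real line.\<close>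
  obtain m :: nat where "- s < real m"
    using reals_Archimedean2 by blast
  then have "s + real m > 0" by simp
  then show ?thesis using assms(3)
  proof (induction m arbitrary: s)
    case 0
    then have s: "s > 0" by simp
    have "(\<lambda>j. (- w) ^ j / fact j * (LBINT v:{0<..<M}. 1 * v powr (s + real j - 1)))
      sums (LBINT v:{0<..<M}. 1 * v powr (s - 1) * exp (- (w * v)))"
      by (rule sums_integral_Ioo_powr_exp(1)) (use s assms in auto)
    moreover have "(LBINT v:{0<..<M}. v powr (s + real j - 1)) = M powr (s + real j) / (s + real j)" for j
      using s assms by (intro set_integral_powr_Ioo) auto
    ultimately show ?case
      using set_integral_split_Ioi[OF set_integral_Gamma(1)[OF s \<open>w > 0\<close>], of M]
        set_integral_Gamma(2)[OF s \<open>w > 0\<close>] assms by simp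
  next
    case (Suc m)
    have nz: "s + 1 + real j \<noteq> 0" for j using Suc.prems(2)[of "Suc j"] by (simp add: add_ac)
    have IH: "(\<lambda>j. (- w) ^ j / fact j * (M powr (s + 1 + real j) / (s + 1 + real j)))
     sums (Gamma (s + 1) * w powr (- (s + 1)) - (LBINT v:{M<..}. v powr (s + 1 - 1) * exp (- (w * v))))"
      using Suc.prems(1) nz by (intro Suc.IH) auto
    let ?J = "\<lambda>s. LBINT v:{M<..}. v powr (s - 1) * exp (- (w * v))"
    have s0: "s \<noteq> 0" using Suc.prems(2)[of 0] by simp
    \<comment> \<open>The integrand is the derivative of \<open>v powr s * exp (- (w * v))\<close>,
      which vanishes at infinity: the recurrence of the upper incomplete Gamma function.\<close>
    have parts: "s * ?J s - w * ?J (s + 1) = - (M powr s * exp (- (w * M)))"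
    proof -
      have int: "\<And>s. set_integrable lborel {M<..} (\<lambda>v. v powr (s - 1) * exp (- (w * v)))"
        using assms(1,2) by (rule set_integrable_powr_exp_Ioi)
      have "s * ?J s - w * ?J (s + 1) = (LBINT v:{M<..}. s * (v powr (s - 1) * exp (- (w * v))) - w * (v powr (s + 1 - 1) * exp (- (w * v))))"
        by (subst set_integral_diff(2), intro set_integrable_mult_right int,
            intro set_integrable_mult_right int, simp)
      also have "\<dots> = 0 - M powr s * exp (- (w * M))"
      proof (rule set_integral_FTC_Ioi)
        show "((\<lambda>v. v powr s * exp (- (w * v))) has_real_derivative
           s * (x powr (s - 1) * exp (- (w * x))) - w * (x powr (s + 1 - 1) * exp (- (w * x)))) (at x)"
          if "x > M" for x
          using that assms by (auto intro!: derivative_eq_intros simp: algebra_simps)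
        show "((\<lambda>v. v powr s * exp (- (w * v))) \<longlongrightarrow> 0) at_top"
          using \<open>w > 0\<close> by real_asymp
        show "((\<lambda>v. v powr s * exp (- (w * v))) \<longlongrightarrow> M powr s * exp (- (w * M))) (at_right M)"
          using assms by (intro tendsto_intros) auto
        show "set_integrable lborel {M<..} (\<lambda>v. s * (v powr (s - 1) * exp (- (w * v))) - w * (v powr (s + 1 - 1) * exp (- (w * v))))"
          by (intro set_integral_diff(1) set_integrable_mult_right int)
      qed (use assms in \<open>auto intro!: continuous_intros\<close>)
      finally show ?thesis by simp
    qed
    have e: "(\<lambda>j. M powr s * ((- w) ^ j / fact j * M ^ j)) sums (M powr s * exp (- (w * M)))"
      by (intro sums_mult exp_powser_sums)
    have "(\<lambda>j. (- w) ^ j / fact j * (- w * (M powr (s + 1 + real j) / (s + 1 + real j))))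
      sums (- w * (Gamma (s + 1) * w powr (- (s + 1)) - ?J (s + 1)))"
      using sums_mult[OF IH, of "- w"] by (simp add: mult_ac)
    also have "(\<lambda>j. (- w) ^ j / fact j * (- w * (M powr (s + 1 + real j) / (s + 1 + real j)))) =
       (\<lambda>j. (\<lambda>i. (- w) ^ i / fact i * (real i * (M powr (s + real i) / (s + real i)))) (Suc j))"
    proof
      fix j
      have "real (Suc j) / fact (Suc j) = (1 / fact j :: real)"
        by (simp add: fact_Suc)
      then have "(- w) ^ Suc j * (real (Suc j) / fact (Suc j)) = (- w) ^ j / fact j * (- w)"
        by simp
      moreover have "s + 1 + real j = s + real (Suc j)" by simp
      ultimately show "(- w) ^ j / fact j * (- w * (M powr (s + 1 + real j) / (s + 1 + real j))) =
         (\<lambda>i. (- w) ^ i / fact i * (real i * (M powr (s + real i) / (s + real i)))) (Suc j)"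
        by (metis (no_types, lifting) mult.assoc times_divide_eq_left times_divide_eq_right)
    qed
    \<comment> \<open>The factor \<open>real i\<close> kills the term \<open>i = 0\<close>, so the
      index shift does not change the sum.\<close>
    finally have "(\<lambda>i. (- w) ^ i / fact i * (real i * (M powr (s + real i) / (s + real i))))
       sums (- w * (Gamma (s + 1) * w powr (- (s + 1)) - ?J (s + 1)))"
      by (subst (asm) sums_Suc_iff) simp
    note D = sums_diff[OF e this]
    \<comment> \<open>With \<open>X = M powr (s + j) / (s + j)\<close> the exponential term contains
      \<open>(s + j) * X\<close>; subtracting \<open>j * X\<close> leaves \<open>s * X\<close>, the
      wanted series times \<open>s\<close>.\<close>
    have EQ: "(\<lambda>j. M powr s * ((- w) ^ j / fact j * M ^ j) - (- w) ^ j / fact j * (real j * (M powr (s + real j) / (s + real j))))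
        = (\<lambda>j. s * ((- w) ^ j / fact j * (M powr (s + real j) / (s + real j))))"
      proof
        fix j
        define X c where "X = M powr (s + real j) / (s + real j)" and "c = (- w) ^ j / fact j"
        have "M powr s * M ^ j = M powr (s + real j)" using assms by (simp add: powr_add powr_realpow)
        also have "\<dots> = (s + real j) * X" using Suc.prems(2)[of j] by (simp add: X_def)
        finally have "M powr s * (c * M ^ j) = c * ((s + real j) * X)" by (simp only: mult.left_commute)
        then have "M powr s * (c * M ^ j) - c * (real j * X) = s * (c * X)" by (simp add: algebra_simps)
        then show "M powr s * ((- w) ^ j / fact j * M ^ j) - (- w) ^ j / fact j * (real j * (M powr (s + real j) / (s + real j)))
          = s * ((- w) ^ j / fact j * (M powr (s + real j) / (s + real j)))"
          unfolding X_def c_def .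
      qed
    have "(\<lambda>j. s * ((- w) ^ j / fact j * (M powr (s + real j) / (s + real j)))) sums
       (M powr s * exp (- (w * M)) + w * (Gamma (s + 1) * w powr (- (s + 1)) - ?J (s + 1)))"
      using D unfolding EQ by simp
    from sums_mult[OF this, of "1 / s"]
    have "(\<lambda>j. (- w) ^ j / fact j * (M powr (s + real j) / (s + real j))) sums
       ((M powr s * exp (- (w * M)) + w * (Gamma (s + 1) * w powr (- (s + 1)) - ?J (s + 1))) / s)"
      using s0 by simp
    also have "w * (Gamma (s + 1) * w powr (- (s + 1))) = s * (Gamma s * w powr (- s))"
    proof -
      \<comment> \<open>A pole of Gamma at \<open>s\<close> would make some denominator
        \<open>s + j\<close> zero.\<close>
      have "s \<notin> \<int>\<^sub>\<le>\<^sub>0"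
      proof
        assume "s \<in> \<int>\<^sub>\<le>\<^sub>0"
        then obtain k where "s = - real k" by (auto elim!: nonpos_Ints_cases')
        then show False using Suc.prems(2)[of k] by simp
      qed
      then have "Gamma (s + 1) = s * Gamma s" by (rule Gamma_plus1)
      moreover have "w * w powr (- (s + 1)) = w powr (- s)"
        using assms powr_add[of w 1 "- (s + 1)"] by simp
      ultimately show ?thesis by (metis (no_types, opaque_lifting) mult.assoc mult.left_commute)
    qed
    then have "(M powr s * exp (- (w * M)) + w * (Gamma (s + 1) * w powr (- (s + 1)) - ?J (s + 1))) / s
       = Gamma s * w powr (- s) - ?J s"
      using parts s0 by (simp add: field_simps)
    finally show ?case .
  qed
qed

section \<open>The Mellin transform of the multiplier and the binomial series at infinity\<close>

lemma set_integral_Mellin_Ioi: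
  fixes \<beta> \<nu> s :: real
  assumes "\<beta> > 0" "s > 0" "s < \<beta> * \<nu>"
  shows "set_integrable lborel {0<..} (\<lambda>v. (1 + v powr \<beta>) powr (- \<nu>) * v powr (s - 1))"
    and "(LBINT v:{0<..}. (1 + v powr \<beta>) powr (- \<nu>) * v powr (s - 1)) =
      Gamma (s / \<beta>) * Gamma (\<nu> - s / \<beta>) / (\<beta> * Gamma \<nu>)"
proof -
  \<comment> \<open>Parameters of the Beta integral that arises under
    \<open>t = v powr \<beta> / (1 + v powr \<beta>)\<close>, which maps the half-line onto the open
    unit interval. Both are positive exactly when \<open>0 < s < \<beta> * \<nu>\<close>, and
    \<open>a + b = \<nu>\<close> puts \<open>Gamma \<nu>\<close> in the denominator.\<close>
  define a b where "a = s / \<beta>" and "b = \<nu> - s / \<beta>"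
  have ab: "a > 0" "b > 0" "a + b = \<nu>" "\<beta> * a = s"
    using assms by (auto simp: a_def b_def field_simps)
  let ?f = "\<lambda>t::real. t powr (a - 1) * (1 - t) powr (b - 1)"
  let ?g = "\<lambda>v::real. v powr \<beta> / (1 + v powr \<beta>)"
  let ?g' = "\<lambda>v::real. \<beta> * v powr (\<beta> - 1) / (1 + v powr \<beta>) ^ 2"
  let ?h = "\<lambda>v::real. (1 + v powr \<beta>) powr (- \<nu>) * v powr (s - 1)"
  have "(?f has_integral Beta a b) {0..1}"
    using ab by (intro has_integral_Beta_real) auto
  then have f: "(?f has_integral Beta a b) {0<..<1}"
    by (simp add: has_integral_Icc_iff_Ioo)
  have fabs: "?f absolutely_integrable_on {0<..<1}"
    using f by (intro nonnegative_absolutely_integrable_1) auto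
  have pos: "1 + v powr \<beta> > 0" for v
    using powr_ge_zero[of v \<beta>] by linarith
  have im: "?g ` {0<..} = {0<..<1}"
  proof (intro equalityI subsetI)
    fix t :: real assume t: "t \<in> {0<..<1}"
    show "t \<in> ?g ` {0<..}"
    proof (rule image_eqI)
      let ?v = "(t / (1 - t)) powr (1 / \<beta>)"
      have v: "?v powr \<beta> = t / (1 - t)" using t assms by (simp add: powr_powr)
      show "t = ?g ?v" unfolding v using t by (simp add: field_simps)
      show "?v \<in> {0<..}" using t by simp
    qed
  next
    fix t :: real assume "t \<in> ?g ` {0<..}"
    then obtain v where v: "v > 0" "t = ?g v" by auto
    then have "v powr \<beta> > 0" by simp
    then show "t \<in> {0<..<1}" using v pos[of v] by (simp add: divide_less_eq)
  qed
  have inj: "inj_on ?g {0<..}"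
  proof (rule inj_onI)
    fix x y :: real assume xy: "x \<in> {0<..}" "y \<in> {0<..}" and "?g x = ?g y"
    then have "x powr \<beta> = y powr \<beta>" using pos[of x] pos[of y] by (simp add: frac_eq_eq algebra_simps)
    then show "x = y" using xy assms
      by (metis greaterThan_iff less_eq_real_def powr_powr powr_one right_inverse order_less_irrefl)
  qed
  have key: "\<bar>?g' v\<bar> * ?f (?g v) = \<beta> * ?h v" if "v > 0" for v
  proof -
    let ?D = "1 + v powr \<beta>"
    have "1 - ?g v = 1 / ?D" using pos[of v] by (simp add: field_simps)
    then have "\<bar>?g' v\<bar> * ?f (?g v) =
       \<beta> * v powr (\<beta> - 1) / ?D ^ 2 * ((v powr \<beta>) powr (a - 1) / ?D powr (a - 1)) * (1 / ?D powr (b - 1))"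
      using assms pos[of v] by (simp add: powr_divide abs_mult)
    also have "\<dots> = \<beta> * (v powr (\<beta> - 1) * v powr (\<beta> * (a - 1))) / (?D powr 2 * ?D powr (a - 1) * ?D powr (b - 1))"
      using pos[of v] by (simp add: powr_powr)
    also have "v powr (\<beta> - 1) * v powr (\<beta> * (a - 1)) = v powr (s - 1)"
      using ab by (simp add: powr_add[symmetric] algebra_simps)
    also have "?D powr 2 * ?D powr (a - 1) * ?D powr (b - 1) = ?D powr (2 + (a - 1) + (b - 1))"
      by (simp only: powr_add)
    also have "2 + (a - 1) + (b - 1) = \<nu>"
      using ab by simp
    finally show ?thesis by (simp add: powr_minus divide_inverse)
  qed
  have der: "(?g has_field_derivative ?g' x) (at x within {0<..})" if "x \<in> {0<..}" for x
    using that pos[of x] by (auto intro!: derivative_eq_intros simp: power2_eq_square field_simps)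
  have CV: "(\<lambda>x. \<bar>?g' x\<bar> * ?f (?g x)) absolutely_integrable_on {0<..} \<and>
     integral {0<..} (\<lambda>x. \<bar>?g' x\<bar> * ?f (?g x)) = Beta a b"
    using has_absolute_integral_change_of_variables_1'[OF _ der inj, of ?f "Beta a b"] fabs f
    unfolding im by (auto simp: integral_unique)
  have "((\<lambda>x. \<bar>?g' x\<bar> * ?f (?g x)) absolutely_integrable_on {0<..}) =
        ((\<lambda>x. \<beta> * ?h x) absolutely_integrable_on {0<..})"
    by (intro set_integrable_cong refl key) simp
  with CV have 1: "(\<lambda>x. \<beta> * ?h x) absolutely_integrable_on {0<..}" by (simp only:)
  have "integral {0<..} (\<lambda>x. \<bar>?g' x\<bar> * ?f (?g x)) = integral {0<..} (\<lambda>x. \<beta> * ?h x)"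
    by (intro integral_cong key) simp
  with CV have 2: "integral {0<..} (\<lambda>x. \<beta> * ?h x) = Beta a b" by (simp only:)
  \<comment> \<open>The change of variables is a theorem about \<open>lebesgue\<close>; since the
    integrand is Borel, integrability passes back to \<open>lborel\<close>.\<close>
  have "integrable lebesgue (\<lambda>x. indicator {0<..} x *\<^sub>R (\<beta> * ?h x))"
    using 1 unfolding set_integrable_def .
  then have "set_integrable lborel {0<..} (\<lambda>x. \<beta> * ?h x)"
    unfolding set_integrable_def by (subst (asm) integrable_completion) auto
  then show int: "set_integrable lborel {0<..} ?h"
    using assms by simp
  have "(LBINT v:{0<..}. \<beta> * ?h v) = Beta a b"
    using set_borel_integral_eq_integral(2)[OF int] 2 by simp
  then have "(LBINT v:{0<..}. ?h v) = Beta a b / \<beta>"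
    using assms by (simp add: eq_divide_eq mult.commute)
  then show "(LBINT v:{0<..}. ?h v) = Gamma (s / \<beta>) * Gamma (\<nu> - s / \<beta>) / (\<beta> * Gamma \<nu>)"
    unfolding Beta_def ab(3) unfolding a_def b_def by (simp add: mult.commute)
qed

lemma one_plus_powr_neg_sums:
  fixes \<beta> \<nu> v :: real
  assumes "\<beta> > 0" "v > 1"
  shows "(\<lambda>l. (- \<nu> gchoose l) * v powr (- (\<beta> * (\<nu> + real l)))) sums (1 + v powr \<beta>) powr (- \<nu>)"
proof -
  have "\<bar>1\<bar> < v powr \<beta>" using assms by simp
  from gen_binomial_real'[OF this, of "- \<nu>"]
  show ?thesis by (simp add: powr_powr algebra_simps)
qed

text \<open>The coefficients alternate in sign, so taking absolute values amounts to replacing 1 by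
  -1 in the binomial series, which still converges because
  \<open>M powr \<beta> > 1\<close>.\<close>

lemma summable_abs_gbinomial:
  fixes \<beta> \<nu> M :: real
  assumes "\<beta> > 0" "\<nu> > 0" "M > 1"
  shows "summable (\<lambda>l. \<bar>- \<nu> gchoose l\<bar> * M powr (- (\<beta> * (\<nu> + real l))))"
proof -
  have M: "\<bar>-1\<bar> < M powr \<beta>" using assms by simp
  from gen_binomial_real'[OF this, of "- \<nu>"]
  have "summable (\<lambda>l. (- \<nu> gchoose l) * (- 1) ^ l * (M powr \<beta>) powr (- \<nu> - real l))"
    by (simp add: sums_iff)
  moreover have "(- \<nu> gchoose l) * (- 1) ^ l = \<bar>- \<nu> gchoose l\<bar>" for l
  proof -
    have "(- \<nu> gchoose l) = (-1) ^ l * (pochhammer \<nu> l / fact l)"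
      by (simp add: gbinomial_pochhammer)
    moreover have "pochhammer \<nu> l \<ge> 0"
      using assms by (simp add: pochhammer_nonneg)
    ultimately show ?thesis by (cases "even l") auto
  qed
  ultimately show ?thesis by (simp add: powr_powr algebra_simps)
qed

lemma gbinomial_neg_Suc:
  fixes \<nu> :: real
  shows "real (Suc l) * (- \<nu> gchoose Suc l) = - \<nu> * (- (\<nu> + 1) gchoose l)"
proof -
  have "- (\<nu> + 1) = - \<nu> - 1" by simp
  then show ?thesis using gbinomial_absorption[of l "- \<nu>"] by (simp only:)
qed

lemma set_integral_powr_Ioi:
  fixes t M :: real
  assumes "t > 0" "M > 0"
  shows "set_integrable lborel {M<..} (\<lambda>v. v powr (- t - 1))"
    and "(LBINT v:{M<..}. v powr (- t - 1)) = M powr (- t) / t"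
proof -
  have e: "einterval (ereal M) \<infinity> = {M<..}"
    by (auto simp: einterval_iff)
  have A: "((\<lambda>v. - (v powr (- t) / t)) \<longlongrightarrow> - (M powr (- t) / t)) (at_right M)"
    using assms by (intro tendsto_intros) auto
  have B: "((\<lambda>v. - (v powr (- t) / t)) \<longlongrightarrow> 0) at_top"
    using assms by real_asymp
  have *: "\<And>x. M < x \<Longrightarrow> ((\<lambda>v. - (v powr (- t) / t)) has_real_derivative x powr (- t - 1)) (at x)"
    using assms by (auto intro!: derivative_eq_intros)
  have "set_integrable lborel (einterval (ereal M) \<infinity>) (\<lambda>v. v powr (- t - 1))"
    by (rule interval_integral_FTC_nonneg[where F="\<lambda>v. - (v powr (- t) / t)"
          and A="- (M powr (- t) / t)" and B=0])
       (use assms * A B in \<open>auto simp: ereal_tendsto_simps1 ereal_tendsto_simps2 intro!: continuous_intros\<close>)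
  then show int: "set_integrable lborel {M<..} (\<lambda>v. v powr (- t - 1))"
    unfolding e .
  show "(LBINT v:{M<..}. v powr (- t - 1)) = M powr (- t) / t"
    using set_integral_FTC_Ioi[OF * _ int A B] assms
    by (simp add: continuous_intros)
qed

text \<open>
  The Mellin transform of \<open>(1 + v powr \<beta>) powr -\<nu>\<close>, continued past the strip of convergence
  \<open>s < \<beta> * \<nu>\<close> by expanding the tail of the integral.  The induction raises \<open>\<nu>\<close>, which enlarges the strip.
\<close>

lemma Mellin_continued_sums:
  fixes \<beta> \<nu> s M \<delta> :: real
  assumes "\<beta> > 0" "\<nu> > 0" "s > 0" "M > 1" "\<delta> > 0" "\<And>l::nat. \<delta> \<le> \<bar>\<beta> * (\<nu> + real l) - s\<bar>"
  shows "(\<lambda>l. (- \<nu> gchoose l) * (M powr (s - \<beta> * (\<nu> + real l)) / (\<beta> * (\<nu> + real l) - s)))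
     sums (Gamma (s / \<beta>) * Gamma (\<nu> - s / \<beta>) / (\<beta> * Gamma \<nu>)
        - (LBINT v:{0<..<M}. (1 + v powr \<beta>) powr (- \<nu>) * v powr (s - 1)))"
proof -
  \<comment> \<open>Only \<open>s > 0\<close> and the bound of the weight by 1 matter, so the
    exponential is switched off by \<open>w = 0\<close>.\<close>
  have Mint: "set_integrable lborel {0<..<M} (\<lambda>v. (1 + v powr \<beta>) powr (- \<nu>) * v powr (s - 1))"
    if "\<nu> > 0" for \<nu>
    by (rule sums_integral_Ioo_powr_exp(2)[where j=0 and w=0, simplified])
      (use assms that in \<open>auto simp: powr_minus inverse_le_1_iff ge_one_powr_ge_zero\<close>)
  \<comment> \<open>After \<open>m\<close> unit increases of \<open>\<nu>\<close> the convergence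
    strip contains \<open>s\<close>.\<close>
  obtain m :: nat where "s / \<beta> - \<nu> < real m"
    using reals_Archimedean2 by blast
  then have "s < \<beta> * (\<nu> + real m)" using assms(1) by (simp add: field_simps)
  then show ?thesis using assms(2,6)
  proof (induction m arbitrary: \<nu>)
    case 0
    let ?f = "\<lambda>l v. (- \<nu> gchoose l) * v powr (- (\<beta> * (\<nu> + real l) - s) - 1)"
    have t: "\<beta> * (\<nu> + real l) - s > 0" for l
    proof -
      have "\<beta> * (\<nu> + 0) \<le> \<beta> * (\<nu> + real l)" using assms(1) by (intro mult_left_mono) auto
      then show ?thesis using 0(1) by simp
    qed
    have eq: "?f l v = v powr (s - 1) * ((- \<nu> gchoose l) * v powr (- (\<beta> * (\<nu> + real l))))" if "v > 0" for l v
      using that by (simp add: powr_add[symmetric] mult.left_commute algebra_simps)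
    have int: "set_integrable lborel {M<..} (?f l)" for l
      using t assms by (intro set_integrable_mult_right set_integral_powr_Ioi) auto
    have val: "(LBINT v:{M<..}. ?f l v) = (- \<nu> gchoose l) * (M powr (s - \<beta> * (\<nu> + real l)) / (\<beta> * (\<nu> + real l) - s))" for l
      using set_integral_powr_Ioi(2)[OF t, of M l] assms by (simp only: set_integral_mult_right minus_diff_eq)
    have val': "(LBINT v:{M<..}. \<bar>?f l v\<bar>) = \<bar>- \<nu> gchoose l\<bar> * (M powr (s - \<beta> * (\<nu> + real l)) / (\<beta> * (\<nu> + real l) - s))" for l
      using set_integral_powr_Ioi(2)[OF t, of M l] assms
      by (simp add: abs_mult)
    have S: "summable (\<lambda>l. \<bar>?f l v\<bar>)" if "v > M" for v
    proof -
      have "summable (\<lambda>l. v powr (s - 1) * (\<bar>- \<nu> gchoose l\<bar> * v powr (- (\<beta> * (\<nu> + real l)))))"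
        using assms that 0 by (intro summable_mult summable_abs_gbinomial) auto
      moreover have "v > 0" using that assms by simp
      ultimately show ?thesis by (simp only: eq abs_mult abs_of_nonneg[OF powr_ge_zero])
    qed
    have S2: "summable (\<lambda>l. LBINT v:{M<..}. \<bar>?f l v\<bar>)"
    proof (rule summable_comparison_test')
      show "summable (\<lambda>l. M powr s / \<delta> * (\<bar>- \<nu> gchoose l\<bar> * M powr (- (\<beta> * (\<nu> + real l)))))"
        using assms 0 by (intro summable_mult summable_abs_gbinomial) auto
      fix l
      \<comment> \<open>Replacing the denominators by \<open>\<delta>\<close> leaves the absolute
        binomial series at \<open>M\<close>.\<close>
      have "M powr (s - \<beta> * (\<nu> + real l)) / (\<beta> * (\<nu> + real l) - s) \<le> M powr (s - \<beta> * (\<nu> + real l)) / \<delta>"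
        using t[of l] 0(3)[of l] assms by (intro divide_left_mono) auto
      also have "\<dots> = M powr s / \<delta> * M powr (- (\<beta> * (\<nu> + real l)))"
        by (simp add: powr_diff powr_minus divide_inverse)
      finally have *: "\<bar>- \<nu> gchoose l\<bar> * (M powr (s - \<beta> * (\<nu> + real l)) / (\<beta> * (\<nu> + real l) - s)) \<le> \<bar>- \<nu> gchoose l\<bar> * (M powr s / \<delta> * M powr (- (\<beta> * (\<nu> + real l))))"
        by (rule mult_left_mono) auto
      moreover have "0 \<le> \<bar>- \<nu> gchoose l\<bar> * (M powr (s - \<beta> * (\<nu> + real l)) / (\<beta> * (\<nu> + real l) - s))"
        using t[of l] by simp
      ultimately show "norm (LBINT v:{M<..}. \<bar>?f l v\<bar>) \<le> M powr s / \<delta> * (\<bar>- \<nu> gchoose l\<bar> * M powr (- (\<beta> * (\<nu> + real l))))"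
        unfolding val' using t[of l] by (simp add: mult_ac)
    qed
    have "(\<lambda>l. LBINT v:{M<..}. ?f l v) sums (LBINT v:{M<..}. (\<Sum>l. ?f l v))"
      using S by (intro set_integral_suminf(2) S2 int) auto
    also have "(LBINT v:{M<..}. (\<Sum>l. ?f l v)) = (LBINT v:{M<..}. (1 + v powr \<beta>) powr (- \<nu>) * v powr (s - 1))"
    proof (intro set_lebesgue_integral_cong)
      show "\<forall>v. v \<in> {M<..} \<longrightarrow> (\<Sum>l. ?f l v) = (1 + v powr \<beta>) powr (- \<nu>) * v powr (s - 1)"
      proof (intro allI impI)
        fix v assume v: "v \<in> {M<..}"
        have "(\<lambda>l. ?f l v) sums (v powr (s - 1) * (1 + v powr \<beta>) powr (- \<nu>))"
          using v assms unfolding eq[of v]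
          by (subst eq) (auto intro!: sums_mult one_plus_powr_neg_sums)
        then show "(\<Sum>l. ?f l v) = (1 + v powr \<beta>) powr (- \<nu>) * v powr (s - 1)"
          by (simp add: sums_iff mult.commute)
      qed
    qed auto
    also have "\<dots> = Gamma (s / \<beta>) * Gamma (\<nu> - s / \<beta>) / (\<beta> * Gamma \<nu>)
        - (LBINT v:{0<..<M}. (1 + v powr \<beta>) powr (- \<nu>) * v powr (s - 1))"
      using set_integral_split_Ioi[of "\<lambda>v. (1 + v powr \<beta>) powr (- \<nu>) * v powr (s - 1)" M]
        set_integral_Mellin_Ioi[of \<beta> s \<nu>] 0 assms by simp
    finally show ?case unfolding val .
  next
    case (Suc m)
    let ?P = "\<lambda>\<nu>. LBINT v:{0<..<M}. (1 + v powr \<beta>) powr (- \<nu>) * v powr (s - 1)"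
    let ?B = "\<lambda>\<nu>. Gamma (s / \<beta>) * Gamma (\<nu> - s / \<beta>) / (\<beta> * Gamma \<nu>)"
    let ?t = "\<lambda>l. M powr (s - \<beta> * (\<nu> + real l)) / (\<beta> * (\<nu> + real l) - s)"
    have nz: "\<beta> * (\<nu> + real l) - s \<noteq> 0" for l
      using Suc.prems(3)[of l] assms(5) by auto
    have nz0: "\<nu> * \<beta> - s \<noteq> 0" using nz[of 0] by (simp add: mult.commute)
    \<comment> \<open>The denominators for \<open>\<nu> + 1\<close> are those for
      \<open>\<nu>\<close> with \<open>l\<close> shifted by one, so the same \<open>\<delta>\<close>
      serves.\<close>
    have IH: "(\<lambda>l. (- (\<nu> + 1) gchoose l) * (M powr (s - \<beta> * (\<nu> + 1 + real l)) / (\<beta> * (\<nu> + 1 + real l) - s)))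
     sums (?B (\<nu> + 1) - ?P (\<nu> + 1))"
      using Suc.prems(1,2) Suc.prems(3)[of "Suc l" for l]
      by (intro Suc.IH) (auto simp: add_ac)
    have pos: "1 + v powr \<beta> > 0" for v
      using powr_ge_zero[of v \<beta>] by linarith
    \<comment> \<open>The integrand is the derivative of
      \<open>v powr s * (1 + v powr \<beta>) powr (- \<nu>)\<close>, once
      \<open>v powr \<beta>\<close> is written as \<open>(1 + v powr \<beta>) - 1\<close>. The
      endpoint 0 contributes nothing because \<open>s > 0\<close>.\<close>
    have parts: "(s - \<nu> * \<beta>) * ?P \<nu> + \<nu> * \<beta> * ?P (\<nu> + 1) = M powr s * (1 + M powr \<beta>) powr (- \<nu>)"
    proof -
      have "(s - \<nu> * \<beta>) * ?P \<nu> + \<nu> * \<beta> * ?P (\<nu> + 1) =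
        (LBINT v:{0<..<M}. (s - \<nu> * \<beta>) * ((1 + v powr \<beta>) powr (- \<nu>) * v powr (s - 1)) + \<nu> * \<beta> * ((1 + v powr \<beta>) powr (- (\<nu> + 1)) * v powr (s - 1)))"
        using Suc.prems(2) by (subst set_integral_add(2)) (auto intro!: Mint set_integrable_mult_right simp del: minus_add_distrib)
      also have "\<dots> = M powr s * (1 + M powr \<beta>) powr (- \<nu>) - 0 powr s * (1 + 0 powr \<beta>) powr (- \<nu>)"
      proof (rule set_integral_FTC_Ioo)
        show "((\<lambda>v. v powr s * (1 + v powr \<beta>) powr (- \<nu>)) has_real_derivative
           (s - \<nu> * \<beta>) * ((1 + x powr \<beta>) powr (- \<nu>) * x powr (s - 1)) + \<nu> * \<beta> * ((1 + x powr \<beta>) powr (- (\<nu> + 1)) * x powr (s - 1))) (at x)"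
          if "0 < x" "x < M" for x
        proof -
          let ?D = "1 + x powr \<beta>"
          have D: "((\<lambda>v. v powr s * (1 + v powr \<beta>) powr (- \<nu>)) has_real_derivative
            s * x powr (s - 1) * ?D powr (- \<nu>) + x powr s * (- \<nu> * ?D powr (- \<nu> - 1) * (\<beta> * x powr (\<beta> - 1)))) (at x)"
            using that pos[of x] by (auto intro!: derivative_eq_intros)
          have 1: "?D powr (- \<nu>) = ?D powr (- \<nu> - 1) * ?D"
            using pos[of x] by (simp add: powr_diff)
          have 2: "x powr s * x powr (\<beta> - 1) = x powr (s - 1) * (?D - 1)"
            by (simp add: powr_add[symmetric] algebra_simps)
            have "x powr s * (- \<nu> * ?D powr (- \<nu> - 1) * (\<beta> * x powr (\<beta> - 1))) =
               - \<nu> * \<beta> * ?D powr (- \<nu> - 1) * (x powr s * x powr (\<beta> - 1))" by simp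
            also have "\<dots> = - \<nu> * \<beta> * x powr (s - 1) * (?D powr (- \<nu> - 1) * ?D - ?D powr (- \<nu> - 1))"
              unfolding 2 by (simp only: right_diff_distrib mult_1_right mult_ac)
            also have "\<dots> = - \<nu> * \<beta> * x powr (s - 1) * (?D powr (- \<nu>) - ?D powr (- \<nu> - 1))"
              unfolding 1[symmetric] ..
            finally have "s * x powr (s - 1) * ?D powr (- \<nu>) + x powr s * (- \<nu> * ?D powr (- \<nu> - 1) * (\<beta> * x powr (\<beta> - 1)))
               = (s - \<nu> * \<beta>) * (?D powr (- \<nu>) * x powr (s - 1)) + \<nu> * \<beta> * (?D powr (- (\<nu> + 1)) * x powr (s - 1))"
              unfolding minus_add_distrib diff_conv_add_uminus[symmetric] by (simp add: algebra_simps)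
            then show ?thesis using D by (simp only:)
        qed
        show "((\<lambda>v. v powr s * (1 + v powr \<beta>) powr (- \<nu>)) \<longlongrightarrow> 0 powr s * (1 + 0 powr \<beta>) powr (- \<nu>)) (at_right 0)"
          using assms by (intro tendsto_intros tendsto_powr2) (auto simp: eventually_at_filter)
        show "((\<lambda>v. v powr s * (1 + v powr \<beta>) powr (- \<nu>)) \<longlongrightarrow> M powr s * (1 + M powr \<beta>) powr (- \<nu>)) (at_left M)"
          using assms pos[of M] by (intro tendsto_intros) auto
        show "isCont (\<lambda>x. (s - \<nu> * \<beta>) * ((1 + x powr \<beta>) powr (- \<nu>) * x powr (s - 1)) + \<nu> * \<beta> * ((1 + x powr \<beta>) powr (- (\<nu> + 1)) * x powr (s - 1))) x"
          if "0 < x" "x < M" for x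
          using that pos[of x] by (intro continuous_intros) auto
      qed (use assms Suc.prems(2) in \<open>auto intro!: Mint set_integral_add(1) set_integrable_mult_right simp del: minus_add_distrib\<close>)
      finally show ?thesis using assms by simp
    qed
    have e: "(\<lambda>l. M powr s * ((- \<nu> gchoose l) * M powr (- (\<beta> * (\<nu> + real l))))) sums (M powr s * (1 + M powr \<beta>) powr (- \<nu>))"
      using assms by (intro sums_mult one_plus_powr_neg_sums) auto
    have "(\<lambda>l. - \<nu> * ((- (\<nu> + 1) gchoose l) * (M powr (s - \<beta> * (\<nu> + 1 + real l)) / (\<beta> * (\<nu> + 1 + real l) - s))))
      sums (- \<nu> * (?B (\<nu> + 1) - ?P (\<nu> + 1)))"
      by (intro sums_mult IH)
    \<comment> \<open>Absorption turns the coefficients for \<open>\<nu> + 1\<close> at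
      \<open>l\<close> into those for \<open>\<nu>\<close> at \<open>l + 1\<close>; the factor
      \<open>real i\<close> again makes the missing term \<open>i = 0\<close> vanish.\<close>
    also have "(\<lambda>l. - \<nu> * ((- (\<nu> + 1) gchoose l) * (M powr (s - \<beta> * (\<nu> + 1 + real l)) / (\<beta> * (\<nu> + 1 + real l) - s))))
      = (\<lambda>l. (\<lambda>i. real i * (- \<nu> gchoose i) * ?t i) (Suc l))"
      unfolding mult.assoc[symmetric] gbinomial_neg_Suc by (simp add: add_ac)
    finally have "(\<lambda>i. real i * (- \<nu> gchoose i) * ?t i) sums (- \<nu> * (?B (\<nu> + 1) - ?P (\<nu> + 1)))"
      by (subst (asm) sums_Suc_iff) simp
    note D = sums_diff[OF e sums_mult[OF this, of \<beta>]]
    have EQ: "(\<lambda>l. M powr s * ((- \<nu> gchoose l) * M powr (- (\<beta> * (\<nu> + real l)))) - \<beta> * (real l * (- \<nu> gchoose l) * ?t l))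
        = (\<lambda>l. (\<nu> * \<beta> - s) * ((- \<nu> gchoose l) * ?t l))"
      proof
        fix l
        have "M powr s * M powr (- (\<beta> * (\<nu> + real l))) = M powr (s - \<beta> * (\<nu> + real l))"
          by (simp add: powr_add[symmetric])
        also have "\<dots> = (\<beta> * (\<nu> + real l) - s) * ?t l" using nz[of l] by simp
        finally have *: "M powr s * M powr (- (\<beta> * (\<nu> + real l))) = (\<beta> * (\<nu> + real l) - s) * ?t l" .
        have "M powr s * ((- \<nu> gchoose l) * M powr (- (\<beta> * (\<nu> + real l)))) - \<beta> * (real l * (- \<nu> gchoose l) * ?t l)
          = (- \<nu> gchoose l) * (M powr s * M powr (- (\<beta> * (\<nu> + real l)))) - \<beta> * (real l * (- \<nu> gchoose l) * ?t l)"
          by (simp only: mult_ac)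
        also have "\<dots> = (\<nu> * \<beta> - s) * ((- \<nu> gchoose l) * ?t l)"
          unfolding * by (simp only: left_diff_distrib right_diff_distrib distrib_left distrib_right mult_ac)
        finally show "M powr s * ((- \<nu> gchoose l) * M powr (- (\<beta> * (\<nu> + real l)))) - \<beta> * (real l * (- \<nu> gchoose l) * ?t l)
          = (\<nu> * \<beta> - s) * ((- \<nu> gchoose l) * ?t l)" .
      qed
    have "(\<lambda>l. (\<nu> * \<beta> - s) * ((- \<nu> gchoose l) * ?t l)) sums
       (M powr s * (1 + M powr \<beta>) powr (- \<nu>) - \<beta> * (- \<nu> * (?B (\<nu> + 1) - ?P (\<nu> + 1))))"
      using D unfolding EQ .
    from sums_mult[OF this, of "1 / (\<nu> * \<beta> - s)"] nz0
    have "(\<lambda>l. (- \<nu> gchoose l) * ?t l) sums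
       ((M powr s * (1 + M powr \<beta>) powr (- \<nu>) - \<beta> * (- \<nu> * (?B (\<nu> + 1) - ?P (\<nu> + 1)))) / (\<nu> * \<beta> - s))"
      by simp
    also have "\<dots> = ?B \<nu> - ?P \<nu>"
    proof -
      \<comment> \<open>A pole here would be a zero of some denominator
        \<open>\<beta> * (\<nu> + k) - s\<close>.\<close>
      have "\<nu> - s / \<beta> \<notin> \<int>\<^sub>\<le>\<^sub>0"
      proof
        assume "\<nu> - s / \<beta> \<in> \<int>\<^sub>\<le>\<^sub>0"
        then obtain k where "\<nu> - s / \<beta> = - real k" by (auto elim!: nonpos_Ints_cases')
        then show False using nz[of k] assms(1) by (simp add: field_simps)
      qed
      then have G: "Gamma (\<nu> - s / \<beta> + 1) = (\<nu> - s / \<beta>) * Gamma (\<nu> - s / \<beta>)" by (rule Gamma_plus1)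
      have G2: "Gamma (\<nu> + 1) = \<nu> * Gamma \<nu>" using Suc.prems(2) by (intro Gamma_plus1) (auto simp: nonpos_Ints_def)
      have Gnz: "Gamma \<nu> > 0" using Suc.prems(2) by simp
      have "\<nu> * \<beta> * ?B (\<nu> + 1) = (\<nu> * \<beta> - s) * ?B \<nu>"
      proof -
        have "\<nu> + 1 - s / \<beta> = \<nu> - s / \<beta> + 1" by simp
        then have B: "?B (\<nu> + 1) = (\<nu> - s / \<beta>) * (Gamma (s / \<beta>) * Gamma (\<nu> - s / \<beta>)) / (\<nu> * (\<beta> * Gamma \<nu>))"
          by (simp only: G G2 mult_ac)
        have t: "\<nu> * \<beta> - s = \<beta> * (\<nu> - s / \<beta>)"
          using assms(1) by (simp add: field_simps)
        show ?thesis
          unfolding B t using assms(1) Suc.prems(2) Gnz by simp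
      qed
      with parts have "M powr s * (1 + M powr \<beta>) powr (- \<nu>) - \<beta> * (- \<nu> * (?B (\<nu> + 1) - ?P (\<nu> + 1)))
          = (\<nu> * \<beta> - s) * (?B \<nu> - ?P \<nu>)"
        by (simp add: algebra_simps)
      then show ?thesis using nz0 by simp
    qed
    finally show ?case .
  qed
qed

section \<open>The small-parameter expansion of the Gaussian integral\<close>

text \<open>Integration of a series against counting measure; the product majorant provides all the
  summability conditions at once.\<close>

lemma suminf_swap_dominated:
  fixes D :: "nat \<Rightarrow> nat \<Rightarrow> real"
  assumes D: "\<And>l j. \<bar>D l j\<bar> \<le> a l * b j" and a: "summable a" and b: "summable b"
  shows "(\<lambda>l. \<Sum>j. D l j) sums (\<Sum>j. \<Sum>l. D l j)"
proof -
  let ?M = "count_space (UNIV :: nat set)"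
  have sumj: "summable (\<lambda>j. \<bar>D l j\<bar>)" for l
    by (rule summable_comparison_test'[of "\<lambda>j. a l * b j"]) (use D b in \<open>auto intro: summable_mult\<close>)
  have suml: "summable (\<lambda>l. \<bar>D l j\<bar>)" for j
    by (rule summable_comparison_test'[of "\<lambda>l. a l * b j"]) (use D a in \<open>auto intro: summable_mult2\<close>)
  have int: "integrable ?M (D l)" for l
    using sumj by (simp add: integrable_count_space_nat_iff)
  have S: "summable (\<lambda>l. \<integral>j. norm (D l j) \<partial>?M)"
  proof (rule summable_comparison_test'[of "\<lambda>l. a l * (\<Sum>j. b j)"])
    show "summable (\<lambda>l. a l * suminf b)" using a by (rule summable_mult2)
    fix l
    have "(\<integral>j. norm (D l j) \<partial>?M) = (\<Sum>j. \<bar>D l j\<bar>)"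
      using sumj[of l] by (subst integral_count_space_nat) (auto simp: integrable_count_space_nat_iff)
    also have "\<dots> \<le> (\<Sum>j. a l * b j)"
      using D b sumj by (intro suminf_le summable_mult) auto
    also have "\<dots> = a l * suminf b" using b by (rule suminf_mult)
    finally show "norm (\<integral>j. norm (D l j) \<partial>?M) \<le> a l * suminf b"
      by (simp add: Bochner_Integration.integral_nonneg)
  qed
  have AE: "AE j in ?M. summable (\<lambda>l. norm (D l j))" using suml by simp
  have "(\<lambda>l. integral\<^sup>L ?M (D l)) sums (\<integral>j. (\<Sum>l. D l j) \<partial>?M)"
    by (rule sums_integral[OF int AE S])
  moreover have "integrable ?M (\<lambda>j. \<Sum>l. D l j)"
    by (rule integrable_suminf[OF int AE S])
  ultimately show ?thesis
    using int by (simp add: integral_count_space_nat)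
qed

text \<open>
  The boundary terms at \<open>M\<close> of the two continued expansions cancel against each other.
\<close>

lemma radial_Gauss_expansion:
  fixes \<beta> \<nu> N w \<delta> :: real
  assumes "\<beta> > 0" "\<nu> > 0" "N > 0" "w > 0" "\<delta> > 0"
    and gap: "\<And>j l :: nat. \<delta> \<le> \<bar>N + real j - \<beta> * (\<nu> + real l)\<bar>"
  defines "E1 \<equiv> \<lambda>l::nat. (- \<nu> gchoose l) * Gamma (N - \<beta> * (\<nu> + real l))"
    and "E2 \<equiv> \<lambda>j::nat. Gamma ((N + real j) / \<beta>) * Gamma (\<nu> - (N + real j) / \<beta>) / (\<beta> * Gamma \<nu>)"
  shows "summable (\<lambda>l. \<bar>E1 l\<bar> * w powr (\<beta> * (\<nu> + real l) - N))"
    and "summable (\<lambda>j. \<bar>E2 j\<bar> * (w ^ j / fact j))"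
    and "(LBINT v:{0<..}. (1 + v powr \<beta>) powr (- \<nu>) * v powr (N - 1) * exp (- (w * v))) =
      (\<Sum>l. E1 l * w powr (\<beta> * (\<nu> + real l) - N)) + (\<Sum>j. E2 j * ((- w) ^ j / fact j))"
proof -
  \<comment> \<open>Any number above 1 would do: the exponential series converges below it, and the
    binomial series converges absolutely from it onwards.\<close>
  define M :: real where "M = 2"
  have M: "M > 1" by (simp add: M_def)
  define g where "g v = (1 + v powr \<beta>) powr (- \<nu>)" for v :: real
  have gm [measurable]: "g \<in> borel_measurable borel" unfolding g_def by measurable
  have gb: "\<bar>g v\<bar> \<le> 1" for v
    unfolding g_def using assms by (simp add: powr_minus inverse_le_1_iff ge_one_powr_ge_zero)
  define c where "c l = (- \<nu> gchoose l)" for l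
  define s where "s l = N - \<beta> * (\<nu> + real l)" for l :: nat
  define P where "P j = (LBINT v:{0<..<M}. g v * v powr (N + real j - 1))" for j :: nat
  define J where "J l = (LBINT v:{M<..}. v powr (s l - 1) * exp (- (w * v)))" for l
  \<comment> \<open>The terms of the incomplete Gamma series at exponent \<open>s l\<close>. The
    products \<open>c l * q l j\<close> are the boundary terms common to both expansions.\<close>
  define q where "q l j = (- w) ^ j / fact j * (M powr (s l + real j) / (s l + real j))" for l j
  define J' where "J' = (LBINT v:{M<..}. v powr (N - 1) * exp (- (w * v)))"
  have cM: "summable (\<lambda>l. \<bar>c l\<bar> * M powr s l)"
  proof -
    have "summable (\<lambda>l. M powr N * (\<bar>c l\<bar> * M powr (- (\<beta> * (\<nu> + real l)))))"
      unfolding c_def using assms M by (intro summable_mult summable_abs_gbinomial) auto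
    then show ?thesis by (simp add: s_def powr_diff powr_minus divide_inverse mult_ac)
  qed
  have eM: "summable (\<lambda>j. (w * M) ^ j / fact j)"
    using exp_powser_sums[of "- w" M] by (simp add: sums_iff power_mult_distrib)
  have sj: "\<delta> \<le> \<bar>s l + real j\<bar>" for l j
    using gap[of j l] by (simp add: s_def algebra_simps)
  have sj0: "s l + real j \<noteq> 0" for l j
    using sj[of l j] \<open>\<delta> > 0\<close> by auto
  have intJ: "set_integrable lborel {M<..} (\<lambda>v. v powr (t - 1) * exp (- (w * v)))" for t
    using assms M by (intro set_integrable_powr_exp_Ioi) auto
  have JnonNeg: "J l \<ge> 0" for l
    unfolding J_def set_lebesgue_integral_def by (intro Bochner_Integration.integral_nonneg) auto
  have sl_eq: "v powr (s l - 1) = v powr (- (\<beta> * (\<nu> + real l))) * v powr (N - 1)" for v l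
    by (simp add: s_def powr_add[symmetric] algebra_simps)
  \<comment> \<open>Beyond \<open>M\<close>, the decreasing factor
    \<open>v powr (- (\<beta> * (\<nu> + l)))\<close> is at most its value at \<open>M\<close>; the
    remaining integral \<open>J'\<close> does not depend on \<open>l\<close>.\<close>
  have Jle: "J l \<le> M powr s l * (M powr (- N) * J')" for l
  proof -
    have "J l \<le> (LBINT v:{M<..}. M powr (- (\<beta> * (\<nu> + real l))) * (v powr (N - 1) * exp (- (w * v))))"
      unfolding J_def
    proof (intro set_integral_mono set_integrable_mult_right intJ)
      fix v assume "v \<in> {M<..}"
      then have "v powr (- (\<beta> * (\<nu> + real l))) \<le> M powr (- (\<beta> * (\<nu> + real l)))"
        using M assms by (intro powr_mono2') auto
      then show "v powr (s l - 1) * exp (- (w * v)) \<le> M powr (- (\<beta> * (\<nu> + real l))) * (v powr (N - 1) * exp (- (w * v)))"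
        unfolding sl_eq by (simp add: mult_right_mono mult.assoc[symmetric])
    qed
    also have "\<dots> = M powr (- (\<beta> * (\<nu> + real l))) * J'"
      unfolding set_integral_mult_right J'_def ..
    also have "M powr (- (\<beta> * (\<nu> + real l))) = M powr s l * M powr (- N)"
      by (simp add: s_def powr_add[symmetric])
    finally show ?thesis by (simp only: mult.assoc)
  qed
  have tail: "(\<lambda>l. c l * J l) sums (LBINT v:{M<..}. g v * v powr (N - 1) * exp (- (w * v)))"
  proof -
    let ?f = "\<lambda>l v. c l * (v powr (s l - 1) * exp (- (w * v)))"
    have S: "summable (\<lambda>l. \<bar>?f l v\<bar>)" if "v > M" for v
    proof -
      have "summable (\<lambda>l. v powr (N - 1) * exp (- (w * v)) * (\<bar>- \<nu> gchoose l\<bar> * v powr (- (\<beta> * (\<nu> + real l)))))"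
        using assms M that by (intro summable_mult summable_abs_gbinomial) auto
      then show ?thesis by (simp add: sl_eq c_def abs_mult mult_ac)
    qed
    have absf: "(LBINT v:{M<..}. \<bar>?f l v\<bar>) = \<bar>c l\<bar> * J l" for l
      by (simp add: J_def abs_mult)
    have S2: "summable (\<lambda>l. LBINT v:{M<..}. \<bar>?f l v\<bar>)"
      unfolding absf
    proof (rule summable_comparison_test'[of "\<lambda>l. \<bar>c l\<bar> * M powr s l * (M powr (- N) * J')"])
      show "summable (\<lambda>l. \<bar>c l\<bar> * M powr s l * (M powr (- N) * J'))"
        using cM by (rule summable_mult2)
      show "norm (\<bar>c l\<bar> * J l) \<le> \<bar>c l\<bar> * M powr s l * (M powr (- N) * J')" for l
        using mult_left_mono[OF Jle[of l], of "\<bar>c l\<bar>"] JnonNeg[of l] by (simp add: abs_mult mult_ac)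
    qed
    have "(\<lambda>l. LBINT v:{M<..}. ?f l v) sums (LBINT v:{M<..}. (\<Sum>l. ?f l v))"
      using S by (intro set_integral_suminf(2) S2 set_integrable_mult_right intJ) auto
    also have "(LBINT v:{M<..}. (\<Sum>l. ?f l v)) = (LBINT v:{M<..}. g v * v powr (N - 1) * exp (- (w * v)))"
    proof (intro set_lebesgue_integral_cong allI impI)
      fix v assume v: "v \<in> {M<..}"
      have "(\<lambda>l. v powr (N - 1) * exp (- (w * v)) * ((- \<nu> gchoose l) * v powr (- (\<beta> * (\<nu> + real l)))))
        sums (v powr (N - 1) * exp (- (w * v)) * g v)"
        unfolding g_def using v M assms by (intro sums_mult one_plus_powr_neg_sums) auto
      then show "(\<Sum>l. ?f l v) = g v * v powr (N - 1) * exp (- (w * v))"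
        by (simp add: sl_eq c_def sums_iff mult_ac)
    qed auto
    finally show ?thesis by (simp add: J_def)
  qed
  have head: "(\<lambda>j. (- w) ^ j / fact j * P j) sums (LBINT v:{0<..<M}. g v * v powr (N - 1) * exp (- (w * v)))"
    unfolding P_def using assms M gb by (intro sums_integral_Ioo_powr_exp(1)) auto
  have Ple: "\<bar>P j\<bar> \<le> M powr N / N * M ^ j" for j
  proof -
    have "\<bar>P j\<bar> \<le> (LBINT v:{0<..<M}. \<bar>g v * v powr (N + real j - 1)\<bar>)"
      using integral_abs_bound[of lborel "\<lambda>v. indicator {0<..<M} v *\<^sub>R (g v * v powr (N + real j - 1))"]
      unfolding P_def set_lebesgue_integral_def by (simp add: abs_mult)
    also have "\<dots> \<le> M powr N / N * M ^ j"
      using assms M gb by (intro sums_integral_Ioo_powr_exp(3)[where w=0]) auto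
    finally show ?thesis .
  qed
  have q_sums: "q l sums (Gamma (s l) * w powr (- s l) - J l)" for l
    unfolding q_def J_def using assms M sj0 by (intro Gamma_incomplete_sums) auto
  \<comment> \<open>Thanks to \<open>\<delta>\<close> the bound is a function of \<open>l\<close>
    times a function of \<open>j\<close>, the form that the exchange of sums requires.\<close>
  have qle: "\<bar>q l j\<bar> \<le> M powr s l / \<delta> * ((w * M) ^ j / fact j)" for l j
  proof -
    have "\<bar>q l j\<bar> = w ^ j / fact j * (M powr (s l + real j) / \<bar>s l + real j\<bar>)"
      using assms by (simp add: q_def abs_mult power_abs)
    also have "\<dots> \<le> w ^ j / fact j * (M powr (s l + real j) / \<delta>)"
      using assms sj[of l j] by (intro mult_left_mono divide_left_mono) auto
    also have "\<dots> = M powr s l / \<delta> * ((w * M) ^ j / fact j)"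
      using M by (simp add: powr_add powr_realpow power_mult_distrib mult_ac)
    finally show ?thesis .
  qed
  let ?e = "\<Sum>j. (w * M) ^ j / fact j"
  \<comment> \<open>The size of Gamma at large negative arguments is not estimated directly; it is
    read off from the series identity \<open>q_sums\<close>.\<close>
  have Gle: "\<bar>Gamma (s l) * w powr (- s l)\<bar> \<le> M powr s l * (M powr (- N) * J' + ?e / \<delta>)" for l
  proof -
    have sq: "summable (\<lambda>j. \<bar>q l j\<bar>)"
      by (rule summable_comparison_test'[OF summable_mult[OF eM, of "M powr s l / \<delta>"]])
        (use qle in auto)
    have "\<bar>\<Sum>j. q l j\<bar> \<le> (\<Sum>j. \<bar>q l j\<bar>)"
      using sq by (rule summable_rabs)
    also have "\<dots> \<le> (\<Sum>j. M powr s l / \<delta> * ((w * M) ^ j / fact j))"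
      using sq eM qle by (intro suminf_le summable_mult) auto
    also have "\<dots> = M powr s l * (?e / \<delta>)"
      using suminf_mult[OF eM, of "M powr s l / \<delta>"] by simp
    finally have "\<bar>Gamma (s l) * w powr (- s l) - J l\<bar> \<le> M powr s l * (?e / \<delta>)"
      using q_sums[of l] by (simp add: sums_iff)
    then show ?thesis using Jle[of l] JnonNeg[of l] unfolding distrib_left by linarith
  qed
  have negs: "\<beta> * (\<nu> + real l) - N = - s l" for l by (simp add: s_def)
  have E1: "E1 l = c l * Gamma (s l)" for l by (simp add: E1_def c_def s_def)
  show sumE1: "summable (\<lambda>l. \<bar>E1 l\<bar> * w powr (\<beta> * (\<nu> + real l) - N))"
  proof (rule summable_comparison_test'[of "\<lambda>l. \<bar>c l\<bar> * M powr s l * (M powr (- N) * J' + ?e / \<delta>)"])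
    show "summable (\<lambda>l. \<bar>c l\<bar> * M powr s l * (M powr (- N) * J' + ?e / \<delta>))"
      using cM by (rule summable_mult2)
    show "norm (\<bar>E1 l\<bar> * w powr (\<beta> * (\<nu> + real l) - N)) \<le> \<bar>c l\<bar> * M powr s l * (M powr (- N) * J' + ?e / \<delta>)" for l
      using mult_left_mono[OF Gle[of l], of "\<bar>c l\<bar>"]
      unfolding negs E1 by (simp only: abs_mult real_norm_def abs_abs mult.assoc abs_ge_zero simp_thms)
  qed
  \<comment> \<open>The continued Mellin expansion at exponent \<open>N + j\<close>. Its
    denominators are the negatives of those in \<open>q\<close>, which is the source of the
    cancellation.\<close>
  have mell: "(\<lambda>l. c l * (M powr (s l + real j) / (- (s l + real j)))) sums (E2 j - P j)" for j
  proof -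
    have "(\<lambda>l. (- \<nu> gchoose l) * (M powr (N + real j - \<beta> * (\<nu> + real l)) / (\<beta> * (\<nu> + real l) - (N + real j))))
     sums (Gamma ((N + real j) / \<beta>) * Gamma (\<nu> - (N + real j) / \<beta>) / (\<beta> * Gamma \<nu>)
        - (LBINT v:{0<..<M}. (1 + v powr \<beta>) powr (- \<nu>) * v powr (N + real j - 1)))"
      using assms M gap[of j] by (intro Mellin_continued_sums[where \<delta>=\<delta>]) (auto simp: abs_minus_commute)
    then show ?thesis
      by (simp add: c_def s_def E2_def P_def g_def algebra_simps)
  qed
  have sumE2P: "\<bar>E2 j - P j\<bar> \<le> M ^ j * ((\<Sum>l. \<bar>c l\<bar> * M powr s l) / \<delta>)" for j
  proof -
    let ?r = "\<lambda>l. c l * (M powr (s l + real j) / (- (s l + real j)))"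
    have le: "\<bar>?r l\<bar> \<le> M ^ j / \<delta> * (\<bar>c l\<bar> * M powr s l)" for l
    proof -
      have "\<bar>?r l\<bar> = \<bar>c l\<bar> * (M powr (s l + real j) / \<bar>s l + real j\<bar>)"
        by (simp only: abs_mult abs_divide abs_minus_cancel abs_of_nonneg[OF powr_ge_zero])
      also have "\<dots> \<le> \<bar>c l\<bar> * (M powr (s l + real j) / \<delta>)"
        using assms sj[of l j] by (intro mult_left_mono divide_left_mono) auto
      also have "\<dots> = M ^ j / \<delta> * (\<bar>c l\<bar> * M powr s l)"
        using M by (simp add: powr_add powr_realpow)
      finally show ?thesis .
    qed
    have sr: "summable (\<lambda>l. \<bar>?r l\<bar>)"
      by (rule summable_comparison_test'[OF summable_mult[OF cM, of "M ^ j / \<delta>"]]) (use le in auto)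
    have "\<bar>\<Sum>l. ?r l\<bar> \<le> (\<Sum>l. \<bar>?r l\<bar>)"
      using sr by (rule summable_rabs)
    also have "\<dots> \<le> (\<Sum>l. M ^ j / \<delta> * (\<bar>c l\<bar> * M powr s l))"
      using sr cM le by (intro suminf_le summable_mult) auto
    also have "\<dots> = M ^ j * ((\<Sum>l. \<bar>c l\<bar> * M powr s l) / \<delta>)"
      using suminf_mult[OF cM, of "M ^ j / \<delta>"] by simp
    finally show ?thesis using mell[of j] by (simp add: sums_iff)
  qed
  define K where "K = (\<Sum>l. \<bar>c l\<bar> * M powr s l) / \<delta> + M powr N / N"
  \<comment> \<open>\<open>E2\<close> grows at most geometrically, so division by
    \<open>fact j\<close> gives convergence for every \<open>w\<close>.\<close>
  have E2le: "\<bar>E2 j\<bar> \<le> M ^ j * K" for j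
    using sumE2P[of j] Ple[of j] by (simp add: K_def distrib_left mult.commute)
  show sumE2: "summable (\<lambda>j. \<bar>E2 j\<bar> * (w ^ j / fact j))"
  proof (rule summable_comparison_test'[OF summable_mult[OF eM, of K]])
    show "norm (\<bar>E2 j\<bar> * (w ^ j / fact j)) \<le> K * ((w * M) ^ j / fact j)" for j
      using mult_right_mono[OF E2le[of j], of "w ^ j / fact j"] assms
      by (simp add: power_mult_distrib mult_ac)
  qed
  have sE1: "summable (\<lambda>l. E1 l * w powr (- s l))"
    using sumE1 by - (rule summable_rabs_cancel, simp add: abs_mult negs)
  have sE2: "summable (\<lambda>j. E2 j * ((- w) ^ j / fact j))"
    using sumE2 assms by - (rule summable_rabs_cancel, simp add: abs_mult power_abs)
  have "(\<lambda>l. \<Sum>j. c l * q l j) sums (\<Sum>j. \<Sum>l. c l * q l j)"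
  proof (rule suminf_swap_dominated)
    show "\<bar>c l * q l j\<bar> \<le> \<bar>c l\<bar> * M powr s l * ((w * M) ^ j / fact j / \<delta>)" for l j
      using mult_left_mono[OF qle[of l j], of "\<bar>c l\<bar>"] by (simp add: abs_mult mult_ac)
  qed (intro cM summable_divide eM)+
  also have "(\<lambda>l. \<Sum>j. c l * q l j) = (\<lambda>l. E1 l * w powr (- s l) - c l * J l)"
  proof
    fix l
    have "(\<Sum>j. c l * q l j) = c l * (Gamma (s l) * w powr (- s l) - J l)"
      using sums_mult[OF q_sums[of l], of "c l"] by (rule sums_unique[symmetric])
    then show "(\<Sum>j. c l * q l j) = E1 l * w powr (- s l) - c l * J l"
      by (simp only: E1 right_diff_distrib mult.assoc)
  qed
  also have "(\<lambda>j. \<Sum>l. c l * q l j) = (\<lambda>j. (- w) ^ j / fact j * P j - E2 j * ((- w) ^ j / fact j))"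
  proof
    fix j
    have "(\<lambda>l. - ((- w) ^ j / fact j) * (c l * (M powr (s l + real j) / (- (s l + real j))))) sums (- ((- w) ^ j / fact j) * (E2 j - P j))"
      by (intro sums_mult mell)
    also have "(\<lambda>l. - ((- w) ^ j / fact j) * (c l * (M powr (s l + real j) / (- (s l + real j))))) = (\<lambda>l. c l * q l j)"
      by (simp only: q_def divide_minus_right mult_minus_left mult_minus_right minus_minus mult.left_commute)
    finally have "(\<Sum>l. c l * q l j) = - ((- w) ^ j / fact j) * (E2 j - P j)"
      by (simp add: sums_iff)
    also have "- x * (y - z) = x * z - y * x" for x y z :: real
      by (simp add: algebra_simps)
    finally show "(\<Sum>l. c l * q l j) = (- w) ^ j / fact j * P j - E2 j * ((- w) ^ j / fact j)"
      .
  qed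
  finally have swap: "(\<lambda>l. E1 l * w powr (- s l) - c l * J l) sums
     (\<Sum>j. (- w) ^ j / fact j * P j - E2 j * ((- w) ^ j / fact j))" .
  \<comment> \<open>The double sum taken by rows equals the double sum taken by columns. Rearranged,
    head plus tail of the integral is the sum of the \<open>E1\<close> and \<open>E2\<close>
    series.\<close>
  have "(\<Sum>l. E1 l * w powr (- s l)) - (\<Sum>l. c l * J l) = (\<Sum>j. (- w) ^ j / fact j * P j) - (\<Sum>j. E2 j * ((- w) ^ j / fact j))"
    using swap suminf_diff[OF sE1 sums_summable[OF tail]] suminf_diff[OF sums_summable[OF head] sE2]
    by (simp add: sums_iff)
  moreover have "(LBINT v:{0<..}. g v * v powr (N - 1) * exp (- (w * v))) = (\<Sum>j. (- w) ^ j / fact j * P j) + (\<Sum>l. c l * J l)"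
  proof -
    have int: "set_integrable lborel {0<..} (\<lambda>v. g v * v powr (N - 1) * exp (- (w * v)))"
      by (rule set_integrable_bound[OF set_integral_Gamma(1)[OF \<open>N > 0\<close> \<open>w > 0\<close>]])
        (use gb in \<open>auto simp: set_borel_measurable_def abs_mult mult_left_le_one_le mult.assoc intro!: AE_I2\<close>)
    show ?thesis
      unfolding sums_unique[OF head, symmetric] sums_unique[OF tail, symmetric]
      by (rule set_integral_split_Ioi[OF int]) (use M in simp)
  qed
  ultimately show "(LBINT v:{0<..}. (1 + v powr \<beta>) powr (- \<nu>) * v powr (N - 1) * exp (- (w * v))) =
      (\<Sum>l. E1 l * w powr (\<beta> * (\<nu> + real l) - N)) + (\<Sum>j. E2 j * ((- w) ^ j / fact j))"
    unfolding negs g_def by simp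
qed

section \<open>Gaussian and radial integrals in Euclidean space\<close>

text \<open>The characteristic function of the standard normal law at
  \<open>z / sqrt (2 * w)\<close>, after scaling the variable by
  \<open>sqrt (2 * w)\<close>.\<close>

lemma has_bochner_integral_Gauss_real:
  fixes w z :: real
  assumes "w > 0"
  shows "has_bochner_integral lborel (\<lambda>u. iexp (z * u) * complex_of_real (exp (- (w * u\<^sup>2))))
     (complex_of_real (sqrt (pi / w) * exp (- (z\<^sup>2 / (4 * w)))))"
proof -
  define t where "t = z / sqrt (2 * w)"
  let ?h = "\<lambda>x. std_normal_density x *\<^sub>R iexp (t * x)"
  have "integrable std_normal_distribution (\<lambda>x. iexp (t * x))"
  proof -
    interpret prob_space std_normal_distribution by (rule prob_space_normal_density) simp
    show ?thesis by (intro integrable_const_bound[where B=1]) auto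
  qed
  then have "integrable lborel ?h"
    by (subst (asm) integrable_density) auto
  moreover have "integral\<^sup>L lborel ?h = complex_of_real (exp (- (t^2) / 2))"
    using char_std_normal_distribution unfolding char_def fun_eq_iff
    by (subst (asm) integral_density) auto
  ultimately have "has_bochner_integral lborel ?h (complex_of_real (exp (- (t^2) / 2)))"
    by (simp add: has_bochner_integral_iff)
  then have "has_bochner_integral lborel (\<lambda>u. ?h (0 + sqrt (2 * w) * u)) (complex_of_real (exp (- (t^2) / 2)) /\<^sub>R \<bar>sqrt (2 * w)\<bar>)"
    using assms by (subst (asm) lborel_has_bochner_integral_real_affine_iff[of "sqrt (2 * w)" _ _ 0]) auto
  then have "has_bochner_integral lborel (\<lambda>u. sqrt (2 * pi) *\<^sub>R ?h (0 + sqrt (2 * w) * u))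
      (sqrt (2 * pi) *\<^sub>R (complex_of_real (exp (- (t^2) / 2)) /\<^sub>R \<bar>sqrt (2 * w)\<bar>))"
    by (intro has_bochner_integral_scaleR_right) auto
  moreover have "sqrt (2 * pi) *\<^sub>R ?h (0 + sqrt (2 * w) * u) = iexp (z * u) * complex_of_real (exp (- (w * u\<^sup>2)))" for u
  proof -
    have "t * (sqrt (2 * w) * u) = z * u" using assms by (simp add: t_def)
    then have e: "iexp (t * (0 + sqrt (2 * w) * u)) = iexp (z * u)" by (simp only: add_0)
    have "std_normal_density (0 + sqrt (2 * w) * u) = exp (- (w * u\<^sup>2)) / sqrt (2 * pi)"
      using assms by (simp add: std_normal_density_def power_mult_distrib)
    then show ?thesis unfolding e by (simp add: scaleR_conv_of_real)
  qed
  moreover have "sqrt (2 * pi) *\<^sub>R (complex_of_real (exp (- (t^2) / 2)) /\<^sub>R \<bar>sqrt (2 * w)\<bar>)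
      = complex_of_real (sqrt (pi / w) * exp (- (z\<^sup>2 / (4 * w))))"
  proof -
    have a: "- (t^2) / 2 = - (z\<^sup>2 / (4 * w))"
      using assms by (simp add: t_def power_divide)
    have "sqrt (2 * pi) * inverse (sqrt (2 * w)) = sqrt (2 * pi / (2 * w))"
      unfolding real_sqrt_divide by (rule divide_inverse[symmetric])
    also have "2 * pi / (2 * w) = pi / w" by simp
    finally have b: "sqrt (2 * pi) * inverse \<bar>sqrt (2 * w)\<bar> = sqrt (pi / w)" using assms by simp
    show ?thesis
      unfolding a scaleR_scaleR b by (simp only: scaleR_conv_of_real of_real_mult)
  qed
  ultimately show ?thesis by simp
qed

text \<open>A product of one-dimensional integrals. The complex exponential factorises over the
  coordinates and the cosine does not, so the real part is taken only at the end.\<close>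

lemma has_bochner_integral_Gauss:
  fixes z :: "'a::euclidean_space" and w :: real
  assumes "w > 0"
  shows "has_bochner_integral lborel (\<lambda>x. cos (z \<bullet> x) * exp (- (w * (norm x)\<^sup>2)))
     ((pi / w) powr (DIM('a) / 2) * exp (- ((norm z)\<^sup>2 / (4 * w))))"
proof -
  interpret product_sigma_finite "\<lambda>_::'a. lborel :: real measure" by standard
  let ?F = "\<lambda>b u. iexp ((z \<bullet> b) * u) * complex_of_real (exp (- (w * u\<^sup>2)))"
  let ?G = "\<lambda>x. iexp (z \<bullet> x) * complex_of_real (exp (- (w * (norm x)\<^sup>2)))"
  let ?S = "\<lambda>f. \<Sum>b\<in>Basis. f b *\<^sub>R b :: 'a"
  have G: "?G (?S f) = (\<Prod>b\<in>Basis. ?F b (f b))" for f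
  proof -
    have 1: "z \<bullet> ?S f = (\<Sum>b\<in>Basis. (z \<bullet> b) * f b)"
      by (simp add: inner_sum_right mult.commute)
    have 2: "(norm (?S f))\<^sup>2 = (\<Sum>b\<in>Basis. (f b)\<^sup>2)"
      unfolding power2_norm_eq_inner
      by (subst euclidean_inner) (simp add: inner_sum_left_Basis power2_eq_square)
    have 3: "\<i> * complex_of_real (\<Sum>b\<in>Basis. (z \<bullet> b) * f b) = (\<Sum>b\<in>Basis. \<i> * complex_of_real ((z \<bullet> b) * f b))"
      by (simp only: of_real_sum sum_distrib_left)
    have 4: "- (w * (\<Sum>b\<in>Basis. (f b)\<^sup>2)) = (\<Sum>b\<in>(Basis::'a set). - (w * (f b)\<^sup>2))"
      by (simp only: sum_negf sum_distrib_left)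
    show ?thesis unfolding 1 2 3 4
      by (simp only: exp_sum finite_Basis of_real_prod prod.distrib)
  qed
  have Fi: "integrable lborel (?F b)" and Fv: "integral\<^sup>L lborel (?F b) = complex_of_real (sqrt (pi / w) * exp (- ((z \<bullet> b)\<^sup>2 / (4 * w))))" for b
    using has_bochner_integral_Gauss_real[OF assms, of "z \<bullet> b"] by (auto simp: has_bochner_integral_iff)
  have "integrable (Pi\<^sub>M Basis (\<lambda>_. lborel)) (\<lambda>f. \<Prod>b\<in>Basis. ?F b (f b))"
    by (intro product_integrable_prod Fi) auto
  moreover have "(\<integral>f. (\<Prod>b\<in>Basis. ?F b (f b)) \<partial>Pi\<^sub>M Basis (\<lambda>_. lborel)) = (\<Prod>b\<in>(Basis::'a set). integral\<^sup>L lborel (?F b))"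
    by (intro product_integral_prod Fi) auto
  ultimately have "has_bochner_integral (Pi\<^sub>M Basis (\<lambda>_. lborel)) (\<lambda>f. ?G (?S f))
     (\<Prod>b\<in>(Basis::'a set). complex_of_real (sqrt (pi / w) * exp (- ((z \<bullet> b)\<^sup>2 / (4 * w)))))"
    unfolding has_bochner_integral_iff G Fv by simp
  moreover have "(\<Prod>b\<in>(Basis::'a set). complex_of_real (sqrt (pi / w) * exp (- ((z \<bullet> b)\<^sup>2 / (4 * w)))))
      = complex_of_real ((pi / w) powr (DIM('a) / 2) * exp (- ((norm z)\<^sup>2 / (4 * w))))"
  proof -
    have "(\<Prod>b\<in>(Basis::'a set). sqrt (pi / w) * exp (- ((z \<bullet> b)\<^sup>2 / (4 * w))))
      = sqrt (pi / w) ^ DIM('a) * exp (- ((\<Sum>b\<in>Basis. (z \<bullet> b)\<^sup>2) / (4 * w)))"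
    proof -
      have "- ((\<Sum>b\<in>(Basis::'a set). (z \<bullet> b)\<^sup>2) / (4 * w)) = (\<Sum>b\<in>(Basis::'a set). - ((z \<bullet> b)\<^sup>2 / (4 * w)))"
        by (simp only: sum_negf sum_divide_distrib)
      then show ?thesis by (simp only: exp_sum finite_Basis prod.distrib prod_constant)
    qed
    also have "(\<Sum>b\<in>Basis. (z \<bullet> b)\<^sup>2) = (norm z)\<^sup>2"
      unfolding power2_norm_eq_inner by (subst euclidean_inner) (simp add: power2_eq_square)
    also have "sqrt (pi / w) ^ DIM('a) = (pi / w) powr (DIM('a) / 2)"
      using assms by (simp add: powr_half_sqrt[symmetric] powr_realpow[symmetric] powr_powr)
    finally show ?thesis by (simp only: of_real_prod[symmetric])
  qed
  ultimately have "has_bochner_integral (Pi\<^sub>M Basis (\<lambda>_. lborel)) (\<lambda>f. ?G (?S f))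
     (complex_of_real ((pi / w) powr (DIM('a) / 2) * exp (- ((norm z)\<^sup>2 / (4 * w)))))" by simp
  then have "has_bochner_integral lborel ?G (complex_of_real ((pi / w) powr (DIM('a) / 2) * exp (- ((norm z)\<^sup>2 / (4 * w)))))"
    by (subst lborel_eq, intro has_bochner_integral_distr) auto
  from has_bochner_integral_bounded_linear[OF bounded_linear_Re this]
  show ?thesis by (simp add: Re_exp)
qed

text \<open>This replaces polar coordinates. Both measures give \<open>{..a}\<close> with
  \<open>a \<ge> 0\<close> the volume of the ball of radius \<open>sqrt a\<close>, and half-lines
  generate the Borel sets. The squared norm is used because it turns Gaussians into
  exponentials.\<close>

lemma distr_norm_sq:
  fixes N C :: real
  defines "N \<equiv> DIM('a::euclidean_space) / 2" and "C \<equiv> pi powr N / Gamma N"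
  shows "distr (lborel :: 'a measure) borel (\<lambda>x. (norm x)\<^sup>2) =
     density lborel (\<lambda>u. ennreal (indicator {0<..} u * (C * u powr (N - 1))))"
proof (rule measure_eqI_generator_eq[where E="range atMost" and \<Omega>=UNIV and A="\<lambda>i. {..real i}"])
  have N: "N > 0" unfolding N_def by simp
  have C: "C > 0" unfolding C_def using N by simp
  have V: "unit_ball_vol (real DIM('a)) = C / N"
    using N Gamma_plus1[of N] by (simp add: unit_ball_vol_def C_def N_def[symmetric] nonpos_Ints_def)
  have lhs: "emeasure (distr (lborel :: 'a measure) borel (\<lambda>x. (norm x)\<^sup>2)) {..a} = (if a < 0 then 0 else ennreal (C / N * a powr N))" for a
  proof (cases "a < 0")
    case True
    then have "(\<lambda>x::'a. (norm x)\<^sup>2) -` {..a} = {}"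
      by (auto simp: vimage_def) (metis order_less_le_trans not_less zero_le_power2)
    then show ?thesis using True by (subst emeasure_distr) auto
  next
    case False
    have "(\<lambda>x::'a. (norm x)\<^sup>2) -` {..a} = cball 0 (sqrt a)"
      using False by (auto simp: real_le_rsqrt sqrt_ge_absD dest: real_sqrt_le_mono)
    moreover have "sqrt a ^ DIM('a) = a powr N"
      using False by (cases "a = 0") (simp_all add: N_def powr_half_sqrt[symmetric] powr_realpow[symmetric] powr_powr)
    ultimately show ?thesis using False emeasure_cball[of "sqrt a" "0::'a"]
      by (subst emeasure_distr) (auto simp: V)
  qed
  have rhs: "emeasure (density lborel (\<lambda>u. ennreal (indicator {0<..} u * (C * u powr (N - 1))))) {..a} = (if a < 0 then 0 else ennreal (C / N * a powr N))" for a
  proof -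
    let ?g = "\<lambda>u. indicator {0<..} u * (C * u powr (N - 1))"
    have e: "emeasure (density lborel (\<lambda>u. ennreal (?g u))) {..a} = (\<integral>\<^sup>+u. ennreal (?g u) * indicator {..a} u \<partial>lborel)"
      by (subst emeasure_density) auto
    show ?thesis
    proof (cases "a \<le> 0")
      case True
      then have "(\<integral>\<^sup>+u. ennreal (?g u) * indicator {..a} u \<partial>lborel) = (\<integral>\<^sup>+(u::real). 0 \<partial>lborel)"
        by (intro nn_integral_cong) (auto simp: indicator_def)
      then show ?thesis unfolding e using True N by auto
    next
      case False
      have "(\<integral>\<^sup>+u. ennreal (?g u) * indicator {..a} u \<partial>lborel) = (\<integral>\<^sup>+u. ennreal (indicator {0<..<a} u *\<^sub>R (C * u powr (N - 1))) \<partial>lborel)"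
        using AE_lborel_singleton[of a] by (intro nn_integral_cong_AE) (auto elim!: eventually_mono simp: indicator_def)
      also have "\<dots> = ennreal (LBINT u:{0<..<a}. C * u powr (N - 1))"
        unfolding set_lebesgue_integral_def
        using set_integrable_mult_right[OF set_integral_powr_Ioo(1)[OF N, of a], of C] False C
        by (intro nn_integral_eq_integral) (auto simp: set_integrable_def)
      also have "(LBINT u:{0<..<a}. C * u powr (N - 1)) = C / N * a powr N"
        using set_integral_powr_Ioo(2)[OF N, of a] False by simp
      finally show ?thesis unfolding e using False by simp
    qed
  qed
  show "emeasure (distr (lborel :: 'a measure) borel (\<lambda>x. (norm x)\<^sup>2)) X =
     emeasure (density lborel (\<lambda>u. ennreal (indicator {0<..} u * (C * u powr (N - 1))))) X"
    if "X \<in> range atMost" for X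
    using that lhs rhs by auto
  show "emeasure (distr (lborel :: 'a measure) borel (\<lambda>x. (norm x)\<^sup>2)) {..real i} \<noteq> \<infinity>" for i
    unfolding lhs by simp
  show "(\<Union>i. {..real i}) = UNIV"
    using real_arch_simple by auto
qed (auto simp: Int_stable_def borel_eq_atMost)

lemma radial_integral:
  fixes f :: "real \<Rightarrow> real" and N C :: real
  assumes [measurable]: "f \<in> borel_measurable borel"
  defines "N \<equiv> DIM('a::euclidean_space) / 2" and "C \<equiv> pi powr N / Gamma N"
  shows "integrable (lborel :: 'a measure) (\<lambda>x. f ((norm x)\<^sup>2)) \<longleftrightarrow> set_integrable lborel {0<..} (\<lambda>u. f u * u powr (N - 1))"
    and "(\<integral>x. f ((norm x)\<^sup>2) \<partial>(lborel :: 'a measure)) = C * (LBINT u:{0<..}. f u * u powr (N - 1))"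
proof -
  have N: "N > 0" unfolding N_def by simp
  have C: "C > 0" unfolding C_def using N by simp
  note d = distr_norm_sq[where 'a='a, folded N_def, folded C_def]
  have "integrable (lborel :: 'a measure) (\<lambda>x. f ((norm x)\<^sup>2)) \<longleftrightarrow> integrable (distr (lborel :: 'a measure) borel (\<lambda>x. (norm x)\<^sup>2)) f"
    by (subst integrable_distr_eq) auto
  also have "\<dots> \<longleftrightarrow> integrable lborel (\<lambda>u. indicator {0<..} u * (C * u powr (N - 1)) * f u)"
    unfolding d using C by (subst integrable_real_density) auto
  also have "(\<lambda>u. indicator {0<..} u * (C * u powr (N - 1)) * f u) = (\<lambda>u. indicator {0<..} u *\<^sub>R (C * (f u * u powr (N - 1))))"
    by (auto simp: mult_ac)
  also have "integrable lborel \<dots> \<longleftrightarrow> set_integrable lborel {0<..} (\<lambda>u. f u * u powr (N - 1))"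
    unfolding set_integrable_def[symmetric] using C by simp
  finally show "integrable (lborel :: 'a measure) (\<lambda>x. f ((norm x)\<^sup>2)) \<longleftrightarrow> set_integrable lborel {0<..} (\<lambda>u. f u * u powr (N - 1))" .
  have "(\<integral>x. f ((norm x)\<^sup>2) \<partial>(lborel :: 'a measure)) = integral\<^sup>L (distr (lborel :: 'a measure) borel (\<lambda>x. (norm x)\<^sup>2)) f"
    by (subst integral_distr) auto
  also have "\<dots> = (\<integral>u. indicator {0<..} u * (C * u powr (N - 1)) * f u \<partial>lborel)"
    unfolding d using C by (subst integral_real_density) auto
  also have "\<dots> = (LBINT u:{0<..}. C * (f u * u powr (N - 1)))"
    unfolding set_lebesgue_integral_def by (intro Bochner_Integration.integral_cong) (auto simp: mult_ac)
  finally show "(\<integral>x. f ((norm x)\<^sup>2) \<partial>(lborel :: 'a measure)) = C * (LBINT u:{0<..}. f u * u powr (N - 1))"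
    by simp
qed

text \<open>A polynomial in \<open>g\<close> integrates to 0 against \<open>h\<close>, and
  \<open>\<psi>\<close> is within \<open>e\<close> of a polynomial on the unit interval, so the
  integral is at most \<open>e\<close> times that of \<open>\<bar>h\<bar>\<close>. With
  \<open>g\<close> a Gaussian this serves both the uniqueness of Laplace transforms and the radial
  symmetry.\<close>

lemma integral_zero_of_moments_zero:
  fixes h g :: "'b \<Rightarrow> real" and \<psi> :: "real \<Rightarrow> real"
  assumes h: "integrable M h" and g [measurable]: "g \<in> borel_measurable M" and g01: "\<And>x. g x \<in> {0..1}"
    and mom: "\<And>k::nat. (\<integral>x. h x * g x ^ k \<partial>M) = 0" and \<psi>: "continuous_on {0..1} \<psi>"
  shows "(\<integral>x. h x * \<psi> (g x) \<partial>M) = 0"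
proof -
  have [measurable]: "h \<in> borel_measurable M" using h by simp
  have bint: "integrable M (\<lambda>x. h x * F (g x))" if F: "continuous_on {0..1} F" for F :: "real \<Rightarrow> real"
  proof -
    obtain B where "\<forall>y\<in>F ` {0..1}. norm y \<le> B"
      using compact_imp_bounded[OF compact_continuous_image[OF F compact_Icc]]
      unfolding bounded_iff by blast
    then have B: "\<And>v. v \<in> {0..1} \<Longrightarrow> \<bar>F v\<bar> \<le> B" by simp
    \<comment> \<open>\<open>F\<close> is known to be continuous on the unit interval only; the
      cut-off function is Borel on the line, and \<open>g\<close> never leaves the interval.\<close>
    have "(\<lambda>v. indicator {0..1} v *\<^sub>R F v) \<in> borel_measurable borel"
      using F by (intro borel_measurable_continuous_on_indicator) auto
    then have "(\<lambda>x. indicator {0..1} (g x) *\<^sub>R F (g x)) \<in> borel_measurable M"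
      using measurable_compose[OF g] by blast
    then have [measurable]: "(\<lambda>x. F (g x)) \<in> borel_measurable M"
      using g01 by simp
    show ?thesis
    proof (rule Bochner_Integration.integrable_bound)
      show "integrable M (\<lambda>x. B * h x)" using h by simp
      show "AE x in M. norm (h x * F (g x)) \<le> norm (B * h x)"
      proof (rule AE_I2)
        fix x
        have "\<bar>F (g x)\<bar> \<le> \<bar>B\<bar>" using B[OF g01[of x]] by linarith
        then show "norm (h x * F (g x)) \<le> norm (B * h x)"
          using mult_left_mono[of "\<bar>F (g x)\<bar>" "\<bar>B\<bar>" "\<bar>h x\<bar>"] by (simp add: abs_mult mult.commute)
      qed
    qed measurable
  qed
  have "\<bar>\<integral>x. h x * \<psi> (g x) \<partial>M\<bar> \<le> e * (\<integral>x. \<bar>h x\<bar> \<partial>M)" if "e > 0" for e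
  proof -
    obtain q where q: "real_polynomial_function q" "\<And>v. v \<in> {0..1} \<Longrightarrow> \<bar>\<psi> v - q v\<bar> < e"
      using Stone_Weierstrass_real_polynomial_function[OF compact_Icc \<psi> \<open>e > 0\<close>] by blast
    then obtain a n where qa: "q = (\<lambda>v. \<Sum>i\<le>n. a i * v ^ i)"
      using real_polynomial_function_iff_sum by blast
    have cq: "continuous_on {0..1} q" unfolding qa by (intro continuous_intros)
    have "(\<integral>x. h x * q (g x) \<partial>M) = (\<integral>x. (\<Sum>i\<le>n. a i * (h x * g x ^ i)) \<partial>M)"
      by (simp add: qa sum_distrib_left mult_ac)
    also have "\<dots> = (\<Sum>i\<le>n. \<integral>x. a i * (h x * g x ^ i) \<partial>M)"
      by (intro Bochner_Integration.integral_sum integrable_mult_right bint continuous_intros)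
    also have "\<dots> = 0" by (simp add: mom)
    finally have "(\<integral>x. h x * \<psi> (g x) \<partial>M) = (\<integral>x. h x * \<psi> (g x) - h x * q (g x) \<partial>M)"
      by (subst Bochner_Integration.integral_diff[OF bint[OF \<psi>] bint[OF cq]]) simp
    also have "\<bar>\<dots>\<bar> \<le> (\<integral>x. \<bar>h x * \<psi> (g x) - h x * q (g x)\<bar> \<partial>M)"
      by (rule integral_abs_bound)
    also have "\<dots> \<le> (\<integral>x. e * \<bar>h x\<bar> \<partial>M)"
    proof (rule integral_mono)
      show "integrable M (\<lambda>x. \<bar>h x * \<psi> (g x) - h x * q (g x)\<bar>)"
        by (intro integrable_abs Bochner_Integration.integrable_diff bint \<psi> cq)
      show "integrable M (\<lambda>x. e * \<bar>h x\<bar>)" using h by simp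
      fix x
      have "\<bar>h x * \<psi> (g x) - h x * q (g x)\<bar> = \<bar>h x\<bar> * \<bar>\<psi> (g x) - q (g x)\<bar>"
        by (simp add: abs_mult[symmetric] right_diff_distrib)
      also have "\<dots> \<le> \<bar>h x\<bar> * e" using q(2)[OF g01[of x]] by (intro mult_left_mono) auto
      finally show "\<bar>h x * \<psi> (g x) - h x * q (g x)\<bar> \<le> e * \<bar>h x\<bar>" by (simp add: mult.commute)
    qed
    finally show ?thesis by simp
  qed
  note * = this
  let ?H = "\<integral>x. \<bar>h x\<bar> \<partial>M"
  have "\<bar>\<integral>x. h x * \<psi> (g x) \<partial>M\<bar> \<le> 0"
  proof (rule field_le_epsilon)
    fix e :: real assume e: "e > 0"
    have H: "?H \<ge> 0" by simp
    then have H1: "?H + 1 > 0" by linarith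
    \<comment> \<open>Adding 1 avoids a division by zero when \<open>?H = 0\<close>.\<close>
    have "\<bar>\<integral>x. h x * \<psi> (g x) \<partial>M\<bar> \<le> e / (?H + 1) * ?H" using e H1 by (intro * divide_pos_pos) auto
    also have "\<dots> \<le> e" using e H1 by (simp add: field_simps)
    finally show "\<bar>\<integral>x. h x * \<psi> (g x) \<partial>M\<bar> \<le> 0 + e" by simp
  qed
  then show ?thesis by simp
qed

text \<open>Uniqueness of the Laplace transform in the form used below: if \<open>f\<close> were
  positive on the shell, a bump function of the Gaussian supported there would give a positive
  integral, although all moments vanish. Radial symmetry of \<open>f\<close> is not assumed, so the
  point found may lie anywhere in the shell; a negative \<open>r1\<close> turns the shell into a
  ball.\<close>

lemma nonpos_in_shell_of_Gauss_transform_zero: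
  fixes f :: "'a::euclidean_space \<Rightarrow> real" and r1 r2 :: real
  assumes int: "integrable lborel (\<lambda>x. f x * exp (- ((norm x)\<^sup>2)))"
    and zero: "\<And>k::nat. k \<ge> 1 \<Longrightarrow> (\<integral>x. f x * exp (- (real k * (norm x)\<^sup>2)) \<partial>lborel) = 0"
    and r: "r1 < r2" "0 < r2"
  obtains x where "r1 < (norm x)\<^sup>2" "(norm x)\<^sup>2 < r2" "f x \<le> 0"
proof (rule ccontr)
  assume nt: "\<not> thesis"
  note witness = that
  have pos: "f x > 0" if "r1 < (norm x)\<^sup>2" "(norm x)\<^sup>2 < r2" for x
    using nt witness[OF that] by force
  define g where "g x = exp (- ((norm x)\<^sup>2))" for x :: 'a
  \<comment> \<open>A continuous bump in the variable \<open>v = exp (- (norm x)\<^sup>2)\<close>,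
    positive exactly when \<open>x\<close> lies in the shell.\<close>
  define \<psi> where "\<psi> v = max 0 ((v - exp (- r2)) * (exp (- r1) - v))" for v :: real
  let ?h = "\<lambda>x. f x * g x * \<psi> (g x)"
  have gk: "g x * g x ^ k = exp (- (real (Suc k) * (norm x)\<^sup>2))" for x k
    by (simp add: g_def exp_of_nat_mult[symmetric] exp_add[symmetric] algebra_simps)
  \<comment> \<open>One Gaussian stays with \<open>f\<close> as an integrability weight, hence the
    moments start at \<open>k = 1\<close>.\<close>
  have zero': "(\<integral>x. f x * g x * g x ^ k \<partial>lborel) = 0" for k
    using zero[of "Suc k"] by (simp only: mult.assoc gk)
  have gm [measurable]: "g \<in> borel_measurable borel" unfolding g_def by measurable
  have int': "integrable lborel (\<lambda>x. f x * g x)" using int by (simp add: g_def)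
  have "(\<integral>x. ?h x \<partial>lborel) = 0"
    by (rule integral_zero_of_moments_zero[OF int' _ _ zero'])
      (auto simp: g_def \<psi>_def intro!: continuous_intros)
  have psi: "\<psi> (g x) > 0 \<longleftrightarrow> r1 < (norm x)\<^sup>2 \<and> (norm x)\<^sup>2 < r2" for x
  proof -
    have "0 < max 0 ((v - a) * (b - v)) \<longleftrightarrow> a < v \<and> v < b" if "a < b" for a b v :: real
      using that by (auto simp: less_max_iff_disj zero_less_mult_iff)
    then have "\<psi> (g x) > 0 \<longleftrightarrow> exp (- r2) < g x \<and> g x < exp (- r1)"
      unfolding \<psi>_def using r by simp
    then show ?thesis by (auto simp: g_def)
  qed
  have psi0: "\<psi> v \<ge> 0" for v by (simp add: \<psi>_def)
  have nn: "?h x \<ge> 0" for x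
    using pos[of x] psi[of x] psi0[of "g x"] by (cases "\<psi> (g x) = 0") (auto simp: g_def intro!: mult_nonneg_nonneg)
  have hint: "integrable lborel ?h"
  proof (rule Bochner_Integration.integrable_bound[OF integrable_mult_right[OF int', of "exp (- r1) + 1"]])
    have "(\<lambda>x. f x * g x) \<in> borel_measurable lborel" using int' by simp
    then show "?h \<in> borel_measurable lborel" unfolding \<psi>_def by measurable
    show "AE x in lborel. norm (?h x) \<le> norm ((exp (- r1) + 1) * (f x * g x))"
    proof (rule AE_I2)
      fix x
      have g1: "0 \<le> g x" "g x \<le> 1" by (auto simp: g_def)
      have "(g x - exp (- r2)) * (exp (- r1) - g x) \<le> exp (- r1) + 1"
      proof -
        have "(g x - exp (- r2)) * (exp (- r1) - g x) = g x * exp (- r1) - g x * g x - exp (- r2) * exp (- r1) + exp (- r2) * g x"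
          by (simp add: algebra_simps)
        moreover have "g x * exp (- r1) \<le> 1 * exp (- r1)" using g1 by (intro mult_right_mono) auto
        moreover have "exp (- r2) * g x \<le> 1 * 1" using g1 r by (intro mult_mono) auto
        moreover have "g x * g x \<ge> 0" "exp (- r2) * exp (- r1) \<ge> 0" by (auto simp: mult_nonneg_nonneg)
        ultimately show ?thesis by linarith
      qed
      then have "\<psi> (g x) \<le> exp (- r1) + 1" unfolding \<psi>_def by (simp add: add_nonneg_nonneg)
      then show "norm (?h x) \<le> norm ((exp (- r1) + 1) * (f x * g x))"
        using psi0[of "g x"] mult_right_mono[of "\<psi> (g x)" "exp (- r1) + 1" "\<bar>f x\<bar> * \<bar>g x\<bar>"]
        by (simp add: abs_mult mult.commute)
    qed
  qed
  from \<open>(\<integral>x. ?h x \<partial>lborel) = 0\<close> have "AE x in lborel. ?h x = 0"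
    using hint nn by (subst (asm) integral_nonneg_eq_0_iff_AE) auto
  moreover define S where "S = {x::'a. r1 < (norm x)\<^sup>2 \<and> (norm x)\<^sup>2 < r2}"
  ultimately have "AE x in lborel. x \<notin> S"
  proof (elim eventually_mono)
    fix x assume "?h x = 0"
    moreover have "g x > 0" by (simp add: g_def)
    ultimately show "x \<notin> S" using pos[of x] psi[of x] by (auto simp: S_def)
  qed
  \<comment> \<open>\<open>S\<close> is open and nonempty, so it cannot be a null set.\<close>
  moreover have S: "open S"
    unfolding S_def by (intro open_Collect_conj open_Collect_less continuous_intros)
  ultimately have "S \<in> null_sets lborel"
    by (subst AE_iff_null_sets) auto
  then have "negligible S"
    unfolding negligible_iff_null_sets by (rule null_sets_completionI)
  moreover have "S \<noteq> {}"
  proof -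
    obtain \<rho> where \<rho>: "max 0 r1 < \<rho>" "\<rho> < r2" using dense[of "max 0 r1" r2] r by auto
    obtain b :: 'a where "b \<in> Basis" by (meson nonempty_Basis ex_in_conv)
    then have "(norm (sqrt \<rho> *\<^sub>R b))\<^sup>2 = \<rho>" using \<rho> by (simp add: power_mult_distrib)
    then show ?thesis using \<rho> unfolding S_def by (metis (mono_tags, lifting) empty_iff max_less_iff_conj mem_Collect_eq)
  qed
  ultimately show False using S open_not_negligible by blast
qed

section \<open>Radial symmetry of the density\<close>

lemma lborel_translate:
  fixes f :: "'a::euclidean_space \<Rightarrow> real"
  assumes [measurable]: "f \<in> borel_measurable borel"
  shows "integrable lborel (\<lambda>x. f (x + y)) \<longleftrightarrow> integrable lborel f"
    and "(\<integral>x. f (x + y) \<partial>lborel) = (\<integral>x. f x \<partial>lborel)"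
proof -
  have d: "distr lborel borel ((+) y) = (lborel :: 'a measure)" by (rule lborel_distr_plus)
  have "integrable lborel f \<longleftrightarrow> integrable (distr lborel borel ((+) y)) f" unfolding d ..
  also have "\<dots> \<longleftrightarrow> integrable lborel (\<lambda>x. f (y + x))"
    by (subst integrable_distr_eq) auto
  finally show "integrable lborel (\<lambda>x. f (x + y)) \<longleftrightarrow> integrable lborel f"
    by (simp add: add.commute)
  have "(\<integral>x. f x \<partial>lborel) = integral\<^sup>L (distr lborel borel ((+) y)) f" unfolding d ..
  also have "\<dots> = (\<integral>x. f (y + x) \<partial>lborel)"
    by (subst integral_distr) auto
  finally show "(\<integral>x. f (x + y) \<partial>lborel) = (\<integral>x. f x \<partial>lborel)"
    by (simp add: add.commute)
qed

text \<open>Fubini for \<open>p x * cos ((x - y) \<bullet> t)\<close> times a Gaussian in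
  \<open>t\<close>: integrating over \<open>t\<close> first gives a Gaussian around
  \<open>y\<close>, integrating over \<open>x\<close> first gives \<open>\<phi>\<close>.\<close>

lemma Gauss_smoothing:
  fixes p \<phi> :: "'a::euclidean_space \<Rightarrow> real" and s :: real
  assumes p: "integrable lborel p" and s: "s > 0"
    and ch: "\<And>t. (LINT x|lborel. exp (\<i> * complex_of_real (x \<bullet> t)) * complex_of_real (p x)) = complex_of_real (\<phi> t)"
  shows "(4 * pi * s) powr (DIM('a) / 2) * (\<integral>x. p x * exp (- (s * (norm (x - y))\<^sup>2)) \<partial>lborel) =
     (\<integral>t. \<phi> t * (cos (y \<bullet> t) * exp (- ((norm t)\<^sup>2 / (4 * s)))) \<partial>lborel)"
proof -
  \<comment> \<open>Chosen so that \<open>exp (- (w * (norm t)\<^sup>2))\<close> transforms into a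
    multiple of \<open>exp (- (s * (norm z)\<^sup>2))\<close>.\<close>
  define w where "w = 1 / (4 * s)"
  have w: "w > 0" using s by (simp add: w_def)
  have pm [measurable]: "p \<in> borel_measurable borel" using p by auto
  let ?E = "\<lambda>t::'a. exp (- (w * (norm t)\<^sup>2))"
  have E: "integrable lborel ?E"
    using has_bochner_integral_Gauss[OF w, of "0::'a"] by (simp add: has_bochner_integral_iff)
  have inner_t: "(\<integral>t. p x * (cos ((x - y) \<bullet> t) * ?E t) \<partial>lborel) = (4 * pi * s) powr (DIM('a) / 2) * (p x * exp (- (s * (norm (x - y))\<^sup>2)))" for x
    using has_bochner_integral_Gauss[OF w, of "x - y"] s
    by (simp add: has_bochner_integral_iff w_def mult_ac)
  have inner_x: "(\<integral>x. p x * (cos ((x - y) \<bullet> t) * ?E t) \<partial>lborel) = \<phi> t * (cos (y \<bullet> t) * ?E t)" for t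
  proof -
    have int: "integrable lborel (\<lambda>x. exp (\<i> * complex_of_real (x \<bullet> t)) * complex_of_real (p x))"
      by (rule Bochner_Integration.integrable_bound[OF p]) (auto simp: norm_mult)
    have Re: "integrable lborel (\<lambda>x. cos (x \<bullet> t) * p x)" "(\<integral>x. cos (x \<bullet> t) * p x \<partial>lborel) = \<phi> t"
      using integrable_Re[OF int] integral_Re[OF int] by (auto simp: ch Re_exp)
    \<comment> \<open>The sine part vanishes because the characteristic function is real.\<close>
    have Im: "integrable lborel (\<lambda>x. sin (x \<bullet> t) * p x)" "(\<integral>x. sin (x \<bullet> t) * p x \<partial>lborel) = 0"
      using integrable_Im[OF int] integral_Im[OF int] by (auto simp: ch Im_exp)
    have "(\<integral>x. p x * (cos ((x - y) \<bullet> t) * ?E t) \<partial>lborel) =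
       (\<integral>x. (cos (y \<bullet> t) * ?E t) * (cos (x \<bullet> t) * p x) + (sin (y \<bullet> t) * ?E t) * (sin (x \<bullet> t) * p x) \<partial>lborel)"
      by (intro Bochner_Integration.integral_cong) (auto simp: inner_diff_left cos_diff algebra_simps)
    also have "\<dots> = (cos (y \<bullet> t) * ?E t) * \<phi> t"
      using Re Im by (subst Bochner_Integration.integral_add) auto
    finally show ?thesis by simp
  qed
  have big: "integrable (lborel \<Otimes>\<^sub>M lborel) (\<lambda>(x::'a, t::'a). p x * ?E t)"
  proof (rule lborel_pair.Fubini_integrable)
    show "(\<lambda>(x::'a, t::'a). p x * ?E t) \<in> borel_measurable (lborel \<Otimes>\<^sub>M lborel)"
      by measurable
    show "integrable lborel (\<lambda>x. \<integral>t. norm (case (x, t) of (x, t) \<Rightarrow> p x * ?E t) \<partial>lborel)"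
      using p by (simp add: abs_mult)
    show "AE x in lborel. integrable lborel (\<lambda>t. case (x, t) of (x, t) \<Rightarrow> p x * ?E t)"
      using E by simp
  qed
  have "integrable (lborel \<Otimes>\<^sub>M lborel) (\<lambda>(x, t). p x * (cos ((x - y) \<bullet> t) * ?E t))"
  proof (rule Bochner_Integration.integrable_bound[OF big])
    show "(\<lambda>(x, t). p x * (cos ((x - y) \<bullet> t) * ?E t)) \<in> borel_measurable (lborel \<Otimes>\<^sub>M lborel)"
      by measurable
    have "\<bar>p x\<bar> * (\<bar>cos ((x - y) \<bullet> t)\<bar> * ?E t) \<le> \<bar>p x\<bar> * ?E t" for x t
      by (intro mult_left_mono mult_left_le_one_le) auto
    then show "AE z in lborel \<Otimes>\<^sub>M lborel. norm (case z of (x, t) \<Rightarrow> p x * (cos ((x - y) \<bullet> t) * ?E t)) \<le> norm (case z of (x, t) \<Rightarrow> p x * ?E t)"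
      by (auto simp: abs_mult)
  qed
  from lborel_pair.Fubini_integral[OF this]
  have "(\<integral>t. \<phi> t * (cos (y \<bullet> t) * ?E t) \<partial>lborel) = (\<integral>x. (4 * pi * s) powr (DIM('a) / 2) * (p x * exp (- (s * (norm (x - y))\<^sup>2))) \<partial>lborel)"
    unfolding inner_x inner_t .
  then show ?thesis by (simp add: w_def)
qed

text \<open>For \<open>\<psi>\<close> a power, both sides are explicit Gaussian integrals depending
  on the norm only; the moment lemma extends this to continuous \<open>\<psi>\<close>. No rotation
  of the space is involved.\<close>

lemma radial_cos_integral_cong:
  fixes y y' :: "'a::euclidean_space" and w :: real
  assumes "w > 0" "norm y = norm y'" "continuous_on {0..1} \<psi>"
  shows "(\<integral>t. \<psi> (exp (- (w * (norm t)\<^sup>2))) * (cos (y \<bullet> t) * exp (- (w * (norm t)\<^sup>2))) \<partial>lborel) =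
     (\<integral>t. \<psi> (exp (- (w * (norm t)\<^sup>2))) * (cos (y' \<bullet> t) * exp (- (w * (norm t)\<^sup>2))) \<partial>lborel)"
    (is "?I y = ?I y'")
proof -
  let ?g = "\<lambda>t::'a. exp (- (w * (norm t)\<^sup>2))"
  let ?C = "\<lambda>y t. cos (y \<bullet> t) * ?g t"
  have gk: "?C y t * ?g t ^ k = cos (y \<bullet> t) * exp (- ((real (Suc k) * w) * (norm t)\<^sup>2))" for y t k
    by (simp add: exp_of_nat_mult[symmetric] exp_add[symmetric] algebra_simps)
  have B: "has_bochner_integral lborel (\<lambda>t. ?C y t * ?g t ^ k)
     ((pi / (real (Suc k) * w)) powr (DIM('a) / 2) * exp (- ((norm y)\<^sup>2 / (4 * (real (Suc k) * w)))))" for y k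
    unfolding gk using assms(1) by (intro has_bochner_integral_Gauss) simp
  have int: "integrable lborel (?C y)" for y
    using B[of y 0] by (simp add: has_bochner_integral_iff)
  have "(\<integral>t. (?C y t - ?C y' t) * \<psi> (?g t) \<partial>lborel) = 0"
  proof (rule integral_zero_of_moments_zero[where h="\<lambda>t. ?C y t - ?C y' t" and g="?g" and \<psi>=\<psi>])
    show "integrable lborel (\<lambda>t. ?C y t - ?C y' t)" by (intro Bochner_Integration.integrable_diff int)
    show "(\<integral>t. (?C y t - ?C y' t) * ?g t ^ k \<partial>lborel) = 0" for k
      using has_bochner_integral_integral_eq[OF has_bochner_integral_diff[OF B[of y k] B[of y' k]]]
      unfolding left_diff_distrib assms(2) by simp
  qed (use assms in auto)
  moreover have int\<psi>: "integrable lborel (\<lambda>t. ?C y t * \<psi> (?g t))" for y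
  proof -
    obtain K where "\<forall>v\<in>\<psi> ` {0..1}. norm v \<le> K"
      using compact_imp_bounded[OF compact_continuous_image[OF assms(3) compact_Icc]]
      unfolding bounded_iff by blast
    then have K: "\<bar>\<psi> (?g t)\<bar> \<le> K" for t using assms(1) by simp
    have "(\<lambda>v. indicator {0..1} v *\<^sub>R \<psi> v) \<in> borel_measurable borel"
      using assms(3) by (intro borel_measurable_continuous_on_indicator) auto
    then have "(\<lambda>t. indicator {0..1} (?g t) *\<^sub>R \<psi> (?g t)) \<in> borel_measurable borel"
      by (rule measurable_compose[rotated]) measurable
    then have m [measurable]: "(\<lambda>t. \<psi> (?g t)) \<in> borel_measurable borel"
      using assms(1) by simp
    show ?thesis
    proof (rule Bochner_Integration.integrable_bound[OF integrable_mult_right[OF int[of y], of K]])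
      show "AE t in lborel. norm (?C y t * \<psi> (?g t)) \<le> norm (K * ?C y t)"
      proof (rule AE_I2)
        fix t
        have "\<bar>?C y t\<bar> * \<bar>\<psi> (?g t)\<bar> \<le> \<bar>?C y t\<bar> * \<bar>K\<bar>"
          using K[of t] by (intro mult_left_mono) auto
        then show "norm (?C y t * \<psi> (?g t)) \<le> norm (K * ?C y t)"
          by (simp only: real_norm_def abs_mult mult.commute)
      qed
    qed measurable
  qed
  ultimately have "(\<integral>t. ?C y t * \<psi> (?g t) \<partial>lborel) = (\<integral>t. ?C y' t * \<psi> (?g t) \<partial>lborel)"
    using Bochner_Integration.integral_diff[OF int\<psi>[of y] int\<psi>[of y']] unfolding left_diff_distrib by simp
  then show ?thesis by (simp only: mult.commute)
qed

text \<open>The multiplier as a function of \<open>v = exp (- (w * r\<^sup>2))\<close>. The point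
  \<open>v = 0\<close> stands for infinite radius, where the multiplier tends to 0; the compact
  interval is what Weierstrass approximation needs.\<close>

lemma linnik_multiplier_continuous:
  fixes \<alpha> \<nu> w :: real
  assumes "\<alpha> > 0" "\<nu> > 0" "w > 0"
  defines "\<psi> \<equiv> \<lambda>v. if v = 0 then 0 else (1 + sqrt (- ln v / w) powr \<alpha>) powr (- \<nu>)"
  shows "continuous_on {0..1} \<psi>"
    and "\<psi> (exp (- (w * r\<^sup>2))) = (1 + \<bar>r\<bar> powr \<alpha>) powr (- \<nu>)"
proof -
  let ?h = "\<lambda>v. (1 + sqrt (- ln v / w) powr \<alpha>) powr (- \<nu>)"
  have pos: "1 + z powr \<alpha> > 0" for z
    using powr_ge_zero[of z \<alpha>] by linarith
  have h: "continuous_on {0<..1} ?h"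
    using assms(1,3) pos
    by (intro continuous_on_powr' continuous_intros) (auto simp: less_imp_neq[symmetric] divide_nonpos_pos less_imp_le)
  have lim: "(?h \<longlongrightarrow> 0) (at_right 0)"
    using assms(1-3) by real_asymp
  show "continuous_on {0..1} \<psi>"
    unfolding continuous_on_def
  proof
    fix v :: real assume v: "v \<in> {0..1}"
    show "(\<psi> \<longlongrightarrow> \<psi> v) (at v within {0..1})"
    proof (cases "v = 0")
      case True
      have "(?h \<longlongrightarrow> 0) (at 0 within {0..1})"
      proof -
        have "{0..1} - {0} = {0<..1} - {0 :: real}" by auto
        then have eq: "at (0::real) within {0..1} = at 0 within {0<..1}" by (simp only: at_within_def)
        show ?thesis unfolding eq by (rule tendsto_within_subset[OF lim]) auto
      qed
      moreover have "\<forall>\<^sub>F x in at 0 within {0..1}. ?h x = \<psi> x"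
        by (auto simp: eventually_at_filter \<psi>_def)
      ultimately show ?thesis using True by (simp add: \<psi>_def tendsto_cong)
    next
      case False
      then have "(?h \<longlongrightarrow> ?h v) (at v within {0<..1})"
        using h v unfolding continuous_on_def by auto
      moreover have "at v within {0..1} = at v within {0<..1}"
        by (rule at_within_nhd[of _ "{0<..}"]) (use v False in auto)
      moreover have "\<forall>\<^sub>F x in at v within {0<..1}. ?h x = \<psi> x"
        by (auto simp: eventually_at_filter \<psi>_def)
      ultimately show ?thesis using False by (simp add: \<psi>_def tendsto_cong)
    qed
  qed
  show "\<psi> (exp (- (w * r\<^sup>2))) = (1 + \<bar>r\<bar> powr \<alpha>) powr (- \<nu>)"
    using assms(3) by (simp add: \<psi>_def)
qed

lemma linnik_densityD:
  assumes "linnik_density \<alpha> \<nu> p"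
  shows "p \<in> borel_measurable borel" "integrable lborel p" "\<And>x. x \<noteq> 0 \<Longrightarrow> isCont p x"
    and "\<And>t. (LINT x|lborel. exp (\<i> * complex_of_real (x \<bullet> t)) * complex_of_real (p x)) =
          complex_of_real ((1 + norm t powr \<alpha>) powr (- \<nu>))"
proof -
  show m [measurable]: "p \<in> borel_measurable borel" using assms by (simp add: linnik_density_def)
  interpret prob_space "density lborel (\<lambda>x. ennreal (p x))" using assms by (simp add: linnik_density_def)
  have "(\<integral>\<^sup>+x. ennreal (p x) \<partial>lborel) = 1"
    using emeasure_space_1 by (simp add: emeasure_density)
  then show "integrable lborel p"
    using assms by (intro integrableI_nonneg) (auto simp: linnik_density_def)
  show "isCont p x" if "x \<noteq> 0" for x
    using assms that continuous_on_eq_continuous_at[of "UNIV - {0}" p]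
    by (auto simp: linnik_density_def open_delete)
  show "(LINT x|lborel. exp (\<i> * complex_of_real (x \<bullet> t)) * complex_of_real (p x)) =
          complex_of_real ((1 + norm t powr \<alpha>) powr (- \<nu>))" for t
    using assms by (simp add: linnik_density_def)
qed

text \<open>
  The Gaussian means of \<open>p\<close> around \<open>y\<close> depend only on \<open>norm y\<close>, because the characteristic function is
  a uniform limit of polynomials in a Gaussian; all Gaussian means together determine \<open>p y\<close>.
\<close>

lemma linnik_density_radial:
  fixes p :: "real ^ 'n \<Rightarrow> real"
  assumes p: "linnik_density \<alpha> \<nu> p" and "\<alpha> > 0" "\<nu> > 0" "norm y = norm y'"
  shows "p y = p y'"
proof (cases "y = 0")
  case True
  then show ?thesis using assms by simp
next
  case False
  note D = linnik_densityD[OF p]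
  note [measurable] = D(1)
  have mean_eq: "(\<integral>x. p (x + y) * exp (- (s * (norm x)\<^sup>2)) \<partial>lborel) = (\<integral>x. p (x + y') * exp (- (s * (norm x)\<^sup>2)) \<partial>lborel)"
    if s: "s > 0" and yy: "norm y = norm y'" for s y y'
  proof -
    have tr: "(\<integral>x. p (x + y) * exp (- (s * (norm x)\<^sup>2)) \<partial>lborel) = (\<integral>x. p x * exp (- (s * (norm (x - y))\<^sup>2)) \<partial>lborel)" for y
      using lborel_translate(2)[of "\<lambda>x. p x * exp (- (s * (norm (x - y))\<^sup>2))" y] by simp
    define w where "w = 1 / (4 * s)"
    have w: "w > 0" using s by (simp add: w_def)
    note \<psi> = linnik_multiplier_continuous[OF \<open>\<alpha> > 0\<close> \<open>\<nu> > 0\<close> w]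
    have G: "(4 * pi * s) powr (DIM(real ^ 'n) / 2) * (\<integral>x. p x * exp (- (s * (norm (x - y))\<^sup>2)) \<partial>lborel) =
     (\<integral>t. (1 + norm t powr \<alpha>) powr (- \<nu>) * (cos (y \<bullet> t) * exp (- (w * (norm t)\<^sup>2))) \<partial>lborel)" for y
      using Gauss_smoothing[OF D(2) s D(4), of y] by (simp add: w_def)
    have "(\<integral>t. (1 + norm t powr \<alpha>) powr (- \<nu>) * (cos (y \<bullet> t) * exp (- (w * (norm t)\<^sup>2))) \<partial>lborel) =
       (\<integral>t. (1 + norm t powr \<alpha>) powr (- \<nu>) * (cos (y' \<bullet> t) * exp (- (w * (norm t)\<^sup>2))) \<partial>(lborel :: (real ^ 'n) measure))"
      using radial_cos_integral_cong[OF w yy \<psi>(1)] unfolding \<psi>(2) by simp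
    then have "(4 * pi * s) powr (DIM(real ^ 'n) / 2) * (\<integral>x. p x * exp (- (s * (norm (x - y))\<^sup>2)) \<partial>lborel) =
      (4 * pi * s) powr (DIM(real ^ 'n) / 2) * (\<integral>x. p x * exp (- (s * (norm (x - y'))\<^sup>2)) \<partial>lborel)"
      unfolding G .
    moreover have "(4 * pi * s) powr (DIM(real ^ 'n) / 2) \<noteq> 0" using s by simp
    ultimately show ?thesis unfolding tr by (simp only: mult_cancel_left simp_thms)
  qed
  \<comment> \<open>By continuity the difference of the two translates would be positive near 0,
    against the vanishing of all its Gaussian means.\<close>
  have no: "\<not> p y' < p y" if yy: "norm y = norm y'" and nz: "y \<noteq> 0" for y y'
  proof
    assume less: "p y' < p y"
    let ?f = "\<lambda>x. p (x + y) - p (x + y')"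
    have "y' \<noteq> 0" using nz yy by auto
    have "isCont (\<lambda>x. p (x + y)) 0" if "y \<noteq> 0" for y
      by (rule isCont_o2[where f="\<lambda>x. x + y" and g=p]) (use that D(3) in auto)
    then have "isCont ?f 0" using nz \<open>y' \<noteq> 0\<close>
      by (intro isCont_diff) auto
    then have "\<forall>\<^sub>F x in at 0. ?f x > 0"
      unfolding isCont_def using less by (intro order_tendstoD(1)[where y="?f 0"]) auto
    then obtain \<eta> where \<eta>: "\<eta> > 0" "\<And>x. x \<noteq> 0 \<Longrightarrow> norm x < \<eta> \<Longrightarrow> ?f x > 0"
      by (auto simp: eventually_at dist_norm)
    have int: "integrable lborel (\<lambda>x. p (x + y) * exp (- (s * (norm x)\<^sup>2)))" if "s \<ge> 0" for y and s :: real
    proof (rule Bochner_Integration.integrable_bound)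
      show "integrable lborel (\<lambda>x. p (x + y))" using D(2) lborel_translate(1)[OF D(1)] by simp
      show "AE x in lborel. norm (p (x + y) * exp (- (s * (norm x)\<^sup>2))) \<le> norm (p (x + y))"
        using that by (auto simp: abs_mult mult_right_le_one_le)
    qed measurable
    \<comment> \<open>The lower bound -1 makes the shell a full ball around 0.\<close>
    obtain x where "-1 < (norm x)\<^sup>2" "(norm x)\<^sup>2 < \<eta>\<^sup>2" "?f x \<le> 0"
    proof (rule nonpos_in_shell_of_Gauss_transform_zero[of ?f "-1" "\<eta>\<^sup>2"])
      show "integrable lborel (\<lambda>x. ?f x * exp (- ((norm x)\<^sup>2)))"
        using int[of 1] by (simp add: left_diff_distrib)
      show "(\<integral>x. ?f x * exp (- (real k * (norm x)\<^sup>2)) \<partial>lborel) = 0" if "k \<ge> 1" for k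
        using int[of "real k"] mean_eq[of "real k" y y'] that yy by (simp add: left_diff_distrib)
    qed (use \<eta>(1) in \<open>auto intro: less_trans[of _ 0]\<close>)
    moreover from this have "norm x < \<eta>" using \<eta>(1) power_less_imp_less_base[of "norm x" 2 \<eta>] by simp
    \<comment> \<open>The neighbourhood is punctured; at the centre \<open>x = 0\<close> the
      assumption \<open>less\<close> takes over.\<close>
    ultimately show False using \<eta>(2)[of x] less by (cases "x = 0") auto
  qed
  show ?thesis using no[of y y'] no[of y' y] assms(4) False by force
qed

section \<open>The series and its Laplace transform\<close>

text \<open>On \<open>{1..2}\<close> the Euler integrand is at least \<open>exp (- 2) / 2\<close>,
  because \<open>u powr (x - 1) \<ge> 1 / u\<close> there. A crude bound suffices to pass
  summability from \<open>E1\<close> and \<open>E2\<close> to \<open>b1\<close> and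
  \<open>b2\<close>.\<close>

lemma inverse_Gamma_bounded:
  fixes x :: real
  assumes "x > 0"
  shows "1 / Gamma x \<le> 2 * exp 2"
proof -
  let ?f = "\<lambda>u. u powr (x - 1) * exp (- (1 * u))"
  have int: "set_integrable lborel {0<..} ?f"
    using assms by (intro set_integral_Gamma) auto
  have int1: "set_integrable lborel {1..2} ?f"
    by (rule set_integrable_subset[OF int]) auto
  have "exp (- 2) / 2 = (LBINT u:{1..2::real}. exp (- 2) / 2 :: real)"
    by (simp add: set_lebesgue_integral_def)
  also have "\<dots> \<le> (LBINT u:{1..2}. ?f u)"
  proof (rule set_integral_mono[OF _ int1])
    show "set_integrable lborel {1..2} (\<lambda>u::real. exp (- 2) / 2 :: real)"
      unfolding set_integrable_def by simp
    fix u :: real assume u: "u \<in> {1..2}"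
    have "1 / 2 \<le> u powr (- 1)" using u by (simp add: powr_minus field_simps)
    also have "\<dots> \<le> u powr (x - 1)" using u assms by (intro powr_mono) auto
    finally have "1 / 2 * exp (- 2) \<le> u powr (x - 1) * exp (- (1 * u))"
      using u by (intro mult_mono) auto
    then show "exp (- 2) / 2 \<le> ?f u" by simp
  qed
  also have "\<dots> \<le> (LBINT u:{0<..}. ?f u)"
    using int int1 unfolding set_lebesgue_integral_def set_integrable_def
    by (intro integral_mono) (auto simp: indicator_def)
  also have "\<dots> = Gamma x" using set_integral_Gamma(2)[OF assms, of 1] by simp
  finally have "exp (- 2) / 2 \<le> Gamma x" .
  then have "1 / Gamma x \<le> 1 / (exp (- 2) / 2)"
    using assms by (intro divide_left_mono) auto
  then show ?thesis by (simp add: exp_minus field_simps)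
qed

lemma entire_power_series:
  fixes a :: "nat \<Rightarrow> complex"
  assumes "\<And>x. x > 0 \<Longrightarrow> summable (\<lambda>l. norm (a l) * x ^ l)"
  shows "summable (\<lambda>l. a l * z ^ l)" and "(\<lambda>z. \<Sum>l. a l * z ^ l) holomorphic_on UNIV"
proof -
  show S: "summable (\<lambda>l. a l * z ^ l)" for z
  proof (rule summable_comparison_test'[OF assms[of "norm z + 1"]])
    show "norm z + 1 > 0" using norm_ge_zero[of z] by linarith
    show "norm (a l * z ^ l) \<le> norm (a l) * (norm z + 1) ^ l" for l
      by (auto simp: norm_mult norm_power intro!: mult_left_mono power_mono)
  qed
  have "(\<lambda>z. \<Sum>l. a l * z ^ l) holomorphic_on ball 0 r" for r
    by (rule power_series_holomorphic[where a=a]) (use S in \<open>auto intro: summable_sums\<close>)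
  then have "(\<lambda>z. \<Sum>l. a l * z ^ l) holomorphic_on (\<Union>r. ball 0 r)"
    by (intro holomorphic_on_UN_open) auto
  moreover have "(\<Union>r. ball 0 r) = (UNIV :: complex set)"
  proof (intro equalityI subsetI)
    fix z :: complex
    have "z \<in> ball 0 (norm z + 1)" by simp
    then show "z \<in> (\<Union>r. ball 0 r)" by blast
  qed simp
  ultimately show "(\<lambda>z. \<Sum>l. a l * z ^ l) holomorphic_on UNIV" by simp
qed

text \<open>
  Here \<open>\<beta> = \<alpha> / 2\<close>, \<open>N = n / 2\<close>, and \<open>g u\<close> is the claimed value of the density where
  \<open>(norm x)\<^sup>2 = u\<close>; the coefficients \<open>b1\<close> and \<open>b2\<close> are those of \<open>A1\<close> and \<open>A2\<close> up to a constant factor and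
  powers of \<open>2\<close>.
\<close>

locale linnik_series =
  fixes \<beta> \<nu> N \<delta> :: real
  assumes pos: "\<beta> > 0" "\<nu> > 0" "N > 0" "\<delta> > 0"
    and gap: "\<And>j l :: nat. \<delta> \<le> \<bar>N + real j - \<beta> * (\<nu> + real l)\<bar>"
begin

definition "E1 l = (- \<nu> gchoose l) * Gamma (N - \<beta> * (\<nu> + real l))" for l
definition "E2 j = Gamma ((N + real j) / \<beta>) * Gamma (\<nu> - (N + real j) / \<beta>) / (\<beta> * Gamma \<nu>)" for j
definition "b1 l = E1 l / Gamma (\<beta> * (\<nu> + real l))" for l
definition "b2 j = (- 1) ^ j / fact j * E2 j / Gamma (N + real j)" for j
definition "g u = (4 * pi) powr (- N) *
   ((\<Sum>l. b1 l * (u / 4) powr (\<beta> * (\<nu> + real l) - N)) + (\<Sum>j. b2 j * (u / 4) ^ j))" for u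

lemmas expansion = radial_Gauss_expansion[OF pos(1-3) _ pos(4) gap, folded E1_def E2_def]

lemma summable_b1:
  assumes "w > 0"
  shows "summable (\<lambda>l. \<bar>b1 l\<bar> * w powr (\<beta> * (\<nu> + real l) - N))"
proof (rule summable_comparison_test'[OF summable_mult[OF expansion(1)[OF assms], of "2 * exp 2"]])
  fix l
  have x: "\<beta> * (\<nu> + real l) > 0" using pos by (intro mult_pos_pos add_pos_nonneg) auto
  have "\<bar>b1 l\<bar> = \<bar>E1 l\<bar> * (1 / Gamma (\<beta> * (\<nu> + real l)))"
    using x by (simp add: b1_def)
  also have "\<dots> \<le> \<bar>E1 l\<bar> * (2 * exp 2)"
    using inverse_Gamma_bounded[OF x] by (intro mult_left_mono) auto
  finally have "\<bar>b1 l\<bar> * w powr (\<beta> * (\<nu> + real l) - N) \<le> \<bar>E1 l\<bar> * (2 * exp 2) * w powr (\<beta> * (\<nu> + real l) - N)"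
    by (rule mult_right_mono) simp
  then show "norm (\<bar>b1 l\<bar> * w powr (\<beta> * (\<nu> + real l) - N)) \<le> 2 * exp 2 * (\<bar>E1 l\<bar> * w powr (\<beta> * (\<nu> + real l) - N))"
    by (simp add: mult_ac)
qed

lemma summable_b2:
  assumes "w > 0"
  shows "summable (\<lambda>j. \<bar>b2 j\<bar> * w ^ j)"
proof (rule summable_comparison_test'[OF summable_mult[OF expansion(2)[OF assms], of "2 * exp 2"]])
  fix j
  have x: "N + real j > 0" using pos by simp
  have "\<bar>b2 j\<bar> = \<bar>E2 j\<bar> / fact j * (1 / Gamma (N + real j))"
    using x by (simp add: b2_def abs_mult)
  also have "\<dots> \<le> \<bar>E2 j\<bar> / fact j * (2 * exp 2)"
    using inverse_Gamma_bounded[OF x] by (intro mult_left_mono) auto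
  finally have "\<bar>b2 j\<bar> * w ^ j \<le> \<bar>E2 j\<bar> / fact j * (2 * exp 2) * w ^ j"
    using assms by (intro mult_right_mono) auto
  then show "norm (\<bar>b2 j\<bar> * w ^ j) \<le> 2 * exp 2 * (\<bar>E2 j\<bar> * (w ^ j / fact j))"
    using assms by (simp add: mult_ac)
qed

text \<open>The substitution \<open>x = w powr \<beta>\<close> turns real exponents into integral
  ones, which yields an infinite radius of convergence.\<close>

lemma summable_b1_power:
  assumes "x > 0"
  shows "summable (\<lambda>l. \<bar>b1 l\<bar> * x ^ l)"
proof -
  define w where "w = x powr (1 / \<beta>)"
  have w: "w > 0" "w powr \<beta> = x" using assms pos by (auto simp: w_def powr_powr)
  have "\<bar>b1 l\<bar> * x ^ l = w powr (N - \<beta> * \<nu>) * (\<bar>b1 l\<bar> * w powr (\<beta> * (\<nu> + real l) - N))" for l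
  proof -
    have "w powr (N - \<beta> * \<nu>) * w powr (\<beta> * (\<nu> + real l) - N) = w powr (\<beta> * real l)"
      by (simp add: powr_add[symmetric] algebra_simps)
    also have "\<dots> = x ^ l" using w assms by (simp add: powr_powr[symmetric] powr_realpow)
    finally show ?thesis by simp
  qed
  then show ?thesis using summable_mult[OF summable_b1[OF w(1)]] by (simp only:)
qed

text \<open>\<open>b1\<close> and \<open>b2\<close> arise from \<open>E1\<close> and
  \<open>E2\<close> by dividing by exactly the Gamma values that Laplace transforms of powers
  produce, so transforming \<open>g\<close> term by term gives back the two series of
  \<open>expansion\<close>.\<close>

lemma Laplace_g:
  assumes s: "s > 0"
  defines "w \<equiv> 1 / (4 * s)"
  shows "set_integrable lborel {0<..} (\<lambda>u. g u * exp (- (s * u)) * u powr (N - 1))"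
    and "(LBINT u:{0<..}. g u * exp (- (s * u)) * u powr (N - 1)) =
      (4 * pi * s) powr (- N) * (LBINT v:{0<..}. (1 + v powr \<beta>) powr (- \<nu>) * v powr (N - 1) * exp (- (w * v)))"
proof -
  have w: "w > 0" using s by (simp add: w_def)
  \<comment> \<open>The factor common to all terms: \<open>4 powr (N - x) * s powr (- x)\<close>
    equals \<open>?k * w powr (x - N)\<close>, since \<open>w = 1 / (4 * s)\<close>.\<close>
  let ?k = "4 powr N * w powr N"
  have x1: "\<beta> * (\<nu> + real l) > 0" for l using pos by (intro mult_pos_pos add_pos_nonneg) auto
  have x2: "N + real j > 0" for j using pos by simp
  let ?f1 = "\<lambda>l u. b1 l * (u / 4) powr (\<beta> * (\<nu> + real l) - N) * exp (- (s * u)) * u powr (N - 1)"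
  let ?f2 = "\<lambda>j u. b2 j * (u / 4) ^ j * exp (- (s * u)) * u powr (N - 1)"
  have f1: "?f1 l u = b1 l * 4 powr (N - \<beta> * (\<nu> + real l)) * (u powr (\<beta> * (\<nu> + real l) - 1) * exp (- (s * u)))" if "u > 0" for l u
  proof -
    have 1: "(u / 4) powr (\<beta> * (\<nu> + real l) - N) = 4 powr (N - \<beta> * (\<nu> + real l)) * u powr (\<beta> * (\<nu> + real l) - N)"
      using that by (simp add: powr_divide powr_diff)
    have 2: "u powr (\<beta> * (\<nu> + real l) - N) * u powr (N - 1) = u powr (\<beta> * (\<nu> + real l) - 1)"
      by (simp add: powr_add[symmetric])
    show ?thesis unfolding 1 2[symmetric] by (simp only: mult_ac)
  qed
  have f2: "?f2 j u = b2 j * 4 powr (- real j) * (u powr (N + real j - 1) * exp (- (s * u)))" if "u > 0" for j u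
  proof -
    have 1: "(u / 4) ^ j = 4 powr (- real j) * u powr (real j)"
    proof -
      have a: "(4 :: real) powr (- real j) = 1 / 4 ^ j"
        using powr_minus_divide[of "4 :: real" "real j"] powr_realpow[of "4 :: real" j] by simp
      have b: "u powr (real j) = u ^ j" using that by (rule powr_realpow)
      show ?thesis unfolding a b power_divide by simp
    qed
    have 2: "u powr (real j) * u powr (N - 1) = u powr (N + real j - 1)"
      by (simp add: powr_add[symmetric] algebra_simps)
    show ?thesis unfolding 1 2[symmetric] by (simp only: mult_ac)
  qed
  have wp: "w powr x = (4 * s) powr (- x)" for x
    using s powr_minus_divide[of "4 * s" x] by (simp add: w_def powr_divide)
  have c1: "b1 l * 4 powr (N - \<beta> * (\<nu> + real l)) * (Gamma (\<beta> * (\<nu> + real l)) * s powr (- (\<beta> * (\<nu> + real l)))) = ?k * (E1 l * w powr (\<beta> * (\<nu> + real l) - N))" for l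
  proof -
    have "w powr N * w powr (\<beta> * (\<nu> + real l) - N) = w powr (\<beta> * (\<nu> + real l))"
      by (simp add: powr_add[symmetric])
    also have "\<dots> = 4 powr (- (\<beta> * (\<nu> + real l))) * s powr (- (\<beta> * (\<nu> + real l)))"
      unfolding wp using s by (simp add: powr_mult)
    finally have *: "w powr N * w powr (\<beta> * (\<nu> + real l) - N) = 4 powr (- (\<beta> * (\<nu> + real l))) * s powr (- (\<beta> * (\<nu> + real l)))" .
    have **: "4 powr (N - \<beta> * (\<nu> + real l)) = (4::real) powr N * 4 powr (- (\<beta> * (\<nu> + real l)))"
      by (simp add: powr_add[symmetric])
    have ***: "E1 l = b1 l * Gamma (\<beta> * (\<nu> + real l))"
      using Gamma_real_pos[OF x1[of l]] by (simp add: b1_def)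
    have F: "?k * (E1 l * w powr (\<beta> * (\<nu> + real l) - N)) = E1 l * 4 powr N * (w powr N * w powr (\<beta> * (\<nu> + real l) - N))"
      by simp
    show ?thesis unfolding F unfolding * ** unfolding *** by (simp only: mult_ac)
  qed
  have c2: "b2 j * 4 powr (- real j) * (Gamma (N + real j) * s powr (- (N + real j))) = ?k * (E2 j * ((- w) ^ j / fact j))" for j
  proof -
    have "w powr N * w ^ j = w powr (N + real j)"
      using w by (simp add: powr_add powr_realpow)
    also have "\<dots> = 4 powr (- (N + real j)) * s powr (- (N + real j))"
      unfolding wp using s by (simp add: powr_mult)
    finally have *: "w powr N * w ^ j = 4 powr (- (N + real j)) * s powr (- (N + real j))" .
    have **: "4 powr (- real j) = (4::real) powr N * 4 powr (- (N + real j))"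
      by (simp add: powr_add[symmetric])
    have ***: "(- 1) ^ j / fact j * E2 j = b2 j * Gamma (N + real j)"
      using Gamma_real_pos[OF x2[of j]] by (simp add: b2_def)
    have "(- w) ^ j = (- 1) ^ j * w ^ j" by (rule power_minus)
    then have F: "?k * (E2 j * ((- w) ^ j / fact j)) = ((- 1) ^ j / fact j * E2 j) * 4 powr N * (w powr N * w ^ j)"
      by simp
    show ?thesis unfolding F unfolding * ** unfolding *** by (simp only: mult_ac)
  qed
  have i1: "set_integrable lborel {0<..} (?f1 l)" "(LBINT u:{0<..}. ?f1 l u) = ?k * (E1 l * w powr (\<beta> * (\<nu> + real l) - N))"
    "(LBINT u:{0<..}. \<bar>?f1 l u\<bar>) = ?k * (\<bar>E1 l\<bar> * w powr (\<beta> * (\<nu> + real l) - N))" for l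
  proof -
    note G = set_integral_Gamma[OF x1[of l] s]
    have "set_integrable lborel {0<..} (?f1 l) = set_integrable lborel {0<..} (\<lambda>u. b1 l * 4 powr (N - \<beta> * (\<nu> + real l)) * (u powr (\<beta> * (\<nu> + real l) - 1) * exp (- (s * u))))"
      using f1 by (intro set_integrable_cong) auto
    then show "set_integrable lborel {0<..} (?f1 l)"
      using G(1) by (simp only: set_integrable_mult_right)
    have "(LBINT u:{0<..}. ?f1 l u) = (LBINT u:{0<..}. b1 l * 4 powr (N - \<beta> * (\<nu> + real l)) * (u powr (\<beta> * (\<nu> + real l) - 1) * exp (- (s * u))))"
      using f1 by (intro set_lebesgue_integral_cong) auto
    also have "\<dots> = ?k * (E1 l * w powr (\<beta> * (\<nu> + real l) - N))"
      unfolding set_integral_mult_right G(2) by (rule c1)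
    finally show "(LBINT u:{0<..}. ?f1 l u) = ?k * (E1 l * w powr (\<beta> * (\<nu> + real l) - N))" .
    have "(LBINT u:{0<..}. \<bar>?f1 l u\<bar>) = (LBINT u:{0<..}. \<bar>b1 l * 4 powr (N - \<beta> * (\<nu> + real l))\<bar> * (u powr (\<beta> * (\<nu> + real l) - 1) * exp (- (s * u))))"
      using f1 by (intro set_lebesgue_integral_cong) (auto simp: abs_mult)
    also have "\<dots> = \<bar>b1 l * 4 powr (N - \<beta> * (\<nu> + real l)) * (Gamma (\<beta> * (\<nu> + real l)) * s powr (- (\<beta> * (\<nu> + real l))))\<bar>"
      unfolding set_integral_mult_right G(2) using Gamma_real_pos[OF x1[of l]] by (simp add: abs_mult)
    also have "\<dots> = ?k * (\<bar>E1 l\<bar> * w powr (\<beta> * (\<nu> + real l) - N))"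
      unfolding c1 by (simp add: abs_mult)
    finally show "(LBINT u:{0<..}. \<bar>?f1 l u\<bar>) = ?k * (\<bar>E1 l\<bar> * w powr (\<beta> * (\<nu> + real l) - N))" .
  qed
  have i2: "set_integrable lborel {0<..} (?f2 j)" "(LBINT u:{0<..}. ?f2 j u) = ?k * (E2 j * ((- w) ^ j / fact j))"
    "(LBINT u:{0<..}. \<bar>?f2 j u\<bar>) = ?k * (\<bar>E2 j\<bar> * (w ^ j / fact j))" for j
  proof -
    note G = set_integral_Gamma[OF x2[of j] s]
    have "set_integrable lborel {0<..} (?f2 j) = set_integrable lborel {0<..} (\<lambda>u. b2 j * 4 powr (- real j) * (u powr (N + real j - 1) * exp (- (s * u))))"
      using f2 by (intro set_integrable_cong) auto
    then show "set_integrable lborel {0<..} (?f2 j)"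
      using G(1) by (simp only: set_integrable_mult_right)
    have "(LBINT u:{0<..}. ?f2 j u) = (LBINT u:{0<..}. b2 j * 4 powr (- real j) * (u powr (N + real j - 1) * exp (- (s * u))))"
      using f2 by (intro set_lebesgue_integral_cong) auto
    also have "\<dots> = ?k * (E2 j * ((- w) ^ j / fact j))"
      unfolding set_integral_mult_right G(2) by (rule c2)
    finally show "(LBINT u:{0<..}. ?f2 j u) = ?k * (E2 j * ((- w) ^ j / fact j))" .
    have "(LBINT u:{0<..}. \<bar>?f2 j u\<bar>) = (LBINT u:{0<..}. \<bar>b2 j * 4 powr (- real j)\<bar> * (u powr (N + real j - 1) * exp (- (s * u))))"
      using f2 by (intro set_lebesgue_integral_cong) (auto simp: abs_mult)
    also have "\<dots> = \<bar>b2 j * 4 powr (- real j) * (Gamma (N + real j) * s powr (- (N + real j)))\<bar>"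
      unfolding set_integral_mult_right G(2) using Gamma_real_pos[OF x2[of j]] by (simp add: abs_mult)
    also have "\<dots> = ?k * (\<bar>E2 j\<bar> * (w ^ j / fact j))"
      unfolding c2 using w by (simp add: abs_mult power_abs)
    finally show "(LBINT u:{0<..}. \<bar>?f2 j u\<bar>) = ?k * (\<bar>E2 j\<bar> * (w ^ j / fact j))" .
  qed
  have p1: "summable (\<lambda>l. \<bar>?f1 l u\<bar>)" if "u > 0" for u
    using summable_mult2[OF summable_b1[of "u / 4"], of "exp (- (s * u)) * u powr (N - 1)"] that
    by (simp add: abs_mult mult.assoc)
  have p2: "summable (\<lambda>j. \<bar>?f2 j u\<bar>)" if "u > 0" for u
    using summable_mult2[OF summable_b2[of "u / 4"], of "exp (- (s * u)) * u powr (N - 1)"] that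
    by (simp add: abs_mult mult.assoc)
  \<comment> \<open>Pointwise convergence came from \<open>summable_b1\<close>; summability of the
    integrals is already part of \<open>expansion\<close>.\<close>
  have q1: "summable (\<lambda>l. LBINT u:{0<..}. \<bar>?f1 l u\<bar>)"
    unfolding i1(3) by (intro summable_mult expansion(1) w)
  have q2: "summable (\<lambda>j. LBINT u:{0<..}. \<bar>?f2 j u\<bar>)"
    unfolding i2(3) by (intro summable_mult expansion(2) w)
  have A1: "AE u in lborel. u \<in> {0<..} \<longrightarrow> summable (\<lambda>l. \<bar>?f1 l u\<bar>)" using p1 by auto
  have A2: "AE u in lborel. u \<in> {0<..} \<longrightarrow> summable (\<lambda>j. \<bar>?f2 j u\<bar>)" using p2 by auto
  note S1 = set_integral_suminf[OF i1(1) A1 q1]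
  note S2 = set_integral_suminf[OF i2(1) A2 q2]
  have geq: "g u * exp (- (s * u)) * u powr (N - 1) = (4 * pi) powr (- N) * ((\<Sum>l. ?f1 l u) + (\<Sum>j. ?f2 j u))" if "u > 0" for u
  proof -
    have "summable (\<lambda>l. b1 l * (u / 4) powr (\<beta> * (\<nu> + real l) - N))"
      using summable_b1[of "u / 4"] that by - (rule summable_rabs_cancel, simp add: abs_mult)
    then have 1: "(\<Sum>l. ?f1 l u) = (\<Sum>l. b1 l * (u / 4) powr (\<beta> * (\<nu> + real l) - N)) * exp (- (s * u)) * u powr (N - 1)"
      by (simp add: suminf_mult2 summable_mult2)
    have "summable (\<lambda>j. b2 j * (u / 4) ^ j)"
      using summable_b2[of "u / 4"] that by - (rule summable_rabs_cancel, simp add: abs_mult)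
    then have 2: "(\<Sum>j. ?f2 j u) = (\<Sum>j. b2 j * (u / 4) ^ j) * exp (- (s * u)) * u powr (N - 1)"
      by (simp add: suminf_mult2 summable_mult2)
    show ?thesis unfolding 1 2 g_def by (simp only: distrib_right mult.assoc)
  qed
  have int: "set_integrable lborel {0<..} (\<lambda>u. (4 * pi) powr (- N) * ((\<Sum>l. ?f1 l u) + (\<Sum>j. ?f2 j u)))"
    by (intro set_integrable_mult_right set_integral_add(1) S1 S2)
  have "set_integrable lborel {0<..} (\<lambda>u. g u * exp (- (s * u)) * u powr (N - 1)) =
    set_integrable lborel {0<..} (\<lambda>u. (4 * pi) powr (- N) * ((\<Sum>l. ?f1 l u) + (\<Sum>j. ?f2 j u)))"
    using geq by (intro set_integrable_cong) auto
  with int show "set_integrable lborel {0<..} (\<lambda>u. g u * exp (- (s * u)) * u powr (N - 1))" by simp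
  have "(LBINT u:{0<..}. g u * exp (- (s * u)) * u powr (N - 1)) =
    (LBINT u:{0<..}. (4 * pi) powr (- N) * ((\<Sum>l. ?f1 l u) + (\<Sum>j. ?f2 j u)))"
    using geq by (intro set_lebesgue_integral_cong) auto
  also have "\<dots> = (4 * pi) powr (- N) * ((LBINT u:{0<..}. (\<Sum>l. ?f1 l u)) + (LBINT u:{0<..}. (\<Sum>j. ?f2 j u)))"
    using S1(1) S2(1) by (subst set_integral_mult_right, subst set_integral_add(2)) auto
  also have "(LBINT u:{0<..}. (\<Sum>l. ?f1 l u)) = (\<Sum>l. ?k * (E1 l * w powr (\<beta> * (\<nu> + real l) - N)))"
    using S1(2) unfolding i1(2) by (simp add: sums_iff)
  also have "(LBINT u:{0<..}. (\<Sum>j. ?f2 j u)) = (\<Sum>j. ?k * (E2 j * ((- w) ^ j / fact j)))"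
    using S2(2) unfolding i2(2) by (simp add: sums_iff)
  also have "(\<Sum>l. ?k * (E1 l * w powr (\<beta> * (\<nu> + real l) - N))) = ?k * (\<Sum>l. E1 l * w powr (\<beta> * (\<nu> + real l) - N))"
  proof (rule suminf_mult, rule summable_rabs_cancel)
    show "summable (\<lambda>l. \<bar>E1 l * w powr (\<beta> * (\<nu> + real l) - N)\<bar>)"
      using expansion(1)[OF w] by (simp add: abs_mult)
  qed
  also have "(\<Sum>j. ?k * (E2 j * ((- w) ^ j / fact j))) = ?k * (\<Sum>j. E2 j * ((- w) ^ j / fact j))"
  proof (rule suminf_mult, rule summable_rabs_cancel)
    show "summable (\<lambda>j. \<bar>E2 j * ((- w) ^ j / fact j)\<bar>)"
      using expansion(2)[OF w] w by (simp add: abs_mult power_abs)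
  qed
  also have "(4 * pi) powr (- N) * (?k * (\<Sum>l. E1 l * w powr (\<beta> * (\<nu> + real l) - N)) + ?k * (\<Sum>j. E2 j * ((- w) ^ j / fact j))) =
     (4 * pi) powr (- N) * ?k * (LBINT v:{0<..}. (1 + v powr \<beta>) powr (- \<nu>) * v powr (N - 1) * exp (- (w * v)))"
    unfolding expansion(3)[OF w] by (simp only: distrib_left mult.assoc)
  also have "(4 * pi) powr (- N) * ?k = (4 * pi * s) powr (- N)"
  proof -
    have "(4 * pi * s) powr (- N) = 4 powr (- N) * pi powr (- N) * s powr (- N)"
      using s by (simp add: powr_mult)
    moreover have "4 powr N * (4 :: real) powr (- N) = 1" by (simp add: powr_add[symmetric])
    moreover have "(4 * pi) powr (- N) * ?k = (4 powr N * 4 powr (- N)) * (4 powr (- N) * pi powr (- N) * s powr (- N))"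
      unfolding wp using s by (simp add: powr_mult)
    ultimately show ?thesis by simp
  qed
  finally show "(LBINT u:{0<..}. g u * exp (- (s * u)) * u powr (N - 1)) =
      (4 * pi * s) powr (- N) * (LBINT v:{0<..}. (1 + v powr \<beta>) powr (- \<nu>) * v powr (N - 1) * exp (- (w * v)))" .
qed

text \<open>Once \<open>(u / 4) powr (\<beta> * \<nu> - N)\<close> is pulled out, the first series
  is an entire function of \<open>(u / 4) powr \<beta>\<close>. The factor pulled out may blow up at
  0, hence the open half-line.\<close>

lemma g_continuous: "continuous_on {0<..} g"
proof -
  have S1: "summable (\<lambda>l. norm (complex_of_real (b1 l)) * x ^ l)" if "x > 0" for x
    using summable_b1_power[OF that] by simp
  have S2: "summable (\<lambda>l. norm (complex_of_real (b2 l)) * x ^ l)" if "x > 0" for x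
    using summable_b2[OF that] by simp
  let ?F1 = "\<lambda>z. \<Sum>l. complex_of_real (b1 l) * z ^ l" and ?F2 = "\<lambda>z. \<Sum>l. complex_of_real (b2 l) * z ^ l"
  have F: "continuous_on UNIV ?F1" "continuous_on UNIV ?F2"
    using entire_power_series(2)[OF S1] entire_power_series(2)[OF S2] by (auto intro: holomorphic_on_imp_continuous_on)
  have eq: "g u = (4 * pi) powr (- N) * ((u / 4) powr (\<beta> * \<nu> - N) * Re (?F1 (complex_of_real ((u / 4) powr \<beta>))) + Re (?F2 (complex_of_real (u / 4))))"
    if u: "u > 0" for u
  proof -
    have R1: "?F1 (complex_of_real x) = complex_of_real (\<Sum>l. b1 l * x ^ l)" if "x > 0" for x
      using summable_b1_power[OF that] that summable_rabs_cancel[of "\<lambda>l. b1 l * x ^ l"]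
      by (subst suminf_of_real) (auto simp: abs_mult)
    have R2: "?F2 (complex_of_real x) = complex_of_real (\<Sum>l. b2 l * x ^ l)" if "x > 0" for x
      using summable_b2[OF that] that summable_rabs_cancel[of "\<lambda>l. b2 l * x ^ l"]
      by (subst suminf_of_real) (auto simp: abs_mult)
    have "summable (\<lambda>l. b1 l * ((u / 4) powr \<beta>) ^ l)"
      using summable_b1_power[of "(u / 4) powr \<beta>"] u by - (rule summable_rabs_cancel, simp add: abs_mult)
    then have "(u / 4) powr (\<beta> * \<nu> - N) * (\<Sum>l. b1 l * ((u / 4) powr \<beta>) ^ l) = (\<Sum>l. (u / 4) powr (\<beta> * \<nu> - N) * (b1 l * ((u / 4) powr \<beta>) ^ l))"
      by (rule suminf_mult[symmetric])
    also have "\<dots> = (\<Sum>l. b1 l * (u / 4) powr (\<beta> * (\<nu> + real l) - N))"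
    proof (intro suminf_cong)
      fix l
      have "((u / 4) powr \<beta>) ^ l = (u / 4) powr (\<beta> * real l)"
        using u by (simp add: powr_realpow[symmetric] powr_powr)
      then have "(u / 4) powr (\<beta> * \<nu> - N) * ((u / 4) powr \<beta>) ^ l = (u / 4) powr (\<beta> * \<nu> - N + \<beta> * real l)"
        by (simp only: powr_add)
      also have "\<beta> * \<nu> - N + \<beta> * real l = \<beta> * (\<nu> + real l) - N" by (simp add: algebra_simps)
      finally show "(u / 4) powr (\<beta> * \<nu> - N) * (b1 l * ((u / 4) powr \<beta>) ^ l) = b1 l * (u / 4) powr (\<beta> * (\<nu> + real l) - N)"
        by (simp only: mult.left_commute)
    qed
    finally show ?thesis
      using u R1[of "(u / 4) powr \<beta>"] R2[of "u / 4"] unfolding g_def by simp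
  qed
  have "continuous_on {0<..} (\<lambda>u. (4 * pi) powr (- N) * ((u / 4) powr (\<beta> * \<nu> - N) * Re (?F1 (complex_of_real ((u / 4) powr \<beta>))) + Re (?F2 (complex_of_real (u / 4)))))"
    by (intro continuous_intros continuous_on_compose2[OF F(1)] continuous_on_compose2[OF F(2)]) auto
  then show ?thesis by (subst continuous_on_cong[OF refl eq]) auto
qed

end

section \<open>Identification of the density\<close>

text \<open>Equality would be \<open>N + j = \<beta> * (\<nu> + l)\<close> cleared of denominators.
  It forces \<open>f\<close> to divide \<open>a\<close>, and with \<open>k = a / f\<close> it reads
  \<open>b * (n + 2 * j) = k * (e + l * f)\<close>. For odd \<open>n\<close> and even
  \<open>k\<close>, \<open>b\<close> becomes even along with \<open>a\<close>; for even
  \<open>n\<close> and \<open>f\<close> and odd \<open>k\<close>, \<open>e\<close> becomes even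
  along with \<open>f\<close>. Both contradict coprimality.\<close>

lemma linnik_resonance_free:
  fixes n a b e f j l :: nat
  assumes "a \<ge> 1" "b \<ge> 1" "e \<ge> 1" "f \<ge> 1" "coprime a b" "coprime e f"
    and cond: "\<not> f dvd a \<or> (odd n \<and> f dvd a \<and> even (a div f))
       \<or> (even n \<and> even a \<and> even f \<and> f dvd a \<and> odd (a div f))"
  shows "b * f * (n + 2 * j) \<noteq> a * (e + l * f)"
proof
  assume eq: "b * f * (n + 2 * j) = a * (e + l * f)"
  have "a * e + (a * l) * f = f * (b * (n + 2 * j))"
    using eq by (simp add: algebra_simps)
  then have "f dvd a * e + (a * l) * f" by simp
  then have "f dvd a * e" by (simp add: dvd_add_left_iff)
  then have "f dvd a" using \<open>coprime e f\<close> by (simp add: coprime_commute coprime_dvd_mult_left_iff)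
  then obtain k where k: "a = f * k" by (elim dvdE)
  have k': "a div f = k" using k \<open>f \<ge> 1\<close> by simp
  have "f * (b * (n + 2 * j)) = f * (k * (e + l * f))"
    using eq unfolding k by (simp only: mult_ac)
  then have eq': "b * (n + 2 * j) = k * (e + l * f)" using \<open>f \<ge> 1\<close> by simp
  show False
  proof (cases "odd n")
    case True
    then have "even k" using cond \<open>f dvd a\<close> k' by auto
    then have "even (b * (n + 2 * j))" unfolding eq' by simp
    then have "even b" using True by simp
    moreover have "even a" using \<open>even k\<close> k by simp
    ultimately show False using coprime_common_divisor[OF \<open>coprime a b\<close>, of 2] by simp
  next
    case False
    then have o: "even f" "odd k" using cond \<open>f dvd a\<close> k' by auto
    have "even (k * (e + l * f))" using False unfolding eq'[symmetric] by simp
    then have "even e" using o by simp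
    then show False using coprime_common_divisor[OF \<open>coprime e f\<close>, of 2] o by simp
  qed
qed

text \<open>Multiplied by \<open>2 * b * f\<close>, the difference is an integer, nonzero by the
  absence of resonances and so at least 1 in absolute value.\<close>

lemma linnik_gap:
  fixes n a b e f :: nat and \<alpha> \<nu> :: real
  assumes ab: "a \<ge> 1" "b \<ge> 1" "e \<ge> 1" "f \<ge> 1" "coprime a b" "coprime e f"
    and \<alpha>\<nu>: "\<alpha> = real a / real b" "\<nu> = real e / real f"
    and cond: "\<not> f dvd a \<or> (odd n \<and> f dvd a \<and> even (a div f))
       \<or> (even n \<and> even a \<and> even f \<and> f dvd a \<and> odd (a div f))"
  shows "1 / (2 * real b * real f) \<le> \<bar>real n / 2 + real j - \<alpha> / 2 * (\<nu> + real l)\<bar>"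
proof -
  let ?d = "int (b * f * (n + 2 * j)) - int (a * (e + l * f))"
  have "?d \<noteq> 0"
    using linnik_resonance_free[OF ab cond, of j l] by (simp only: right_minus_eq of_nat_eq_iff not_False_eq_True)
  then have "1 \<le> \<bar>?d\<bar>" by linarith
  then have "1 \<le> \<bar>real_of_int ?d\<bar>" by linarith
  moreover have "real_of_int ?d = 2 * real b * real f * (real n / 2 + real j - \<alpha> / 2 * (\<nu> + real l))"
    using ab unfolding \<alpha>\<nu> by (simp add: field_simps)
  ultimately have "1 \<le> 2 * real b * real f * \<bar>real n / 2 + real j - \<alpha> / 2 * (\<nu> + real l)\<bar>"
    by (simp add: abs_mult)
  then show ?thesis using ab by (simp add: field_simps)
qed

context linnik_series
begin

text \<open>\<open>p\<close> and the radial function given by \<open>g\<close> have the same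
  Gaussian integrals about the origin. Were they different at \<open>x0\<close>, continuity and
  radial symmetry would give their difference a constant sign on a whole shell.\<close>

lemma linnik_density_eq_g:
  fixes p :: "real ^ 'n \<Rightarrow> real"
  assumes p: "linnik_density (2 * \<beta>) \<nu> p" and N: "N = real CARD('n) / 2" and x0: "x0 \<noteq> 0"
  shows "p x0 = g ((norm x0)\<^sup>2)"
proof -
  note D = linnik_densityD[OF p]
  note [measurable] = D(1)
  \<comment> \<open>The cut-off makes \<open>g\<close> Borel on the whole line; only continuity for
    \<open>u > 0\<close> is known.\<close>
  define h where "h u = indicator {0<..} u *\<^sub>R g u" for u
  have hm [measurable]: "h \<in> borel_measurable borel"
    unfolding h_def using g_continuous by (intro borel_measurable_continuous_on_indicator) auto
  have hpos: "h u = g u" if "u > 0" for u using that by (simp add: h_def)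
  let ?C = "pi powr N / Gamma N"
  have DIM: "real DIM(real ^ 'n) / 2 = N" by (simp add: N)
  note R = radial_integral[where 'a="real ^ 'n", unfolded DIM]
  have H: "integrable lborel (\<lambda>x::real ^ 'n. h ((norm x)\<^sup>2) * exp (- (s * (norm x)\<^sup>2)))"
    "(\<integral>x. h ((norm x)\<^sup>2) * exp (- (s * (norm x)\<^sup>2)) \<partial>(lborel :: (real ^ 'n) measure)) =
       (\<integral>x. p x * exp (- (s * (norm x)\<^sup>2)) \<partial>lborel)"
    if s: "s > 0" for s
  proof -
    define w where "w = 1 / (4 * s)"
    let ?f = "\<lambda>u. h u * exp (- (s * u))"
    have fm: "?f \<in> borel_measurable borel" by measurable
    have "set_integrable lborel {0<..} (\<lambda>u. ?f u * u powr (N - 1)) =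
      set_integrable lborel {0<..} (\<lambda>u. g u * exp (- (s * u)) * u powr (N - 1))"
      using hpos by (intro set_integrable_cong) auto
    then show "integrable lborel (\<lambda>x::real ^ 'n. h ((norm x)\<^sup>2) * exp (- (s * (norm x)\<^sup>2)))"
      using R(1)[OF fm] Laplace_g(1)[OF s] by simp
    let ?F = "\<lambda>v. (1 + v powr \<beta>) powr (- \<nu>) * exp (- (w * v))"
    let ?I = "LBINT v:{0<..}. (1 + v powr \<beta>) powr (- \<nu>) * v powr (N - 1) * exp (- (w * v))"
    have "(LBINT u:{0<..}. ?f u * u powr (N - 1)) = (LBINT u:{0<..}. g u * exp (- (s * u)) * u powr (N - 1))"
      using hpos by (intro set_lebesgue_integral_cong) auto
    then have 1: "(\<integral>x. h ((norm x)\<^sup>2) * exp (- (s * (norm x)\<^sup>2)) \<partial>(lborel :: (real ^ 'n) measure)) =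
       ?C * ((4 * pi * s) powr (- N) * ?I)"
      using R(2)[OF fm] Laplace_g(2)[OF s] by (simp add: w_def)
    have "(4 * pi * s) powr N * (\<integral>x. p x * exp (- (s * (norm (x - 0))\<^sup>2)) \<partial>lborel) =
     (\<integral>t. (1 + norm t powr (2 * \<beta>)) powr (- \<nu>) * (cos (0 \<bullet> t) * exp (- ((norm t)\<^sup>2 / (4 * s)))) \<partial>(lborel :: (real ^ 'n) measure))"
      using Gauss_smoothing[OF D(2) s D(4), of 0] unfolding DIM .
    also have "\<dots> = (\<integral>t. ?F ((norm t)\<^sup>2) \<partial>(lborel :: (real ^ 'n) measure))"
    proof (intro Bochner_Integration.integral_cong refl)
      fix t :: "real ^ 'n"
      have "(norm t)\<^sup>2 powr \<beta> = norm t powr (2 * \<beta>)"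
        using powr_powr[of "norm t" 2 \<beta>] by simp
      then show "(1 + norm t powr (2 * \<beta>)) powr (- \<nu>) * (cos (0 \<bullet> t) * exp (- ((norm t)\<^sup>2 / (4 * s)))) = ?F ((norm t)\<^sup>2)"
        by (simp add: w_def)
    qed
    also have "\<dots> = ?C * (LBINT v:{0<..}. ?F v * v powr (N - 1))"
      by (rule R(2)) measurable
    also have "(LBINT v:{0<..}. ?F v * v powr (N - 1)) = ?I"
      by (intro set_lebesgue_integral_cong) (auto simp: mult_ac)
    finally have 2: "(4 * pi * s) powr N * (\<integral>x. p x * exp (- (s * (norm x)\<^sup>2)) \<partial>lborel) = ?C * ?I" by simp
    have "(4 * pi * s) powr (- N) * (4 * pi * s) powr N = 1"
      using s by (simp add: powr_add[symmetric])
    then have "(\<integral>x. p x * exp (- (s * (norm x)\<^sup>2)) \<partial>lborel) = (4 * pi * s) powr (- N) * (?C * ?I)"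
      unfolding 2[symmetric] mult.assoc[symmetric] by simp
    with 1 show "(\<integral>x. h ((norm x)\<^sup>2) * exp (- (s * (norm x)\<^sup>2)) \<partial>(lborel :: (real ^ 'n) measure)) =
       (\<integral>x. p x * exp (- (s * (norm x)\<^sup>2)) \<partial>lborel)" by simp
  qed
  have P: "integrable lborel (\<lambda>x. p x * exp (- (s * (norm x)\<^sup>2)))" if "s > 0" for s
    by (rule Bochner_Integration.integrable_bound[OF D(2)])
      (use that in \<open>auto simp: abs_mult mult_right_le_one_le\<close>)
  have rad: "p x = p y" if "norm x = norm y" for x y
    using linnik_density_radial[OF p _ pos(2) that] pos(1) by simp
  let ?D = "\<lambda>x. p x - h ((norm x)\<^sup>2)"
  have cont: "isCont ?D x0"
  proof -
    have "continuous_on {0<..} h"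
      using g_continuous hpos by (subst continuous_on_cong[OF refl, of _ _ g]) auto
    then have "isCont h ((norm x0)\<^sup>2)"
      using x0 by (simp add: continuous_on_eq_continuous_at)
    then have "isCont (\<lambda>x. h ((norm x)\<^sup>2)) x0"
      by (intro isCont_o2[where g=h and f="\<lambda>x. (norm x)\<^sup>2"] continuous_intros)
    then show ?thesis using D(3)[OF x0] by (intro isCont_diff)
  qed
  \<comment> \<open>The two signs of the difference are treated together, with
    \<open>\<sigma>\<close> equal to 1 or -1.\<close>
  have no: "\<not> \<sigma> * ?D x0 > 0" for \<sigma> :: real
  proof
    assume "\<sigma> * ?D x0 > 0"
    moreover have "((\<lambda>x. \<sigma> * ?D x) \<longlongrightarrow> \<sigma> * ?D x0) (at x0)"
      using cont unfolding isCont_def by (rule tendsto_mult_left)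
    ultimately have "\<forall>\<^sub>F x in at x0. \<sigma> * ?D x > 0"
      by (intro order_tendstoD(1))
    then obtain \<eta>0 where \<eta>0: "\<eta>0 > 0" "\<And>x. x \<noteq> x0 \<Longrightarrow> dist x x0 < \<eta>0 \<Longrightarrow> \<sigma> * ?D x > 0"
      by (auto simp: eventually_at)
    define r where "r = norm x0"
    have r: "r > 0" using x0 by (simp add: r_def)
    \<comment> \<open>The cap \<open>r\<close> keeps \<open>r - \<eta>\<close> nonnegative, so that
      the squares are ordered like the radii.\<close>
    define \<eta> where "\<eta> = min \<eta>0 r"
    have \<eta>: "\<eta> > 0" "\<eta> \<le> \<eta>0" "\<eta> \<le> r" using \<eta>0(1) r by (auto simp: \<eta>_def)
    obtain x where x: "(r - \<eta>)\<^sup>2 < (norm x)\<^sup>2" "(norm x)\<^sup>2 < (r + \<eta>)\<^sup>2" "\<sigma> * ?D x \<le> 0"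
    proof (rule nonpos_in_shell_of_Gauss_transform_zero[of "\<lambda>x. \<sigma> * ?D x" "(r - \<eta>)\<^sup>2" "(r + \<eta>)\<^sup>2"])
      have split: "\<sigma> * ?D x * E = \<sigma> * (p x * E - h ((norm x)\<^sup>2) * E)" for x E
        by (simp add: algebra_simps)
      show "integrable lborel (\<lambda>x. \<sigma> * ?D x * exp (- ((norm x)\<^sup>2)))"
        unfolding split using P[of 1] H(1)[of 1] by simp
      show "(\<integral>x. \<sigma> * ?D x * exp (- (real k * (norm x)\<^sup>2)) \<partial>lborel) = 0" if "k \<ge> 1" for k
        unfolding split using P[of "real k"] H[of "real k"] that by simp
      show "(r - \<eta>)\<^sup>2 < (r + \<eta>)\<^sup>2" using \<eta> r by (intro power_strict_mono) auto
      show "0 < (r + \<eta>)\<^sup>2" using \<eta> r by simp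
    qed
    have "r - \<eta> < norm x" using x(1) power_less_imp_less_base[of "r - \<eta>" 2 "norm x"] by simp
    moreover have "norm x < r + \<eta>" using x(2) \<eta> r power_less_imp_less_base[of "norm x" 2 "r + \<eta>"] by simp
    ultimately have xr: "\<bar>norm x - r\<bar> < \<eta>" by linarith
    \<comment> \<open>\<open>x\<close> may lie far from \<open>x0\<close>; its radial copy on the
      ray through \<open>x0\<close> has the same norm and is close to \<open>x0\<close>.\<close>
    define x' where "x' = (norm x / r) *\<^sub>R x0"
    have nx: "norm x' = norm x" using r by (simp add: x'_def r_def)
    have "x' - x0 = ((norm x - r) / r) *\<^sub>R x0"
      using r by (simp add: x'_def diff_divide_distrib scaleR_left_diff_distrib)
    then have "dist x' x0 = \<bar>norm x - r\<bar>" using r by (simp add: dist_norm r_def)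
    then have "\<sigma> * ?D x' > 0"
      using \<eta>0(2)[of x'] \<open>\<sigma> * ?D x0 > 0\<close> xr \<eta> by (cases "x' = x0") auto
    then show False using x(3) rad[OF nx] nx by simp
  qed
  have "?D x0 = 0" using no[of 1] no[of "-1"] by simp
  then show ?thesis using hpos x0 by simp
qed

end

text \<open>Convergence is asserted separately, because \<open>suminf\<close> denotes a value even
  for a divergent series.\<close>

theorem proposition4p2:
  fixes p :: "real ^ 'n \<Rightarrow> real" and \<alpha> \<nu> :: real and n a b e f :: nat
  assumes "n = CARD('n)"
    and "a \<ge> 1" "b \<ge> 1" "e \<ge> 1" "f \<ge> 1"
    and "coprime a b" "coprime e f"
    and "\<alpha> = real a / real b" "\<alpha> < 2"
    and "\<nu> = real e / real f"
    and "\<not> f dvd a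
       \<or> (odd n \<and> f dvd a \<and> even (a div f))
       \<or> (even n \<and> even a \<and> even f \<and> f dvd a \<and> odd (a div f))"
    and "linnik_density \<alpha> \<nu> p"
  shows "(\<forall>z. summable (A1_term \<alpha> \<nu> n z)) \<and> A1 \<alpha> \<nu> n holomorphic_on UNIV \<and>
         (\<forall>z. summable (A2_term \<alpha> \<nu> n z)) \<and> A2 \<alpha> \<nu> n holomorphic_on UNIV \<and>
         (\<forall>r>0. complex_of_real (radial_value p r) =
            complex_of_real (1 / (2 ^ n * pi powr (real n / 2) * Gamma \<nu>)) *
            (complex_of_real (r powr (\<alpha> * \<nu> - real n) / 2 powr (\<alpha> * \<nu> - real n))
               * A1 \<alpha> \<nu> n (complex_of_real (r powr \<alpha>))
             + A2 \<alpha> \<nu> n (complex_of_real (r ^ 2))))"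
proof -
  define \<beta> N \<delta> where "\<beta> = \<alpha> / 2" and "N = real n / 2" and "\<delta> = 1 / (2 * real b * real f)"
  have \<alpha>: "\<alpha> > 0" and \<nu>: "\<nu> > 0" using assms(2-10) by auto
  interpret linnik_series \<beta> \<nu> N \<delta>
  proof
    show "\<beta> > 0" "\<nu> > 0" using \<alpha> \<nu> by (simp_all add: \<beta>_def)
    show "N > 0" using assms(1) by (simp add: N_def)
    show "\<delta> > 0" using assms(3,5) by (simp add: \<delta>_def)
    show "\<delta> \<le> \<bar>N + real j - \<beta> * (\<nu> + real l)\<bar>" for j l
      unfolding \<beta>_def N_def \<delta>_def by (rule linnik_gap[OF assms(2-8,10,11)])
  qed
  \<comment> \<open>Power series coefficients. \<open>Gamma \<nu>\<close> cancels the one hidden in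
    the binomial coefficient or in \<open>E2\<close>; the \<open>\<beta>\<close> in
    \<open>c2\<close> cancels the \<open>1 / \<beta>\<close> of \<open>E2\<close>, and reappears
    inverted as the prefactor \<open>2 / \<alpha>\<close> of \<open>A2\<close>.\<close>
  define c1 where "c1 l = complex_of_real (Gamma \<nu> * b1 l / 2 powr (\<alpha> * real l))" for l
  define c2 where "c2 j = complex_of_real (\<beta> * Gamma \<nu> * b2 j / 2 ^ (2 * j))" for j
  have G\<nu>: "Gamma \<nu> > 0" using \<nu> by simp
  have A1t: "A1_term \<alpha> \<nu> n z = (\<lambda>l. c1 l * z ^ l)" for z
  proof
    fix l
    have "\<nu> \<notin> \<int>\<^sub>\<le>\<^sub>0" using \<nu> by (auto simp: nonpos_Ints_def)
    then have "(- \<nu> gchoose l) = (-1) ^ l / fact l * Gamma (\<nu> + real l) / Gamma \<nu>"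
      by (simp add: gbinomial_pochhammer pochhammer_Gamma)
    then have "Gamma \<nu> * b1 l = (-1) ^ l / fact l * Gamma (\<nu> + real l) * (Gamma (N - \<beta> * (\<nu> + real l)) / Gamma (\<beta> * (\<nu> + real l)))"
      using G\<nu> by (simp add: b1_def E1_def)
    also have "N - \<beta> * (\<nu> + real l) = (real n - \<alpha> * (\<nu> + real l)) / 2"
      by (simp add: N_def \<beta>_def diff_divide_distrib)
    also have "\<beta> * (\<nu> + real l) = \<alpha> * (\<nu> + real l) / 2" by (simp add: \<beta>_def)
    finally show "A1_term \<alpha> \<nu> n z l = c1 l * z ^ l"
      unfolding A1_term_def c1_def by (simp del: of_real_mult) simp
  qed
  have A2t: "A2_term \<alpha> \<nu> n z = (\<lambda>j. c2 j * z ^ j)" for z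
  proof
    fix j
    have "\<beta> * Gamma \<nu> * b2 j = (-1) ^ j / fact j * (Gamma ((N + real j) / \<beta>) / Gamma (N + real j)) * Gamma (\<nu> - (N + real j) / \<beta>)"
      using G\<nu> pos(1) by (simp add: b2_def E2_def)
    also have "(N + real j) / \<beta> = (real n + 2 * real j) / \<alpha>"
      using \<alpha> by (simp add: N_def \<beta>_def field_simps)
    also have "N + real j = (real n + 2 * real j) / 2" by (simp add: N_def add_divide_distrib)
    also have "\<nu> - (real n + 2 * real j) / \<alpha> = (\<alpha> * \<nu> - real n - 2 * real j) / \<alpha>"
      using \<alpha> by (simp add: field_simps)
    finally have "A2_term \<alpha> \<nu> n z j = complex_of_real (\<beta> * Gamma \<nu> * b2 j) * (z ^ j / 2 ^ (2 * j))"
      unfolding A2_term_def by (simp only:)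
    then show "A2_term \<alpha> \<nu> n z j = c2 j * z ^ j"
      unfolding c2_def by simp
  qed
  have S1: "summable (\<lambda>l. norm (c1 l) * x ^ l)" if "x > 0" for x
  proof -
    have "norm (c1 l) * x ^ l = Gamma \<nu> * (\<bar>b1 l\<bar> * (x / 2 powr \<alpha>) ^ l)" for l
      using G\<nu> by (simp add: c1_def norm_mult norm_divide power_divide powr_realpow[symmetric] powr_powr)
    then show ?thesis using summable_mult[OF summable_b1_power[of "x / 2 powr \<alpha>"], of "Gamma \<nu>"] that by (simp only: divide_pos_pos powr_gt_zero)
  qed
  have S2: "summable (\<lambda>j. norm (c2 j) * x ^ j)" if "x > 0" for x
  proof -
    have "norm (c2 j) * x ^ j = \<beta> * Gamma \<nu> * (\<bar>b2 j\<bar> * (x / 4) ^ j)" for j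
      using G\<nu> pos(1) by (simp add: c2_def norm_mult norm_divide norm_power power_divide power_mult)
    then show ?thesis using summable_mult[OF summable_b2[of "x / 4"], of "\<beta> * Gamma \<nu>"] that by simp
  qed
  note E1 = entire_power_series[OF S1] and E2 = entire_power_series[OF S2]
  have A1: "A1 \<alpha> \<nu> n = (\<lambda>z. \<Sum>l. c1 l * z ^ l)" by (simp add: fun_eq_iff A1_def A1t)
  have A2: "A2 \<alpha> \<nu> n = (\<lambda>z. complex_of_real (2 / \<alpha>) * (\<Sum>j. c2 j * z ^ j))" by (simp add: fun_eq_iff A2_def A2t)
  have val: "complex_of_real (radial_value p r) =
            complex_of_real (1 / (2 ^ n * pi powr (real n / 2) * Gamma \<nu>)) *
            (complex_of_real (r powr (\<alpha> * \<nu> - real n) / 2 powr (\<alpha> * \<nu> - real n))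
               * A1 \<alpha> \<nu> n (complex_of_real (r powr \<alpha>))
             + A2 \<alpha> \<nu> n (complex_of_real (r ^ 2)))" if r: "r > 0" for r
  proof -
    have p: "linnik_density (2 * \<beta>) \<nu> p" using assms(12) by (simp add: \<beta>_def)
    have pg: "p x = g (r\<^sup>2)" if "norm x = r" for x
      using linnik_density_eq_g[OF p, of x] that r assms(1) by (auto simp: N_def)
    obtain x0 :: "real ^ 'n" where x0: "norm x0 = r"
      using vector_choose_size[of r] r by auto
    \<comment> \<open>The witness \<open>x0\<close> is needed for uniqueness: without a point of
      norm \<open>r\<close> every value would satisfy the description.\<close>
    have rv: "radial_value p r = g (r\<^sup>2)"
      unfolding radial_value_def using pg x0 by (intro the_equality) auto
    \<comment> \<open>Passing from \<open>r\<^sup>2 / 4\<close> to \<open>r / 2\<close> doubles the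
      exponents, which turns \<open>\<beta>\<close> and \<open>N\<close> into
      \<open>\<alpha>\<close> and \<open>n\<close>.\<close>
    have q: "r\<^sup>2 / 4 = (r / 2) powr 2" using r by (simp add: power_divide)
    have s1: "summable (\<lambda>l. b1 l * (r\<^sup>2 / 4) powr (\<beta> * (\<nu> + real l) - N))"
      using summable_b1[of "r\<^sup>2 / 4"] r by - (rule summable_rabs_cancel, simp add: abs_mult)
    have s2: "summable (\<lambda>j. b2 j * (r\<^sup>2 / 4) ^ j)"
      using summable_b2[of "r\<^sup>2 / 4"] r by - (rule summable_rabs_cancel, simp add: abs_mult)
    have 1: "complex_of_real (r powr (\<alpha> * \<nu> - real n) / 2 powr (\<alpha> * \<nu> - real n)) * A1 \<alpha> \<nu> n (complex_of_real (r powr \<alpha>)) =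
       complex_of_real (Gamma \<nu> * (\<Sum>l. b1 l * (r\<^sup>2 / 4) powr (\<beta> * (\<nu> + real l) - N)))"
    proof -
      have t: "complex_of_real (r powr (\<alpha> * \<nu> - real n) / 2 powr (\<alpha> * \<nu> - real n)) * (c1 l * complex_of_real (r powr \<alpha>) ^ l) =
        complex_of_real (Gamma \<nu> * (b1 l * (r\<^sup>2 / 4) powr (\<beta> * (\<nu> + real l) - N)))" for l
      proof -
        have "2 * (\<beta> * (\<nu> + real l) - N) = \<alpha> * \<nu> - real n + \<alpha> * real l"
          by (simp add: \<beta>_def N_def field_simps)
        then have "(r\<^sup>2 / 4) powr (\<beta> * (\<nu> + real l) - N) = (r / 2) powr (\<alpha> * \<nu> - real n + \<alpha> * real l)"
          unfolding q powr_powr by (simp only:)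
        also have "\<dots> = r powr (\<alpha> * \<nu> - real n) / 2 powr (\<alpha> * \<nu> - real n) * ((r powr \<alpha>) ^ l / 2 powr (\<alpha> * real l))"
          using r by (simp add: powr_add powr_divide powr_realpow[symmetric] powr_powr)
        finally have *: "(r\<^sup>2 / 4) powr (\<beta> * (\<nu> + real l) - N) =
            r powr (\<alpha> * \<nu> - real n) / 2 powr (\<alpha> * \<nu> - real n) * ((r powr \<alpha>) ^ l / 2 powr (\<alpha> * real l))" .
        show ?thesis unfolding c1_def of_real_power[symmetric] of_real_mult[symmetric] * by simp
      qed
      have "complex_of_real (r powr (\<alpha> * \<nu> - real n) / 2 powr (\<alpha> * \<nu> - real n)) * A1 \<alpha> \<nu> n (complex_of_real (r powr \<alpha>)) =
        (\<Sum>l. complex_of_real (r powr (\<alpha> * \<nu> - real n) / 2 powr (\<alpha> * \<nu> - real n)) * (c1 l * complex_of_real (r powr \<alpha>) ^ l))"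
        unfolding A1 by (rule suminf_mult[symmetric]) (rule E1(1))
      also have "\<dots> = complex_of_real (\<Sum>l. Gamma \<nu> * (b1 l * (r\<^sup>2 / 4) powr (\<beta> * (\<nu> + real l) - N)))"
        unfolding t by (rule suminf_of_real[symmetric]) (rule summable_mult[OF s1])
      also have "(\<Sum>l. Gamma \<nu> * (b1 l * (r\<^sup>2 / 4) powr (\<beta> * (\<nu> + real l) - N))) = Gamma \<nu> * (\<Sum>l. b1 l * (r\<^sup>2 / 4) powr (\<beta> * (\<nu> + real l) - N))"
        by (rule suminf_mult[OF s1])
      finally show ?thesis .
    qed
    have 2: "A2 \<alpha> \<nu> n (complex_of_real (r ^ 2)) = complex_of_real (Gamma \<nu> * (\<Sum>j. b2 j * (r\<^sup>2 / 4) ^ j))"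
    proof -
      have t: "complex_of_real (2 / \<alpha>) * (c2 j * complex_of_real (r ^ 2) ^ j) = complex_of_real (Gamma \<nu> * (b2 j * (r\<^sup>2 / 4) ^ j))" for j
      proof -
        have *: "2 / \<alpha> * (\<beta> * Gamma \<nu> * b2 j / 2 ^ (2 * j) * (r\<^sup>2) ^ j) = Gamma \<nu> * (b2 j * (r\<^sup>2 / 4) ^ j)"
          using \<alpha> by (simp add: power_divide power_mult \<beta>_def)
        show ?thesis unfolding c2_def of_real_power[symmetric] of_real_mult[symmetric] * ..
      qed
      have "A2 \<alpha> \<nu> n (complex_of_real (r ^ 2)) = (\<Sum>j. complex_of_real (2 / \<alpha>) * (c2 j * complex_of_real (r ^ 2) ^ j))"
        unfolding A2 by (rule suminf_mult[symmetric]) (rule E2(1))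
      also have "\<dots> = complex_of_real (\<Sum>j. Gamma \<nu> * (b2 j * (r\<^sup>2 / 4) ^ j))"
        unfolding t by (rule suminf_of_real[symmetric]) (rule summable_mult[OF s2])
      also have "(\<Sum>j. Gamma \<nu> * (b2 j * (r\<^sup>2 / 4) ^ j)) = Gamma \<nu> * (\<Sum>j. b2 j * (r\<^sup>2 / 4) ^ j)"
        by (rule suminf_mult[OF s2])
      finally show ?thesis .
    qed
    \<comment> \<open>The constants agree because \<open>4 powr N = 2 ^ n\<close>.\<close>
    have K: "1 / (2 ^ n * pi powr (real n / 2) * Gamma \<nu>) * Gamma \<nu> = (4 * pi) powr (- N)"
    proof -
      have "(4 :: real) powr N = (2 powr 2) powr N" by simp
      also have "\<dots> = 2 ^ n" unfolding powr_powr by (simp add: N_def powr_realpow)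
      finally have "(4 * pi) powr N = 2 ^ n * pi powr (real n / 2)" by (simp add: powr_mult N_def)
      then show ?thesis using G\<nu> by (simp add: powr_minus_divide)
    qed
    have "g (r\<^sup>2) = 1 / (2 ^ n * pi powr (real n / 2) * Gamma \<nu>) * (Gamma \<nu> * (\<Sum>l. b1 l * (r\<^sup>2 / 4) powr (\<beta> * (\<nu> + real l) - N)) + Gamma \<nu> * (\<Sum>j. b2 j * (r\<^sup>2 / 4) ^ j))"
      unfolding g_def K[symmetric] by (simp only: distrib_left mult.assoc)
    then show ?thesis unfolding rv 1 2 by (simp only: of_real_mult of_real_add)
  qed
  show ?thesis
    using E1 E2 val unfolding A1t A2t A1 A2 by (auto intro!: holomorphic_intros)
qed

end
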